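(* Let $U$ be the open unit ball in $\mathbb{C}^2$ centered at $0$ and let $Z_0=\partial U$ be the unit sphere. Let $H$ be a diffeomorphism of the closed ball $\overline{U}$ (onto its image in $\mathbb{C}^2$) that is biholomorphic on $U$, and let $Z=H(Z_0)$. Then $$\mathcal{Q}(Z)\ge 4\pi.$$
   Context: For a strongly pseudoconvex real hypersurface $Z\subset\mathbb{C}^2$ with defining function $\rho$, Fefferman's measure is $\mathcal{F}(Z)=\int_Z\sigma_Z$, where $\sigma_Z$ is the positive $3$-form on $Z$ uniquely determined by $$\sigma_Z\wedge d\rho = 2^{4/3} M(\rho)^{1/3}\,\omega_{\mathbb{C}^2},\qquad M(\rho)=-\det\begin{pmatrix}0&\rho_{z_j}\\ \rho_{\bar z_k}&\rho_{z_j\bar z_k}\end{pmatrix}_{1\le j,k\le 2},$$ with $\omega_{\mathbb{C}^2}$ the euclidean volume form and subscripts denoting differentiation; $\sigma_Z$ does not depend on the choice of $\rho$. If $Z$ is the compact boundary of a bounded domain, $\mathcal{V}(Z)$ denotes the euclidean volume enclosed by $Z$, and the isoperimetric quotient is $\mathcal{Q}(Z)=\mathcal{F}(Z)^{3/2}/\mathcal{V}(Z)$. *)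

theory Defs
  imports "HOL-Analysis.Analysis"
begin

section \<open>Smooth maps, diffeomorphisms, biholomorphic maps\<close>

text \<open>\<open>C\<^sup>k\<close> and \<open>C\<^sup>\<infinity>\<close> on an open set, by iterating directional derivatives
  (these are continuous for all directions iff the Frechet derivative is).\<close>

primrec Ck_on ::
  "nat \<Rightarrow> 'a::euclidean_space set \<Rightarrow> ('a \<Rightarrow> 'b::euclidean_space) \<Rightarrow> bool" where
  "Ck_on 0 S f \<longleftrightarrow> continuous_on S f"
| "Ck_on (Suc k) S f \<longleftrightarrow> (\<forall>x\<in>S. f differentiable (at x)) \<and>
     (\<forall>v. Ck_on k S (\<lambda>x. frechet_derivative f (at x) v))"

definition smooth_on_open ::
  "'a::euclidean_space set \<Rightarrow> ('a \<Rightarrow> 'b::euclidean_space) \<Rightarrow> bool" where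
  "smooth_on_open S f \<longleftrightarrow> open S \<and> (\<forall>k. Ck_on k S f)"

text \<open>Smoothness on an arbitrary set, such as a closed ball, means having a smooth extension
  to an open neighbourhood.\<close>

definition smooth_map_on ::
  "'a::euclidean_space set \<Rightarrow> ('a \<Rightarrow> 'b::euclidean_space) \<Rightarrow> bool" where
  "smooth_map_on K f \<longleftrightarrow>
     (\<exists>W F. K \<subseteq> W \<and> smooth_on_open W F \<and> (\<forall>x\<in>K. F x = f x))"

definition diffeomorphism_onto_image ::
  "'a::euclidean_space set \<Rightarrow> ('a \<Rightarrow> 'b::euclidean_space) \<Rightarrow> bool" where
  "diffeomorphism_onto_image K f \<longleftrightarrow>
     inj_on f K \<and> smooth_map_on K f \<and> smooth_map_on (f ` K) (inv_into K f)"

definition holomorphic_map_on :: "(complex^'n) set \<Rightarrow> (complex^'n \<Rightarrow> complex^'m) \<Rightarrow> bool" where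
  "holomorphic_map_on S f \<longleftrightarrow> open S \<and>
     (\<forall>p\<in>S. \<exists>L. (f has_derivative L) (at p) \<and> (\<forall>c v. L (c *s v) = c *s L v))"

definition biholomorphic_on :: "(complex^'n) set \<Rightarrow> (complex^'n \<Rightarrow> complex^'n) \<Rightarrow> bool" where
  "biholomorphic_on S f \<longleftrightarrow>
     inj_on f S \<and> holomorphic_map_on S f \<and> holomorphic_map_on (f ` S) (inv_into S f)"


section \<open>Strongly pseudoconvex hypersurfaces\<close>

definition d_z :: "'n::finite \<Rightarrow> (complex^'n \<Rightarrow> complex) \<Rightarrow> complex^'n \<Rightarrow> complex" where
  "d_z j f p =
     (frechet_derivative f (at p) (axis j 1) - \<i> * frechet_derivative f (at p) (axis j \<i>)) / 2"

definition d_zbar :: "'n::finite \<Rightarrow> (complex^'n \<Rightarrow> complex) \<Rightarrow> complex^'n \<Rightarrow> complex" where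
  "d_zbar j f p =
     (frechet_derivative f (at p) (axis j 1) + \<i> * frechet_derivative f (at p) (axis j \<i>)) / 2"

definition defining_function :: "(complex^2 \<Rightarrow> real) \<Rightarrow> (complex^2) set \<Rightarrow> bool" where
  "defining_function \<rho> Z \<longleftrightarrow>
     (\<exists>N. smooth_on_open N \<rho> \<and> Z = {p\<in>N. \<rho> p = 0} \<and>
          (\<forall>p\<in>Z. \<exists>v. frechet_derivative \<rho> (at p) v \<noteq> 0))"

definition levi_form :: "(complex^2 \<Rightarrow> real) \<Rightarrow> complex^2 \<Rightarrow> complex^2 \<Rightarrow> complex" where
  "levi_form \<rho> p w =
     (\<Sum>j\<in>UNIV. \<Sum>k\<in>UNIV. d_z j (d_zbar k (\<lambda>q. of_real (\<rho> q))) p * (w $ j) * cnj (w $ k))"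

text \<open>Of \<open>\<rho>\<close> and \<open>-\<rho>\<close> at most one satisfies this positivity condition; thus it also fixes the
  side of \<open>Z\<close> on which \<open>\<rho>\<close> is negative. The Levi form is real.\<close>

definition strongly_psc_defining_function :: "(complex^2 \<Rightarrow> real) \<Rightarrow> (complex^2) set \<Rightarrow> bool" where
  "strongly_psc_defining_function \<rho> Z \<longleftrightarrow> defining_function \<rho> Z \<and>
     (\<forall>p\<in>Z. \<forall>w. w \<noteq> 0 \<longrightarrow> (\<Sum>j\<in>UNIV. d_z j (\<lambda>q. of_real (\<rho> q)) p * (w $ j)) = 0
        \<longrightarrow> Re (levi_form \<rho> p w) > 0)"


section \<open>Exterior algebra on \<open>\<complex>\<^sup>2 = \<real>\<^sup>4\<close>\<close>

type_synonym c2 = "complex^2"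

definition alternating3 :: "(c2 \<Rightarrow> c2 \<Rightarrow> c2 \<Rightarrow> real) \<Rightarrow> bool" where
  "alternating3 s \<longleftrightarrow>
     (\<forall>u v. linear (\<lambda>x. s x u v) \<and> linear (\<lambda>x. s u x v) \<and> linear (\<lambda>x. s u v x)) \<and>
     (\<forall>u v. s u u v = 0 \<and> s u v u = 0 \<and> s v u u = 0)"

text \<open>Wedge product of a 3-form with a 1-form (sum over shuffles).\<close>

definition wedge31 ::
  "(c2 \<Rightarrow> c2 \<Rightarrow> c2 \<Rightarrow> real) \<Rightarrow> (c2 \<Rightarrow> real) \<Rightarrow> c2 \<Rightarrow> c2 \<Rightarrow> c2 \<Rightarrow> c2 \<Rightarrow> real" where
  "wedge31 s a v1 v2 v3 v4 =
     s v1 v2 v3 * a v4 - s v1 v2 v4 * a v3 + s v1 v3 v4 * a v2 - s v2 v3 v4 * a v1"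

text \<open>The euclidean volume form \<open>dx\<^sub>1 \<and> dy\<^sub>1 \<and> dx\<^sub>2 \<and> dy\<^sub>2\<close>.\<close>

definition real_coords :: "c2 \<Rightarrow> real^4" where
  "real_coords v = vector [Re (v $ 1), Im (v $ 1), Re (v $ 2), Im (v $ 2)]"

definition vol_form :: "c2 \<Rightarrow> c2 \<Rightarrow> c2 \<Rightarrow> c2 \<Rightarrow> real" where
  "vol_form v1 v2 v3 v4 =
     det (vector [real_coords v1, real_coords v2, real_coords v3, real_coords v4] :: real^4^4)"


section \<open>Fefferman's measure\<close>

text \<open>The matrix is hermitian, so its determinant is real.\<close>

definition fefferman_M :: "(c2 \<Rightarrow> real) \<Rightarrow> c2 \<Rightarrow> real" where
  "fefferman_M \<rho> p =
     (let r = (\<lambda>q. complex_of_real (\<rho> q)) in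
      - Re (det (vector
         [vector [0,            d_z 1 r p,              d_z 2 r p],
          vector [d_zbar 1 r p, d_z 1 (d_zbar 1 r) p,   d_z 2 (d_zbar 1 r) p],
          vector [d_zbar 2 r p, d_z 1 (d_zbar 2 r) p,   d_z 2 (d_zbar 2 r) p]] :: complex^3^3)))"

text \<open>A 3-form on \<open>Z\<close> is represented by a pointwise family of alternating forms on the ambient
  space. The defining equation leaves such an ambient form free up to terms \<open>\<beta> \<and> d\<rho>\<close>, which
  vanish on tangent vectors of \<open>Z\<close>; it determines \<open>\<sigma>\<close> uniquely as a form on \<open>Z\<close>.\<close>

definition fefferman_form ::
  "(c2 \<Rightarrow> real) \<Rightarrow> c2 set \<Rightarrow> (c2 \<Rightarrow> c2 \<Rightarrow> c2 \<Rightarrow> c2 \<Rightarrow> real) \<Rightarrow> bool" where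
  "fefferman_form \<rho> Z \<sigma> \<longleftrightarrow>
     (\<forall>p\<in>Z. alternating3 (\<sigma> p) \<and>
        (\<forall>v1 v2 v3 v4. wedge31 (\<sigma> p) (frechet_derivative \<rho> (at p)) v1 v2 v3 v4
            = 2 powr (4/3) * fefferman_M \<rho> p powr (1/3) * vol_form v1 v2 v3 v4))"

definition pullback3 ::
  "(c2 \<Rightarrow> c2 \<Rightarrow> c2 \<Rightarrow> c2 \<Rightarrow> real) \<Rightarrow> (real^3 \<Rightarrow> c2) \<Rightarrow> real^3 \<Rightarrow> real" where
  "pullback3 \<sigma> \<phi> t =
     \<sigma> (\<phi> t) (frechet_derivative \<phi> (at t) (axis 1 1)) (frechet_derivative \<phi> (at t) (axis 2 1))
        (frechet_derivative \<phi> (at t) (axis 3 1))"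

text \<open>Local parametrizations of \<open>Z\<close> that are positively oriented for the orientation in which
  \<open>\<sigma>\<close> is a positive form. Positivity of the pullback makes \<open>\<phi>\<close> an immersion.\<close>

definition positive_chart ::
  "c2 set \<Rightarrow> (c2 \<Rightarrow> c2 \<Rightarrow> c2 \<Rightarrow> c2 \<Rightarrow> real) \<Rightarrow> (real^3) set \<Rightarrow> (real^3 \<Rightarrow> c2) \<Rightarrow> bool" where
  "positive_chart Z \<sigma> W \<phi> \<longleftrightarrow> smooth_on_open W \<phi> \<and> inj_on \<phi> W \<and> \<phi> ` W \<subseteq> Z \<and>
     (\<forall>t\<in>W. pullback3 \<sigma> \<phi> t > 0)"

text \<open>\<open>I\<close> is the integral over \<open>Z\<close> of the positive form \<open>\<sigma>\<close>: cut \<open>Z\<close> into countably many disjoint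
  Borel pieces, each lying in a chart, and add up the integrals of the pullbacks.\<close>

definition has_form_integral ::
  "(c2 \<Rightarrow> c2 \<Rightarrow> c2 \<Rightarrow> c2 \<Rightarrow> real) \<Rightarrow> c2 set \<Rightarrow> real \<Rightarrow> bool" where
  "has_form_integral \<sigma> Z I \<longleftrightarrow>
     (\<exists>\<phi> W A. (\<forall>i::nat. positive_chart Z \<sigma> (W i) (\<phi> i) \<and> A i \<in> sets borel \<and> A i \<subseteq> W i \<and>
                 set_integrable lborel (A i) (pullback3 \<sigma> (\<phi> i))) \<and>
        disjoint_family (\<lambda>i. \<phi> i ` A i) \<and> (\<Union>i. \<phi> i ` A i) = Z \<and>
        (\<lambda>i. set_lebesgue_integral lborel (A i) (pullback3 \<sigma> (\<phi> i))) sums I)"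

text \<open>The value does not depend on the choice of \<open>\<rho>\<close>, of \<open>\<sigma>\<close> or of the charts.\<close>

definition fefferman_measure :: "c2 set \<Rightarrow> real" where
  "fefferman_measure Z =
     (THE I. \<exists>\<rho> \<sigma>. strongly_psc_defining_function \<rho> Z \<and> fefferman_form \<rho> Z \<sigma> \<and>
                has_form_integral \<sigma> Z I)"

text \<open>The library's \<^const>\<open>inside\<close> is the union of the bounded components of the complement.\<close>

definition enclosed_volume :: "c2 set \<Rightarrow> real" where
  "enclosed_volume Z = measure lebesgue (inside Z)"

definition isoperimetric_quotient :: "c2 set \<Rightarrow> real" where
  "isoperimetric_quotient Z = fefferman_measure Z powr (3/2) / enclosed_volume Z"

end

theory Submission
  imports Defs "HOL-Complex_Analysis.Cauchy_Integral_Formula"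
begin

text \<open>Let \<open>g\<close> be the complex Jacobian of the smooth extension of \<open>H\<close> to the closed ball. In terms
  of integrals pulled back to the unit sphere \<open>S\<close>, Fefferman's measure is \<open>2 powr (1/3)\<close> times the
  integral of \<open>\<bar>g\<bar> powr (4/3)\<close> over \<open>S\<close>, and the enclosed volume is the integral of \<open>\<bar>g\<bar>\<^sup>2\<close> over the
  ball \<open>B\<close>. As \<open>g\<close> has no zeros, \<open>g = e\<^sup>3\<close> with \<open>e\<close> holomorphic, and for normalised measures it
  suffices that the mean of \<open>\<bar>e\<bar>\<^sup>6\<close> over \<open>B\<close> is at most \<open>2 M\<^sup>3\<close>, where \<open>M\<^sup>2\<close> is the mean of \<open>\<bar>e\<bar>\<^sup>4\<close> over
  \<open>S\<close>. (The factor 2 is a slack: for the unit sphere the quotient is \<open>8\<pi>\<close>.)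

  Let \<open>R\<close> be the Euler vector field. Since \<open>\<bar>R e\<^sup>3\<bar>\<^sup>2 = 9 \<bar>e\<bar>\<^sup>4 \<bar>R e\<bar>\<^sup>2\<close> is \<open>9/8\<close> times the geometric mean of
  \<open>\<bar>R e\<^sup>2\<bar>\<^sup>2\<close> and \<open>\<bar>R e\<^sup>4\<bar>\<^sup>2\<close>, AM-GM bounds it by a weighted sum of these two, with weights depending
  on \<open>t = \<bar>z\<bar>\<^sup>2\<close>. After integration over the ball the left side controls the Bergman norm of \<open>e\<^sup>3\<close>,
  the first term on the right is controlled by the Hardy norm of \<open>f = e\<^sup>2\<close>, and the second by the
  norm of \<open>f\<^sup>2\<close> in the Bergman space with kernel \<open>(1 - \<langle>z,w\<rangle>)\<^sup>-\<^sup>4\<close>, which is at most the square of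
  the Hardy norm of \<open>f\<close>. Polynomial approximation reduces general \<open>e\<close> to polynomials.\<close>

text \<open>On the sphere in C^2 the Hardy space has kernel (1 - <z,w>)^-2, and the Bergman space of
  the ball has (1 - <z,w>)^-3. With f = e^2, the Bergman norm of f^(3/2) is to be bounded by the
  Hardy norm of f. Integer powers are handled by multiplying kernels, which sends f^2 to exponent 4;
  the power 3/2 lies in between, and the pointwise AM-GM step interpolates between the exponents 2
  and 4. The Euler field suits this because it turns e^2, e^3, e^4 into multiples of one derivative
  and acts on homogeneous parts as a scalar.

  The other obstacle is the boundary: the map is holomorphic only inside and merely smooth up to the
  sphere, whereas the Levi form needs second derivatives on the sphere. The Cauchy-Riemann
  identities are carried there by continuity. Since \<open>fefferman_measure\<close> is a definite
  description, a defining function, a form and charts must be constructed, and the value must be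
  computed for arbitrary ones. Surface measure is avoided by extending densities constantly along
  radii: a sphere integral is four times a ball integral.\<close>

section \<open>The inequality for power series\<close>

text \<open>A polynomial in \<open>z\<^sub>1, z\<^sub>2\<close> is a polynomial in \<open>z\<^sub>2\<close> with coefficients in \<open>\<complex>[z\<^sub>1]\<close>;
  \<open>mono_wt m n\<close> is the mean of \<open>\<bar>z\<^sub>1\<^sup>m z\<^sub>2\<^sup>n\<bar>\<^sup>2\<close> over the unit sphere.\<close>

definition mono_wt :: "nat \<Rightarrow> nat \<Rightarrow> real" where
  "mono_wt m n = fact m * fact n / fact (m + n + 1)"

lemma mono_wt_pos: "mono_wt m n > 0"
  by (simp add: mono_wt_def)

definition cf :: "complex poly poly \<Rightarrow> nat \<Rightarrow> nat \<Rightarrow> complex" where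
  "cf P m n = coeff (coeff P n) m"

lemma cf_mult: "cf (P * Q) m n = (\<Sum>j\<le>n. \<Sum>i\<le>m. cf P i j * cf Q (m - i) (n - j))"
  by (simp add: cf_def coeff_mult coeff_sum)

text \<open>A squared norm: monomials are orthogonal on the sphere, so this is the mean over the
  unit sphere of the squared modulus of the homogeneous part of degree \<open>k\<close>.\<close>

definition hom_norm :: "nat \<Rightarrow> complex poly poly \<Rightarrow> real" where
  "hom_norm k P = (\<Sum>m\<le>k. (cmod (cf P m (k - m)))\<^sup>2 * mono_wt m (k - m))"

lemma hom_norm_nonneg: "hom_norm k P \<ge> 0"
  unfolding hom_norm_def by (intro sum_nonneg mult_nonneg_nonneg less_imp_le[OF mono_wt_pos]) auto

text \<open>The right side is the coefficient of (1 - x - y)^-2 at x^i y^j: squared norms of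
  monomials and coefficients of the Hardy kernel are reciprocal.\<close>

lemma inverse_mono_wt:
  "1 / mono_wt i j = real ((i + j + 1) * ((i + j) choose i))"
proof -
  have "fact (i + j) = fact i * fact j * real ((i + j) choose i)"
    using binomial_fact_lemma[of i "i + j"] by (metis add_diff_cancel_left' le_add1 of_nat_fact of_nat_mult)
  thus ?thesis by (simp add: mono_wt_def field_simps)
qed

lemma choose_3: "real ((k + 3) choose 3) = (real k + 1) * (real k + 2) * (real k + 3) / 6"
proof (induction k)
  case (Suc k)
  have "(Suc k + 3) choose 3 = ((k + 3) choose 2) + ((k + 3) choose 3)"
    using binomial_Suc_Suc[of "k + 3" 2] by (simp add: eval_nat_numeral)
  moreover have "real ((k + 3) choose 2) = (real k + 3) * (real k + 2) / 2"
  proof -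
    have "even ((k + 3) * (k + 2))" by auto
    thus ?thesis unfolding choose_two by (simp add: real_of_nat_div algebra_simps)
  qed
  ultimately show ?case using Suc by (simp add: field_simps)
qed (simp add: eval_nat_numeral)

text \<open>Compares coefficients in (1 - x)^-2 (1 - x)^-2 = (1 - x)^-4.\<close>

lemma sum_product_linear: "(\<Sum>l\<le>k. (l + 1) * (k - l + 1)) = ((k + 3) choose 3)"
proof -
  have "(\<Sum>l\<le>k. (real l + 1) * ((real k - real l) + 1)) = (real k + 1) * (real k + 2) * (real k + 3) / 6"
  proof -
    \<comment> \<open>Freeing \<open>c\<close> from \<open>k\<close> makes the induction work: the
      upper limit varies while the second factor stays fixed.\<close>
    have a: "(\<Sum>l\<le>k. (real l + 1) * (c - real l)) = (real k + 1) * (real k + 2) * (3 * c - 2 * real k) / 6" for c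
      by (induction k) (auto simp: field_simps)
    show ?thesis using a[of "real k + 1"] by (simp add: algebra_simps)
  qed
  moreover have "real (\<Sum>l\<le>k. (l + 1) * (k - l + 1)) = (\<Sum>l\<le>k. (real l + 1) * (real k - real l + 1))"
    unfolding of_nat_sum by (intro sum.cong refl) (simp only: of_nat_mult of_nat_add of_nat_1 of_nat_diff atMost_iff)
  ultimately show ?thesis using choose_3[of k] by (metis of_nat_eq_iff)
qed

text \<open>The square of (1 - x - y)^-2 is (1 - x - y)^-4, read at x^m y^n. Grouping the terms by
  the degree l = i + j of the first factor leaves Vandermonde's convolution in \<open>i\<close>; the
  remaining sum over \<open>l\<close> is \<open>sum_product_linear\<close>.\<close>

lemma sum_inverse_mono_wt:
  "(\<Sum>j\<le>n. \<Sum>i\<le>m. 1 / (mono_wt i j * mono_wt (m - i) (n - j)))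
     = real (((m + n) choose m) * ((m + n + 3) choose 3))"
proof -
  define k where "k = m + n"
  define T where "T l i = (l + 1) * (k - l + 1) * ((l choose i) * ((k - l) choose (m - i)))" for l i
  have "(\<Sum>j\<le>n. \<Sum>i\<le>m. 1 / (mono_wt i j * mono_wt (m - i) (n - j))) = (\<Sum>j\<le>n. \<Sum>i\<le>m. real (T (i + j) i))"
  proof (intro sum.cong refl)
    fix i j assume "j \<in> {..n}" "i \<in> {..m}"
    hence e: "m - i + (n - j) = k - (i + j)" by (auto simp: k_def)
    have "1 / (mono_wt i j * mono_wt (m - i) (n - j)) = (1 / mono_wt i j) * (1 / mono_wt (m - i) (n - j))" by simp
    also have "\<dots> = real (T (i + j) i)"
      unfolding inverse_mono_wt e T_def of_nat_mult by (simp only: mult_ac)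
    finally show "1 / (mono_wt i j * mono_wt (m - i) (n - j)) = real (T (i + j) i)" .
  qed
  also have "\<dots> = (\<Sum>(j,i)\<in>{..n}\<times>{..m}. real (T (i + j) i))" by (simp add: sum.cartesian_product)
  also have "\<dots> = (\<Sum>(l,i)\<in>{(l,i). l \<le> k \<and> i \<le> m \<and> i \<le> l \<and> l - i \<le> n}. real (T l i))"
    by (rule sum.reindex_bij_witness[of _ "\<lambda>(l,i). (l - i, i)" "\<lambda>(j,i). (i + j, i)"]) (auto simp: k_def)
  \<comment> \<open>The index set grows to a full rectangle because one of the two binomials
    vanishes at every added point.\<close>
  also have "\<dots> = (\<Sum>(l,i)\<in>{..k}\<times>{..m}. real (T l i))"
  proof (rule sum.mono_neutral_left)
    show "\<forall>x\<in>{..k}\<times>{..m} - {(l,i). l \<le> k \<and> i \<le> m \<and> i \<le> l \<and> l - i \<le> n}. (case x of (l,i) \<Rightarrow> real (T l i)) = 0"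
    proof safe
      fix l i assume h: "l \<le> k" "i \<le> m" and "real (T l i) \<noteq> 0"
      hence "l choose i \<noteq> 0" "(k - l) choose (m - i) \<noteq> 0" by (auto simp: T_def simp del: of_nat_mult of_nat_add)
      hence "i \<le> l" "m - i \<le> k - l" by (metis binomial_eq_0 not_le)+
      thus "i \<le> l" "l - i \<le> n" using h by (auto simp: k_def)
    qed
  qed auto
  also have "\<dots> = (\<Sum>l\<le>k. \<Sum>i\<le>m. real (T l i))" by (simp add: sum.cartesian_product)
  also have "\<dots> = (\<Sum>l\<le>k. real ((l + 1) * (k - l + 1) * (k choose m)))"
  proof (intro sum.cong refl)
    fix l assume "l \<in> {..k}"
    hence "(\<Sum>i\<le>m. (l choose i) * ((k - l) choose (m - i))) = k choose m"
      using vandermonde[of l "k-l" m] by simp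
    hence "(\<Sum>i\<le>m. T l i) = (l + 1) * (k - l + 1) * (k choose m)"
      unfolding T_def sum_distrib_left[symmetric] by simp
    thus "(\<Sum>i\<le>m. real (T l i)) = real ((l + 1) * (k - l + 1) * (k choose m))"
      by (metis of_nat_sum)
  qed
  also have "\<dots> = real ((k choose m) * (\<Sum>l\<le>k. (l + 1) * (k - l + 1)))"
    by (simp add: sum_distrib_left sum_distrib_right algebra_simps)
  finally show ?thesis unfolding sum_product_linear by (simp add: k_def)
qed

text \<open>For kernel exponent 4 the squared norm of a monomial of degree k = m + n is its Hardy
  value times 6/((k+2)(k+3)); again it is reciprocal to the kernel coefficient.\<close>

lemma mono_wt_binomial:
  "mono_wt m n * (6 / ((real (m + n) + 2) * (real (m + n) + 3))) * real (((m + n) choose m) * ((m + n + 3) choose 3)) = 1"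
proof -
  define k where "k = real (m + n)"
  define x where "x = real ((m + n) choose m)"
  have k: "k \<ge> 0" by (simp add: k_def)
  have 1: "real ((m + n + 3) choose 3) = (k + 1) * (k + 2) * (k + 3) / 6"
    using choose_3[of "m+n"] by (simp only: k_def)
  have 2: "mono_wt m n * ((k + 1) * x) = 1"
    using inverse_mono_wt[of m n] mono_wt_pos[of m n] by (auto simp: field_simps k_def x_def)
  have "mono_wt m n * (6 / ((k + 2) * (k + 3))) * (x * ((k + 1) * (k + 2) * (k + 3) / 6))
     = (mono_wt m n * ((k + 1) * x)) * (((k + 2) * (k + 3)) / ((k + 2) * (k + 3)))"
    by (simp add: divide_simps)
  also have "\<dots> = 1" unfolding 2 using k by (simp add: add_nonneg_eq_0_iff)
  finally show ?thesis using 1 by (simp only: k_def x_def of_nat_mult)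
qed

text \<open>Cauchy-Schwarz for the convolution of coefficients, with the monomial weights split off:
  the sum of the squares of \<open>b\<close> is the kernel coefficient at (m,n), which
  \<open>mono_wt_binomial\<close> cancels against the weight on the left.\<close>

lemma cf_square_bound:
  "(cmod (cf (P * P) m n))\<^sup>2 * mono_wt m n * (6 / ((real (m + n) + 2) * (real (m + n) + 3)))
    \<le> (\<Sum>j\<le>n. \<Sum>i\<le>m. ((cmod (cf P i j))\<^sup>2 * mono_wt i j) * ((cmod (cf P (m-i) (n-j)))\<^sup>2 * mono_wt (m-i) (n-j)))"
proof -
  let ?I = "{..n} \<times> {..m}"
  define a where "a = (\<lambda>(j,i). cmod (cf P i j) * cmod (cf P (m-i) (n-j)) * sqrt (mono_wt i j * mono_wt (m-i) (n-j)))"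
  define b where "b = (\<lambda>(j,i). 1 / sqrt (mono_wt i j * mono_wt (m-i) (n-j)))"
  have "cmod (cf (P * P) m n) \<le> (\<Sum>(j,i)\<in>?I. cmod (cf P i j * cf P (m - i) (n - j)))"
    unfolding cf_mult sum.cartesian_product by (rule order.trans[OF norm_sum]) (simp add: case_prod_unfold)
  also have "\<dots> = (\<Sum>x\<in>?I. a x * b x)"
    by (intro sum.cong refl) (auto simp: a_def b_def norm_mult mono_wt_pos less_imp_neq[OF mono_wt_pos, symmetric])
  finally have "(cmod (cf (P * P) m n))\<^sup>2 \<le> (\<Sum>x\<in>?I. a x * b x)\<^sup>2" by (simp add: power_mono)
  also have "\<dots> \<le> (\<Sum>x\<in>?I. (a x)\<^sup>2) * (\<Sum>x\<in>?I. (b x)\<^sup>2)" by (rule Cauchy_Schwarz_ineq_sum)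
  also have "(\<Sum>x\<in>?I. (b x)\<^sup>2) = real (((m + n) choose m) * ((m + n + 3) choose 3))"
    unfolding sum_inverse_mono_wt[symmetric] sum.cartesian_product
    by (intro sum.cong refl) (auto simp: b_def power_divide mono_wt_pos less_imp_le)
  finally have "(cmod (cf (P * P) m n))\<^sup>2 * (mono_wt m n * (6 / ((real (m + n) + 2) * (real (m + n) + 3))))
     \<le> ((\<Sum>x\<in>?I. (a x)\<^sup>2) * real (((m + n) choose m) * ((m + n + 3) choose 3))) * (mono_wt m n * (6 / ((real (m + n) + 2) * (real (m + n) + 3))))"
    by (rule mult_right_mono) (simp add: mono_wt_pos less_imp_le)
  also have "\<dots> = (\<Sum>x\<in>?I. (a x)\<^sup>2) * (mono_wt m n * (6 / ((real (m + n) + 2) * (real (m + n) + 3))) * real (((m + n) choose m) * ((m + n + 3) choose 3)))"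
    by (simp only: mult_ac)
  also have "\<dots> = (\<Sum>x\<in>?I. (a x)\<^sup>2)" by (simp only: mono_wt_binomial mult_1_right)
  also have "\<dots> = (\<Sum>(j,i)\<in>?I. ((cmod (cf P i j))\<^sup>2 * mono_wt i j) * ((cmod (cf P (m-i) (n-j)))\<^sup>2 * mono_wt (m-i) (n-j)))"
    by (intro sum.cong refl) (auto simp: a_def power_mult_distrib mono_wt_pos less_imp_le algebra_simps)
  finally show ?thesis by (simp add: sum.cartesian_product mult.assoc)
qed

text \<open>The restriction of \<open>H\<^sup>2 \<otimes> H\<^sup>2\<close> to the diagonal is the weighted Bergman space with kernel
  \<open>(1 - \<langle>z,w\<rangle>)\<^sup>-\<^sup>4\<close>, and restriction is a contraction.\<close>

lemma hom_norm_square_contractive: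
  "(\<Sum>k\<le>K. hom_norm k (P * P) * (6 / ((real k + 2) * (real k + 3)))) \<le> (\<Sum>k\<le>K. hom_norm k P)\<^sup>2"
proof -
  define q where "q i j = (cmod (cf P i j))\<^sup>2 * mono_wt i j" for i j
  have q0: "q i j \<ge> 0" for i j by (simp add: q_def less_imp_le mono_wt_pos)
  define S where "S = {(i,j). i + j \<le> K}"
  have fS: "finite S" by (rule finite_subset[of _ "{..K}\<times>{..K}"]) (auto simp: S_def)
  have tri: "(\<Sum>k\<le>K. \<Sum>m\<le>k. h m (k - m)) = (\<Sum>(i,j)\<in>S. h i j)" for h :: "nat \<Rightarrow> nat \<Rightarrow> real"
    by (subst sum.Sigma, simp, simp, rule sum.reindex_bij_witness[of _ "\<lambda>(i,j). (i+j,i)" "\<lambda>(k,m). (m,k-m)"]) (auto simp: S_def)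
  have "(\<Sum>k\<le>K. hom_norm k (P * P) * (6 / ((real k + 2) * (real k + 3))))
     \<le> (\<Sum>k\<le>K. \<Sum>m\<le>k. \<Sum>j\<le>k-m. \<Sum>i\<le>m. q i j * q (m-i) (k-m-j))"
    unfolding hom_norm_def sum_distrib_right
  proof (intro sum_mono)
    fix k m :: nat assume "m \<in> {..k}"
    thus "(cmod (cf (P * P) m (k - m)))\<^sup>2 * mono_wt m (k - m) * (6 / ((real k + 2) * (real k + 3)))
        \<le> (\<Sum>j\<le>k-m. \<Sum>i\<le>m. q i j * q (m-i) (k-m-j))"
      using cf_square_bound[of P m "k-m"] by (simp add: q_def)
  qed
  also have "\<dots> = (\<Sum>(m,n)\<in>S. \<Sum>j\<le>n. \<Sum>i\<le>m. q i j * q (m-i) (n-j))" by (rule tri)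
  also have "\<dots> = (\<Sum>(x,y)\<in>Sigma S (\<lambda>(m,n). {..m}\<times>{..n}). q (fst y) (snd y) * q (fst x - fst y) (snd x - snd y))"
  proof (subst sum.Sigma[symmetric], goal_cases)
    case 3
    show ?case
      by (intro sum.cong refl, clarsimp simp: case_prod_unfold, subst sum.swap) (simp add: sum.cartesian_product case_prod_unfold)
  qed (use fS in auto)
  also have "\<dots> = (\<Sum>(x,y)\<in>{(x,y). x \<in> S \<and> y \<in> S \<and> (fst x + fst y) + (snd x + snd y) \<le> K}. q (fst x) (snd x) * q (fst y) (snd y))"
    by (rule sum.reindex_bij_witness[of _ "\<lambda>(x,y). ((fst x + fst y, snd x + snd y), x)" "\<lambda>(x,y). (y, (fst x - fst y, snd x - snd y))"])
       (auto simp: S_def)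
  \<comment> \<open>Dropping the bound on the total degree adds only nonnegative terms and completes
    the square of the sum over \<open>S\<close>.\<close>
  also have "\<dots> \<le> (\<Sum>(x,y)\<in>S\<times>S. q (fst x) (snd x) * q (fst y) (snd y))"
    using fS by (intro sum_mono2) (auto simp: q0)
  also have "\<dots> = (\<Sum>(i,j)\<in>S. q i j)\<^sup>2"
    by (simp add: power2_eq_square sum_product sum.cartesian_product case_prod_unfold)
  also have "(\<Sum>(i,j)\<in>S. q i j) = (\<Sum>k\<le>K. hom_norm k P)"
    unfolding tri[symmetric] hom_norm_def q_def ..
  finally show ?thesis .
qed


section \<open>Beta integrals and radial weights\<close>

text \<open>The weight \<open>mono_wt\<close> is also Euler's beta value B(a+1, b+1), so one
  function serves for the sphere and for radial integrals. The induction step is integration by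
  parts, written as the derivative of t^(a+1) (1-t)^(b+1).\<close>

lemma has_integral_beta_nat:
  "((\<lambda>t::real. t ^ a * (1 - t) ^ b) has_integral mono_wt a b) {0..1}"
proof (induction b arbitrary: a)
  case 0
  have "((\<lambda>t::real. t ^ a) has_integral (1 ^ (Suc a) / real (Suc a) - 0 ^ (Suc a) / real (Suc a))) {0..1}"
    by (rule fundamental_theorem_of_calculus)
       (auto intro!: derivative_eq_intros simp flip: has_real_derivative_iff_has_vector_derivative simp del: power_Suc)
  thus ?case by (simp add: mono_wt_def)
next
  case (Suc b)
  have "((\<lambda>t::real. real (Suc a) * (t ^ a * (1 - t) ^ Suc b) - real (Suc b) * (t ^ Suc a * (1 - t) ^ b)) has_integral
       (1 ^ Suc a * (1 - 1) ^ Suc b - 0 ^ Suc a * (1 - 0) ^ Suc b)) {0..1}"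
    by (rule fundamental_theorem_of_calculus)
       (auto intro!: derivative_eq_intros simp flip: has_real_derivative_iff_has_vector_derivative simp del: power_Suc)
  from has_integral_add[OF this has_integral_mult_right[OF Suc.IH[of "Suc a"], of "real (Suc b)"]]
  have "((\<lambda>t::real. real (Suc a) * (t ^ a * (1 - t) ^ Suc b)) has_integral real (Suc b) * mono_wt (Suc a) b) {0..1}"
    by simp
  from has_integral_mult_right[OF this, of "1 / real (Suc a)"]
  have "((\<lambda>t::real. t ^ a * (1 - t) ^ Suc b) has_integral (real (Suc b) * mono_wt (Suc a) b / real (Suc a))) {0..1}"
    by simp
  also have "real (Suc b) * mono_wt (Suc a) b / real (Suc a) = mono_wt a (Suc b)"
    by (simp add: mono_wt_def divide_simps)
  finally show ?case .
qed

lemma mono_wt_values: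
  "mono_wt n 1 = 1 / ((real n + 1) * (real n + 2))"
  "mono_wt n 2 = 2 / ((real n + 1) * (real n + 2) * (real n + 3))"
  "mono_wt n 3 = 6 / ((real n + 1) * (real n + 2) * (real n + 3) * (real n + 4))"
  "mono_wt n 4 = 24 / ((real n + 1) * (real n + 2) * (real n + 3) * (real n + 4) * (real n + 5))"
  by (simp_all add: mono_wt_def eval_nat_numeral divide_simps) (simp_all add: algebra_simps)

text \<open>The factor k^2 comes from the Euler field, the exponent k - 1 from cancelling one power
  of t. Up to constants k^2 \<open>mono_wt (k - 1) j\<close> behaves like k^(1-j): Hardy for j = 1,
  Bergman for j = 2, kernel exponent 4 for j = 3.\<close>

lemma has_integral_weighted_series:
  fixes d :: "nat \<Rightarrow> real"
  shows "((\<lambda>t. (1 - t) ^ j * (1 + 4/3 * (1 - t)) * (\<Sum>k=1..K. (real k)\<^sup>2 * d k * t ^ (k - 1))) has_integral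
      (\<Sum>k=1..K. d k * ((real k)\<^sup>2 * (mono_wt (k - 1) j + 4/3 * mono_wt (k - 1) (Suc j))))) {0..1}"
proof -
  have "((\<lambda>t. \<Sum>k=1..K. d k * ((real k)\<^sup>2 * (t ^ (k-1) * (1 - t) ^ j + 4/3 * (t ^ (k-1) * (1 - t) ^ Suc j)))) has_integral
      (\<Sum>k=1..K. d k * ((real k)\<^sup>2 * (mono_wt (k - 1) j + 4/3 * mono_wt (k - 1) (Suc j))))) {0..1}"
    by (intro has_integral_sum has_integral_mult_right has_integral_add has_integral_beta_nat) auto
  moreover have "(\<Sum>k=1..K. d k * ((real k)\<^sup>2 * (t ^ (k-1) * (1 - t) ^ j + 4/3 * (t ^ (k-1) * (1 - t) ^ Suc j))))
     = (1 - t) ^ j * (1 + 4/3 * (1 - t)) * (\<Sum>k=1..K. (real k)\<^sup>2 * d k * t ^ (k - 1))" for t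
    unfolding sum_distrib_left by (intro sum.cong refl) (simp add: field_simps)
  ultimately show ?thesis by (simp only:)
qed

text \<open>The weight \<open>1 + 4/3 (1 - t)\<close> is chosen such that the middle bound is the Bergman weight
  \<open>2 / (k + 2)\<close>, while the other two lose no more than the factor 2 permits.\<close>

lemma weight_bounds:
  assumes "k \<ge> (1::nat)"
  shows "(real k)\<^sup>2 * (mono_wt (k - 1) 1 + 4/3 * mono_wt (k - 1) 2) \<le> 4/3"
    and "(real k)\<^sup>2 * (mono_wt (k - 1) 2 + 4/3 * mono_wt (k - 1) 3) \<ge> 2 / (real k + 2)"
    and "(real k)\<^sup>2 * (mono_wt (k - 1) 3 + 4/3 * mono_wt (k - 1) 4) \<le> 4/3 * (6 / ((real k + 2) * (real k + 3)))"
proof -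
  define x where "x = real k"
  have x: "x \<ge> 1" using assms by (simp add: x_def)
  \<comment> \<open>These are (x - 1)^2 >= 0 and (x - 4)^2 >= 0. The latter is the third bound with
    denominators cleared, so that bound is attained at k = 4.\<close>
  have q: "x * 2 \<le> x * x + 1" "x * 8 \<le> x * x + 16"
    using zero_le_square[of "x - 1"] zero_le_square[of "x - 4"] by (simp_all only: left_diff_distrib right_diff_distrib)
  have e: "real (k - 1) = x - 1" using assms by (simp add: x_def)
  have "x\<^sup>2 * (1 / (x * (x + 1)) + 4/3 * (2 / (x * (x + 1) * (x + 2)))) = (3 * x\<^sup>2 + 14 * x) / (3 * (x + 1) * (x + 2))"
    using x by (simp add: divide_simps power2_eq_square) (simp add: algebra_simps)
  also have "\<dots> \<le> 4/3"
    using x q(1) by (simp add: divide_simps) (simp add: algebra_simps power2_eq_square)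
  finally show "(real k)\<^sup>2 * (mono_wt (k - 1) 1 + 4/3 * mono_wt (k - 1) 2) \<le> 4/3"
    unfolding mono_wt_values e x_def[symmetric] by (simp add: algebra_simps)
  have "2 / (x + 2) \<le> (2 / (x + 2)) * (x * (x + 7) / ((x + 1) * (x + 3)))"
  proof -
    \<comment> \<open>Amounts to x >= 1, with equality at k = 1; there the constant 4/3 in the
      weight cannot be lowered.\<close>
    have "1 \<le> x * (x + 7) / ((x + 1) * (x + 3))"
      using x by (simp add: divide_simps) (simp add: algebra_simps)
    from mult_left_mono[OF this, of "2 / (x + 2)"] show ?thesis using x by simp
  qed
  also have "\<dots> = x\<^sup>2 * (2 / (x * (x + 1) * (x + 2)) + 4/3 * (6 / (x * (x + 1) * (x + 2) * (x + 3))))"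
    using x by (simp add: divide_simps power2_eq_square)
  finally show "(real k)\<^sup>2 * (mono_wt (k - 1) 2 + 4/3 * mono_wt (k - 1) 3) \<ge> 2 / (real k + 2)"
    unfolding mono_wt_values e x_def[symmetric] by (simp add: algebra_simps)
  have "x\<^sup>2 * (6 / (x * (x + 1) * (x + 2) * (x + 3)) + 4/3 * (24 / (x * (x + 1) * (x + 2) * (x + 3) * (x + 4))))
     = (6 / ((x + 2) * (x + 3))) * ((3 * x\<^sup>2 + 28 * x) / (3 * (x + 1) * (x + 4)))"
    using x by (simp add: divide_simps power2_eq_square) (simp add: algebra_simps)
  also have "\<dots> \<le> (6 / ((x + 2) * (x + 3))) * (4/3)"
  proof (rule mult_left_mono)
    show "(3 * x\<^sup>2 + 28 * x) / (3 * (x + 1) * (x + 4)) \<le> 4/3"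
      using x q(2) by (simp add: divide_simps) (simp add: algebra_simps power2_eq_square)
  qed (use x in auto)
  finally show "(real k)\<^sup>2 * (mono_wt (k - 1) 3 + 4/3 * mono_wt (k - 1) 4) \<le> 4/3 * (6 / ((real k + 2) * (real k + 3)))"
    unfolding mono_wt_values e x_def[symmetric] by (simp add: algebra_simps)
qed

text \<open>The hypothesis \<open>ineq\<close> is the AM-GM estimate integrated over spheres of
  radius sqrt t. It is divided by t, multiplied by the weight 1 + 4/3 (1 - t) and integrated over
  (0,1); \<open>weight_bounds\<close> turns the three integrals into Hardy, Bergman and exponent 4
  norms. \<open>M\<close> is any positive upper bound of the Hardy norm of e^2 rather than the norm
  itself, which leaves room for approximation.\<close>

lemma bergman_hardy_series:
  fixes e :: "complex poly poly"
  assumes M: "M > 0" "(\<Sum>k\<le>K. hom_norm k (e * e)) \<le> M\<^sup>2"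
    and ineq: "\<And>t. 0 < t \<Longrightarrow> t < 1 \<Longrightarrow>
      (1 - t)\<^sup>2 * (\<Sum>k\<le>K. (real k)\<^sup>2 * hom_norm k (e * e * e) * t ^ k)
       \<le> 9/16 * M * ((1 - t) * (\<Sum>k\<le>K. (real k)\<^sup>2 * hom_norm k (e * e) * t ^ k))
        + 9/(16 * M) * ((1 - t) ^ 3 * (\<Sum>k\<le>K. (real k)\<^sup>2 * hom_norm k (e * e * (e * e)) * t ^ k))"
  shows "(\<Sum>k\<le>K. hom_norm k (e * e * e) * (2 / (real k + 2))) \<le> 2 * M ^ 3"
proof -
  \<comment> \<open>Constant terms are invisible to the Euler field and are carried along
    separately: y = |e(0)|^2 contributes y^2, y^3 and y^4 to the three norms.\<close>
  define y where "y = (cmod (cf e 0 0))\<^sup>2"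
  have cf0: "cf (P * Q) 0 0 = cf P 0 0 * cf Q 0 0" for P Q by (simp add: cf_mult)
  have h0: "hom_norm 0 P = (cmod (cf P 0 0))\<^sup>2" for P by (simp add: hom_norm_def mono_wt_def)
  have y2: "hom_norm 0 (e * e) = y\<^sup>2" "hom_norm 0 (e * e * e) = y ^ 3" "hom_norm 0 (e * e * (e * e)) = y ^ 4"
    by (simp_all add: h0 cf0 norm_mult y_def power_mult_distrib flip: power_mult)
  have split: "(\<Sum>k\<le>K. g k) = g 0 + (\<Sum>k=1..K. g k)" for g :: "nat \<Rightarrow> real"
    by (simp add: atMost_atLeast0 sum.atLeast_Suc_atMost)
  define S where "S P t = (\<Sum>k=1..K. (real k)\<^sup>2 * hom_norm k P * t ^ (k - 1))" for P and t :: real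
  have St: "(\<Sum>k\<le>K. (real k)\<^sup>2 * hom_norm k P * t ^ k) = t * S P t" for P t
    unfolding split S_def sum_distrib_left
    by (simp add: algebra_simps) (intro sum.cong refl, auto simp: power_eq_if)
  have pt: "(1 - t)\<^sup>2 * (1 + 4/3 * (1 - t)) * S (e * e * e) t
       \<le> 9/16 * M * ((1 - t) ^ 1 * (1 + 4/3 * (1 - t)) * S (e * e) t)
        + 9/(16 * M) * ((1 - t) ^ 3 * (1 + 4/3 * (1 - t)) * S (e * e * (e * e)) t)" if t: "t \<in> {0<..<1}" for t
  proof -
    have "((1 - t)\<^sup>2 * S (e * e * e) t) * t \<le> (9/16 * M * ((1 - t) * S (e * e) t)
        + 9/(16 * M) * ((1 - t) ^ 3 * S (e * e * (e * e)) t)) * t"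
      using ineq[of t] t unfolding St by (simp only: distrib_right distrib_left mult_ac greaterThanLessThan_iff simp_thms)
    hence "(1 - t)\<^sup>2 * S (e * e * e) t \<le> (9/16 * M * ((1 - t) * S (e * e) t)
        + 9/(16 * M) * ((1 - t) ^ 3 * S (e * e * (e * e)) t))" using t mult_right_le_imp_le by auto
    note le = this
    define p where "p = 1 + 4/3 * (1 - t)"
    have p0: "0 \<le> p" using t by (auto simp: p_def)
    show ?thesis using mult_left_mono[OF le p0] unfolding p_def[symmetric]
      by (simp only: distrib_left mult_ac power_one_right)
  qed
  define c where "c j k = (real k)\<^sup>2 * (mono_wt (k - 1) j + 4/3 * mono_wt (k - 1) (Suc j))" for j k
  have int: "((\<lambda>t. (1 - t) ^ j * (1 + 4/3 * (1 - t)) * S P t) has_integral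
      (\<Sum>k=1..K. hom_norm k P * c j k)) {0<..<1}" for P j
    using has_integral_weighted_series[of j "\<lambda>k. hom_norm k P" K] 
    unfolding S_def c_def by (simp add: has_integral_Icc_iff_Ioo)
  have A0: "(\<Sum>k=1..K. hom_norm k (e * e * e) * c 2 k) \<le> 9/16 * M * (\<Sum>k=1..K. hom_norm k (e * e) * c 1 k)
        + 9/(16 * M) * (\<Sum>k=1..K. hom_norm k (e * e * (e * e)) * c 3 k)"
    by (rule has_integral_le[OF int has_integral_add[OF has_integral_mult_right[OF int] has_integral_mult_right[OF int]]])
       (use pt in auto)
  have "(\<Sum>k=1..K. hom_norm k (e * e) * c 1 k) \<le> (\<Sum>k=1..K. hom_norm k (e * e) * (4/3))"
    using weight_bounds(1) by (intro sum_mono mult_left_mono hom_norm_nonneg) (auto simp: c_def numeral_2_eq_2)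
  also have "\<dots> = 4/3 * (\<Sum>k=1..K. hom_norm k (e * e))" by (simp add: sum_distrib_left mult.commute)
  also have "(\<Sum>k=1..K. hom_norm k (e * e)) \<le> M\<^sup>2 - y\<^sup>2" using M(2) unfolding split y2 by simp
  finally have A1: "(\<Sum>k=1..K. hom_norm k (e * e) * c 1 k) \<le> 4/3 * (M\<^sup>2 - y\<^sup>2)" by simp
  have "(\<Sum>k=1..K. hom_norm k (e * e * (e * e)) * c 3 k)
      \<le> (\<Sum>k=1..K. hom_norm k (e * e * (e * e)) * (4/3 * (6 / ((real k + 2) * (real k + 3)))))"
    using weight_bounds(3) by (intro sum_mono mult_left_mono hom_norm_nonneg) (auto simp: c_def eval_nat_numeral)
  also have "\<dots> = 4/3 * (\<Sum>k=1..K. hom_norm k (e * e * (e * e)) * (6 / ((real k + 2) * (real k + 3))))"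
    by (simp add: sum_distrib_left mult_ac)
  also have "(\<Sum>k=1..K. hom_norm k (e * e * (e * e)) * (6 / ((real k + 2) * (real k + 3)))) \<le> M ^ 4 - y ^ 4"
  proof -
    have "(\<Sum>k\<le>K. hom_norm k (e * e * (e * e)) * (6 / ((real k + 2) * (real k + 3)))) \<le> (\<Sum>k\<le>K. hom_norm k (e * e))\<^sup>2"
      by (rule hom_norm_square_contractive)
    also have "\<dots> \<le> (M\<^sup>2)\<^sup>2" by (rule power_mono[OF M(2)]) (simp add: sum_nonneg hom_norm_nonneg)
    finally show ?thesis unfolding split y2 by simp
  qed
  finally have A2: "(\<Sum>k=1..K. hom_norm k (e * e * (e * e)) * c 3 k) \<le> 4/3 * (M ^ 4 - y ^ 4)" by simp
  have A: "(\<Sum>k=1..K. hom_norm k (e * e * e) * c 2 k)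
     \<le> 9/16 * M * (4/3 * (M\<^sup>2 - y\<^sup>2)) + 9/(16 * M) * (4/3 * (M ^ 4 - y ^ 4))"
    by (rule order.trans[OF A0 add_mono[OF mult_left_mono[OF A1] mult_left_mono[OF A2]]]) (use M(1) in auto)
  have "(\<Sum>k\<le>K. hom_norm k (e * e * e) * (2 / (real k + 2))) = y ^ 3 + (\<Sum>k=1..K. hom_norm k (e * e * e) * (2 / (real k + 2)))"
    unfolding split y2 by simp
  also have "(\<Sum>k=1..K. hom_norm k (e * e * e) * (2 / (real k + 2))) \<le> (\<Sum>k=1..K. hom_norm k (e * e * e) * c 2 k)"
    using weight_bounds(2) by (intro sum_mono mult_left_mono hom_norm_nonneg) (auto simp: c_def numeral_3_eq_3)
  also note A
  also have "y ^ 3 + (9/16 * M * (4/3 * (M\<^sup>2 - y\<^sup>2)) + 9/(16 * M) * (4/3 * (M ^ 4 - y ^ 4))) \<le> 2 * M ^ 3"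
  proof -
    have "hom_norm 0 (e * e) \<le> (\<Sum>k\<le>K. hom_norm k (e * e))" by (rule member_le_sum) (auto simp: hom_norm_nonneg)
    hence "y\<^sup>2 \<le> M\<^sup>2" using M(2) y2 by simp
    hence yM: "y \<le> M" by (rule power2_le_imp_le) (use M(1) in simp)
    define x where "x = y / M"
    have x: "0 \<le> x" "x \<le> 1" "y = x * M" using yM M(1) by (auto simp: x_def y_def)
    have "y ^ 3 + (9/16 * M * (4/3 * (M\<^sup>2 - y\<^sup>2)) + 9/(16 * M) * (4/3 * (M ^ 4 - y ^ 4)))
       = M ^ 3 * (x ^ 3 + 3/4 * (1 - x\<^sup>2) + 3/4 * (1 - x ^ 4))"
    proof -
      have "9/(16 * M) * (4/3 * (M ^ 4 - y ^ 4)) = 3/4 * ((M ^ 4 / M) * (1 - x ^ 4))"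
        unfolding x(3) power_mult_distrib by (simp add: right_diff_distrib diff_divide_distrib)
      also have "M ^ 4 / M = M ^ 3" using M(1) by (simp add: eval_nat_numeral)
      finally have 1: "9/(16 * M) * (4/3 * (M ^ 4 - y ^ 4)) = 3/4 * (M ^ 3 * (1 - x ^ 4))" .
      have 2: "9/16 * M * (4/3 * (M\<^sup>2 - y\<^sup>2)) = 3/4 * (M ^ 3 * (1 - x\<^sup>2))"
        unfolding x(3) power_mult_distrib by (simp add: power2_eq_square power3_eq_cube right_diff_distrib)
      show ?thesis unfolding 1 2 unfolding x(3) power_mult_distrib by (simp add: field_simps)
    qed
    also have "\<dots> \<le> M ^ 3 * 2"
    proof (rule mult_left_mono)
      \<comment> \<open>Here b, c, d stand for x^2, x^3, x^4. The left side is at most 3/2 + b/4, so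
        part of the factor 2 is left over.\<close>
      have aux: "c + 3/4 * (1 - b) + 3/4 * (1 - d) \<le> 2" if "c \<le> b" "b \<le> 1" "0 \<le> d" for b c d :: real
        using that by argo
      have "x ^ 3 \<le> x\<^sup>2" using power_decreasing[of 2 3 x] x by simp
      moreover have "x\<^sup>2 \<le> 1" "0 \<le> x ^ 4" using x by (auto simp: power_le_one)
      ultimately show "x ^ 3 + 3/4 * (1 - x\<^sup>2) + 3/4 * (1 - x ^ 4) \<le> 2" by (rule aux)
    qed (use M in auto)
    finally show ?thesis by simp
  qed
  finally show ?thesis by simp
qed

section \<open>Lebesgue integration on complex 2-space\<close>

text \<open>Such a map permutes coordinates, so preimages of boxes are boxes with the same side
  lengths, and boxes determine Lebesgue measure. The identifications of C^2 with C x C and with R^4,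
  and of R^4 with R^3 x R, all rest on this.\<close>

lemma lborel_distr_basis_bij:
  fixes T :: "'a::euclidean_space \<Rightarrow> 'b::euclidean_space"
  assumes "linear T" and bij: "bij_betw T Basis Basis"
  shows "distr lborel borel T = lborel"
proof (rule lborel_eqI[symmetric])
  interpret linear T by fact
  have T_meas[measurable]: "T \<in> borel \<rightarrow>\<^sub>M borel"
    by (intro borel_measurable_continuous_onI linear_continuous_on) (simp add: \<open>linear T\<close> linear_conv_bounded_linear[symmetric])
  have TB: "T b \<in> Basis" if "b \<in> Basis" for b using bij that by (auto simp: bij_betw_def)
  have inner_T: "T x \<bullet> T b = x \<bullet> b" if b: "b \<in> Basis" for x b
  proof -
    have "T x \<bullet> T b = (\<Sum>c\<in>Basis. (x \<bullet> c) * (T c \<bullet> T b))"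
      by (subst euclidean_representation[of x, symmetric]) (simp add: sum scale inner_sum_left)
    also have "\<dots> = (\<Sum>c\<in>Basis. if c = b then x \<bullet> c else 0)"
      using bij b TB by (intro sum.cong refl) (auto simp: inner_Basis bij_betw_def inj_on_def)
    finally show ?thesis using b by simp
  qed
  fix l u :: 'b assume le: "\<And>b. b \<in> Basis \<Longrightarrow> l \<bullet> b \<le> u \<bullet> b"
  define l' where "l' = (\<Sum>b\<in>Basis. (l \<bullet> T b) *\<^sub>R b)"
  define u' where "u' = (\<Sum>b\<in>Basis. (u \<bullet> T b) *\<^sub>R b)"
  have i: "l' \<bullet> b = l \<bullet> T b" "u' \<bullet> b = u \<bullet> T b" if "b \<in> Basis" for b
    using that by (auto simp: l'_def u'_def)
  have "T -` box l u = box l' u'"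
  proof (rule set_eqI)
    fix x
    have "T x \<in> box l u \<longleftrightarrow> (\<forall>b\<in>T ` Basis. l \<bullet> b < T x \<bullet> b \<and> T x \<bullet> b < u \<bullet> b)"
      using bij by (simp add: mem_box bij_betw_def)
    thus "x \<in> T -` box l u \<longleftrightarrow> x \<in> box l' u'" by (auto simp: mem_box i inner_T)
  qed
  hence "emeasure (distr lborel borel T) (box l u) = emeasure lborel (box l' u')"
    by (simp add: emeasure_distr)
  also have "\<dots> = (\<Prod>b\<in>Basis. (u' - l') \<bullet> b)"
    using le TB by (simp add: emeasure_lborel_box_eq i inner_diff_left)
  also have "(\<Prod>b\<in>Basis. (u' - l') \<bullet> b) = (\<Prod>b\<in>Basis. (u - l) \<bullet> T b)"
    by (intro prod.cong refl) (simp add: inner_diff_left i)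
  also have "\<dots> = (\<Prod>b\<in>Basis. (u - l) \<bullet> b)" by (rule prod.reindex_bij_betw[OF bij])
  finally show "emeasure (distr lborel borel T) (box l u) = (\<Prod>b\<in>Basis. (u - l) \<bullet> b)" .
qed simp



definition pair_vec :: "complex \<times> complex \<Rightarrow> complex^2" where
  "pair_vec = (\<lambda>(a, b). vector [a, b])"

lemma pair_vec_nth [simp]: "pair_vec p $ 1 = fst p" "pair_vec p $ 2 = snd p"
  by (cases p; simp add: pair_vec_def)+

lemma c2_eq_iff: "x = y \<longleftrightarrow> x $ 1 = y $ 1 \<and> x $ 2 = y $ 2" for x y :: "'a^2"
  by (simp add: vec_eq_iff forall_2)

lemma c2_norm: "(norm z)\<^sup>2 = (cmod (z $ 1))\<^sup>2 + (cmod (z $ 2))\<^sup>2" for z :: "complex^2"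
  by (simp add: norm_vec_def L2_set_def sum_2)

lemma linear_pair_vec: "linear pair_vec"
  by (rule linearI) (auto simp: c2_eq_iff)

lemma pair_vec_measurable [measurable]: "pair_vec \<in> borel \<rightarrow>\<^sub>M borel"
  by (intro borel_measurable_continuous_onI linear_continuous_on) (simp add: linear_pair_vec linear_conv_bounded_linear[symmetric])

lemma lborel_pair_vec: "distr (lborel \<Otimes>\<^sub>M lborel) borel pair_vec = lborel"
proof -
  have "bij_betw pair_vec Basis Basis"
  proof (rule bij_betwI[where g = "\<lambda>z::complex^2. (z $ 1, z $ 2)"])
    show "pair_vec \<in> Basis \<rightarrow> Basis"
    proof (rule Pi_I)
      fix p :: "complex \<times> complex" assume "p \<in> Basis"
      then consider u where "u \<in> Basis" "p = (u, 0)" | u where "u \<in> Basis" "p = (0, u)"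
        by (auto simp: Basis_prod_def)
      thus "pair_vec p \<in> Basis"
      proof cases
        case 1
        hence "pair_vec p = axis 1 u" by (simp add: c2_eq_iff axis_def)
        thus ?thesis using 1 by simp
      next
        case 2
        hence "pair_vec p = axis 2 u" by (simp add: c2_eq_iff axis_def)
        thus ?thesis using 2 by simp
      qed
    qed
    show "(\<lambda>z::complex^2. (z $ 1, z $ 2)) \<in> Basis \<rightarrow> (Basis :: (complex \<times> complex) set)"
    proof (rule Pi_I)
      fix x :: "complex^2" assume "x \<in> Basis"
      then obtain i u where "u \<in> Basis" "x = axis i u" by (auto simp: Basis_vec_def)
      moreover have "i = 1 \<or> i = 2" by (rule exhaust_2)
      ultimately show "(x $ 1, x $ 2) \<in> (Basis :: (complex \<times> complex) set)"
        by (auto simp: Basis_prod_def axis_def)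
    qed
  qed (auto simp: c2_eq_iff)
  from lborel_distr_basis_bij[OF linear_pair_vec this] show ?thesis
    by (simp add: lborel_prod)
qed

lemma nn_integral_c2:
  assumes [measurable]: "f \<in> borel_measurable borel"
  shows "(\<integral>\<^sup>+z. f z \<partial>lborel) = (\<integral>\<^sup>+a. \<integral>\<^sup>+b. f (pair_vec (a, b)) \<partial>lborel \<partial>lborel)"
proof -
  have "(\<integral>\<^sup>+z. f z \<partial>lborel) = (\<integral>\<^sup>+p. f (pair_vec p) \<partial>(lborel \<Otimes>\<^sub>M lborel))"
    by (subst lborel_pair_vec[symmetric], subst nn_integral_distr) (simp_all add: lborel_prod)
  thus ?thesis by (subst lborel.nn_integral_fst) (simp_all add: lborel_prod)
qed

text \<open>Replaces polar coordinates: |z|^2 pushes the area of the disc to pi times Lebesgue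
  measure on [0,1). The two measures agree on all half-lines because the annulus x < |z|^2 < 1 has
  area pi (1 - x).\<close>

lemma nn_integral_disc:
  fixes f :: "real \<Rightarrow> ennreal"
  assumes [measurable]: "f \<in> borel_measurable borel"
  shows "(\<integral>\<^sup>+z. indicator (ball (0::complex) 1) z * f ((cmod z)\<^sup>2) \<partial>lborel)
     = ennreal pi * (\<integral>\<^sup>+s. indicator {0..<1} s * f s \<partial>lborel)"
proof -
  define M where "M = distr (density lborel (indicator (ball (0::complex) 1))) borel (\<lambda>z. (cmod z)\<^sup>2)"
  define N where "N = density lborel (\<lambda>s. ennreal pi * indicator {0..<1::real} s)"
  have Mx: "emeasure M {x<..} = (if x < 0 then ennreal pi else if x < 1 then ennreal (pi * (1 - x)) else 0)" for x
  proof -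
    have "emeasure M {x<..} = emeasure lborel (ball (0::complex) 1 \<inter> {z. x < (cmod z)\<^sup>2})"
    proof -
      have "emeasure M {x<..} = emeasure (density lborel (indicator (ball (0::complex) 1))) {z. x < (cmod z)\<^sup>2}"
        unfolding M_def by (subst emeasure_distr) (auto simp: vimage_def)
      also have "\<dots> = (\<integral>\<^sup>+z. indicator (ball (0::complex) 1 \<inter> {z. x < (cmod z)\<^sup>2}) z \<partial>lborel)"
        by (subst emeasure_density) (auto intro!: borel_measurable_indicator nn_integral_cong simp: indicator_inter_arith simp del: nn_integral_indicator)
      finally show ?thesis by simp
    qed
    also have "\<dots> = (if x < 0 then ennreal pi else if x < 1 then ennreal (pi * (1 - x)) else 0)"
    proof -
      consider "x < 0" | "0 \<le> x" "x < 1" | "1 \<le> x" by linarith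
      thus ?thesis
      proof cases
        case 1
        hence "ball (0::complex) 1 \<inter> {z. x < (cmod z)\<^sup>2} = ball 0 1" by (auto intro: less_le_trans)
        thus ?thesis using 1 by (simp add: emeasure_ball unit_ball_vol_2)
      next
        case 2
        have "ball (0::complex) 1 \<inter> {z. x < (cmod z)\<^sup>2} = ball 0 1 - cball 0 (sqrt x)"
        proof -
          have "cmod z \<le> sqrt x \<longleftrightarrow> (cmod z)\<^sup>2 \<le> x" for z
            using 2 power_mono[of "cmod z" "sqrt x" 2] real_le_rsqrt[of "cmod z" x] by auto
          thus ?thesis by (auto simp: not_le)
        qed
        also have "emeasure lborel \<dots> = emeasure lborel (ball (0::complex) 1) - emeasure lborel (cball (0::complex) (sqrt x))"
        proof (intro emeasure_Diff)
          have "sqrt x < 1" using 2 by simp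
          show "cball (0::complex) (sqrt x) \<subseteq> ball 0 1"
            by (intro subsetI) (metis \<open>sqrt x < 1\<close> dist_norm mem_ball mem_cball order.strict_trans1)
        qed (use 2 in \<open>auto simp: emeasure_cball\<close>)
        also have "\<dots> = ennreal (pi * (1 - x))"
          using 2 by (simp add: emeasure_ball emeasure_cball unit_ball_vol_2 ennreal_minus[symmetric] algebra_simps flip: ennreal_minus)
        finally show ?thesis using 2 by simp
      next
        case 3
        have "ball (0::complex) 1 \<inter> {z. x < (cmod z)\<^sup>2} = {}"
        proof (safe; simp)
          fix z :: complex assume "cmod z < 1" "x < (cmod z)\<^sup>2"
          moreover have "(cmod z)\<^sup>2 \<le> 1" using \<open>cmod z < 1\<close> by (simp add: power_le_one)
          ultimately show False using 3 by simp
        qed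
        thus ?thesis using 3 by simp
      qed
    qed
    finally show ?thesis .
  qed
  have Nx: "emeasure N {x<..} = (if x < 0 then ennreal pi else if x < 1 then ennreal (pi * (1 - x)) else 0)" for x
  proof -
    have "emeasure N {x<..} = ennreal pi * emeasure lborel ({0..<1} \<inter> {x<..})"
      unfolding N_def by (simp add: emeasure_density nn_integral_cmult mult.assoc flip: indicator_inter_arith)
    also have "{0..<1} \<inter> {x<..} = (if x < 0 then {0..<1} else {x<..<1})" by auto
    finally show ?thesis by (auto simp: ennreal_mult)
  qed
  have "M = N"
    by (rule measure_eqI_lessThan) (auto simp: Mx Nx, simp_all add: M_def N_def)
  hence "(\<integral>\<^sup>+s. f s \<partial>M) = (\<integral>\<^sup>+s. f s \<partial>N)" by simp
  moreover have [measurable]: "(indicator (ball 0 1) :: complex \<Rightarrow> ennreal) \<in> borel_measurable borel"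
    by (intro borel_measurable_indicator borel_open open_ball)
  ultimately show ?thesis
    unfolding M_def N_def
    by (simp add: nn_integral_distr nn_integral_density mult.assoc nn_integral_cmult)
qed

lemma nn_integral_beta_scaled:
  assumes t: "t > 0"
  shows "(\<integral>\<^sup>+s. ennreal (s ^ m * (t - s) ^ n) * indicator {0..t} s \<partial>lborel) = ennreal (t ^ (m + n + 1) * mono_wt m n)"
proof -
  have "(\<integral>\<^sup>+s. ennreal (s ^ m * (t - s) ^ n) * indicator {0..t} s \<partial>lborel)
     = ennreal t * (\<integral>\<^sup>+x. ennreal ((t * x) ^ m * (t - t * x) ^ n) * indicator {0..t} (t * x) \<partial>lborel)"
    using t by (subst nn_integral_real_affine[where c = t and t = 0]) auto
  also have "(\<integral>\<^sup>+x. ennreal ((t * x) ^ m * (t - t * x) ^ n) * indicator {0..t} (t * x) \<partial>lborel)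
     = (\<integral>\<^sup>+x. ennreal (t ^ (m + n)) * (ennreal (x ^ m * (1 - x) ^ n) * indicator {0..1} x) \<partial>lborel)"
  proof (intro nn_integral_cong)
    fix x :: real
    have "t * x \<in> {0..t} \<longleftrightarrow> x \<in> {0..1}" using t by (auto simp: zero_le_mult_iff)
    moreover have "(t * x) ^ m * (t - t * x) ^ n = t ^ (m + n) * (x ^ m * (1 - x) ^ n)"
      by (simp add: power_add power_mult_distrib flip: right_diff_distrib[of t 1, simplified])
    ultimately show "ennreal ((t * x) ^ m * (t - t * x) ^ n) * indicator {0..t} (t * x)
       = ennreal (t ^ (m + n)) * (ennreal (x ^ m * (1 - x) ^ n) * indicator {0..1} x)"
      using t by (auto simp: indicator_def simp flip: ennreal_mult)
  qed
  also have "\<dots> = ennreal (t ^ (m + n)) * ennreal (mono_wt m n)"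
    by (subst nn_integral_cmult) (auto intro!: arg_cong2[of _ _ _ _ "(*)"] nn_integral_has_integral_lebesgue'[OF _ has_integral_beta_nat])
  finally show ?thesis using t by (simp add: less_imp_le[OF mono_wt_pos] flip: ennreal_mult mult.assoc)
qed

text \<open>In the variables s_i = |z_i|^2 the integral acquires the factor pi^2 and becomes one
  over the plane. Putting t = s_1 + s_2 = |z|^2 leaves a beta integral over s_1 in [0,t], whatever
  the radial weight \<open>v\<close>. With nonnegative integrals Fubini is unconditional.\<close>

lemma nn_integral_monomial_ball:
  fixes v :: "real \<Rightarrow> real"
  assumes [measurable]: "v \<in> borel_measurable borel" and v: "\<And>x. v x \<ge> 0"
  shows "(\<integral>\<^sup>+z. indicator (ball (0::complex^2) 1) z * ennreal ((cmod (z$1)) ^ (2 * m) * (cmod (z$2)) ^ (2 * n) * v ((norm z)\<^sup>2)) \<partial>lborel)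
     = ennreal (pi\<^sup>2 * mono_wt m n) * (\<integral>\<^sup>+t. indicator {0<..<1} t * ennreal (t ^ (m + n + 1) * v t) \<partial>lborel)"
proof -
  define g where "g s1 s2 = indicator {..<1} (s1 + s2) * ennreal (s1 ^ m * s2 ^ n * v (s1 + s2))" for s1 s2 :: real
  have [measurable]: "(\<lambda>p. g (fst p) (snd p)) \<in> borel_measurable (borel \<Otimes>\<^sub>M borel)" unfolding g_def by measurable
  have [measurable]: "(\<lambda>p. g (snd p) (fst p - snd p)) \<in> borel_measurable (borel \<Otimes>\<^sub>M borel)" unfolding g_def by measurable
  have [measurable]: "g s1 \<in> borel_measurable borel" for s1 unfolding g_def by measurable
  have [measurable]: "(\<lambda>z::complex^2. cmod (z $ 1)) \<in> borel_measurable borel" "(\<lambda>z::complex^2. cmod (z $ 2)) \<in> borel_measurable borel"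
    by (intro borel_measurable_continuous_onI continuous_intros)+
  have [measurable]: "(indicator (ball 0 1) :: complex^2 \<Rightarrow> ennreal) \<in> borel_measurable borel"
    "(indicator (ball 0 1) :: complex \<Rightarrow> ennreal) \<in> borel_measurable borel"
    by (intro borel_measurable_indicator borel_open open_ball)+
  have "(\<integral>\<^sup>+z. indicator (ball (0::complex^2) 1) z * ennreal ((cmod (z$1)) ^ (2 * m) * (cmod (z$2)) ^ (2 * n) * v ((norm z)\<^sup>2)) \<partial>lborel)
    = (\<integral>\<^sup>+a. \<integral>\<^sup>+b. indicator (ball (0::complex) 1) a * (indicator (ball (0::complex) 1) b * g ((cmod a)\<^sup>2) ((cmod b)\<^sup>2)) \<partial>lborel \<partial>lborel)"
  proof (subst nn_integral_c2, goal_cases)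
    case 1
    show ?case by measurable
  next
    case 2
    show ?case
    proof (intro nn_integral_cong)
    fix a b :: complex
    have n: "(norm (pair_vec (a, b)))\<^sup>2 = (cmod a)\<^sup>2 + (cmod b)\<^sup>2" by (simp add: c2_norm)
    have ball: "pair_vec (a, b) \<in> ball 0 1 \<longleftrightarrow> (cmod a)\<^sup>2 + (cmod b)\<^sup>2 < 1"
      unfolding n[symmetric] by (simp add: abs_square_less_1)
    have "cmod a < 1" "cmod b < 1" if "(cmod a)\<^sup>2 + (cmod b)\<^sup>2 < 1"
    proof -
      have "(cmod a)\<^sup>2 < 1" "(cmod b)\<^sup>2 < 1" using that zero_le_power2[of "cmod a"] zero_le_power2[of "cmod b"] by linarith+
      thus "cmod a < 1" "cmod b < 1" by (simp_all add: abs_square_less_1)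
    qed
    thus "indicator (ball 0 1) (pair_vec (a, b)) * ennreal (cmod (pair_vec (a, b) $ 1) ^ (2 * m) * cmod (pair_vec (a, b) $ 2) ^ (2 * n) * v ((norm (pair_vec (a, b)))\<^sup>2))
       = indicator (ball (0::complex) 1) a * (indicator (ball (0::complex) 1) b * g ((cmod a)\<^sup>2) ((cmod b)\<^sup>2))"
      unfolding n g_def using ball by (auto simp: indicator_def power_mult)
    qed
  qed
  also have "\<dots> = (\<integral>\<^sup>+a. indicator (ball (0::complex) 1) a * (ennreal pi * (\<integral>\<^sup>+s. indicator {0..<1} s * g ((cmod a)\<^sup>2) s \<partial>lborel)) \<partial>lborel)"
    by (subst nn_integral_cmult) (auto simp: nn_integral_disc)
  also have "\<dots> = ennreal pi * (\<integral>\<^sup>+r. indicator {0..<1} r * (ennreal pi * (\<integral>\<^sup>+s. indicator {0..<1} s * g r s \<partial>lborel)) \<partial>lborel)"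
    by (rule nn_integral_disc[of "\<lambda>r. ennreal pi * (\<integral>\<^sup>+s. indicator {0..<1} s * g r s \<partial>lborel)"]) measurable
  also have "\<dots> = ennreal pi * ennreal pi * (\<integral>\<^sup>+r. indicator {0..<1} r * (\<integral>\<^sup>+s. indicator {0..<1} s * g r s \<partial>lborel) \<partial>lborel)"
    by (subst mult.left_commute, subst nn_integral_cmult) (auto simp: mult.assoc)
  also have "(\<integral>\<^sup>+r. indicator {0..<1} r * (\<integral>\<^sup>+s. indicator {0..<1} s * g r s \<partial>lborel) \<partial>lborel)
     = (\<integral>\<^sup>+r. \<integral>\<^sup>+t. indicator {0..<1} r * (indicator {0..<1} (t - r) * g r (t - r)) \<partial>lborel \<partial>lborel)"
  proof (intro nn_integral_cong)
    fix r :: real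
    have "(\<integral>\<^sup>+s. indicator {0..<1} s * g r s \<partial>lborel) = (\<integral>\<^sup>+t. indicator {0..<1} (t - r) * g r (t - r) \<partial>lborel)"
      by (subst nn_integral_real_affine[where c = 1 and t = "-r"]) (auto simp: algebra_simps)
    thus "indicator {0..<1} r * (\<integral>\<^sup>+s. indicator {0..<1} s * g r s \<partial>lborel) = (\<integral>\<^sup>+t. indicator {0..<1} r * (indicator {0..<1} (t - r) * g r (t - r)) \<partial>lborel)"
      by (subst nn_integral_cmult) auto
  qed
  also have "\<dots> = (\<integral>\<^sup>+t. \<integral>\<^sup>+r. indicator {0..<1} r * (indicator {0..<1} (t - r) * g r (t - r)) \<partial>lborel \<partial>lborel)"
    by (rule lborel_pair.Fubini') (measurable)
  also have "\<dots> = (\<integral>\<^sup>+t. indicator {0<..<1} t * ennreal (v t) * (\<integral>\<^sup>+r. ennreal (r ^ m * (t - r) ^ n) * indicator {0..t} r \<partial>lborel) \<partial>lborel)"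
  proof (rule nn_integral_cong_AE)
    have "AE t in lborel. t \<noteq> (0::real)" by (rule AE_lborel_singleton)
    thus "AE t in lborel. (\<integral>\<^sup>+r. indicator {0..<1} r * (indicator {0..<1} (t - r) * g r (t - r)) \<partial>lborel)
       = indicator {0<..<1} t * ennreal (v t) * (\<integral>\<^sup>+r. ennreal (r ^ m * (t - r) ^ n) * indicator {0..t} r \<partial>lborel)"
    proof eventually_elim
      case (elim t)
      show ?case using elim v
        by (subst nn_integral_cmult[symmetric], simp, intro nn_integral_cong)
           (auto simp: g_def indicator_def ennreal_mult' mult_ac)
    qed
  qed
  also have "\<dots> = (\<integral>\<^sup>+t. ennreal (mono_wt m n) * (indicator {0<..<1} t * ennreal (t ^ (m + n + 1) * v t)) \<partial>lborel)"
  proof (intro nn_integral_cong)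
    fix t :: real
    show "indicator {0<..<1} t * ennreal (v t) * (\<integral>\<^sup>+r. ennreal (r ^ m * (t - r) ^ n) * indicator {0..t} r \<partial>lborel)
       = ennreal (mono_wt m n) * (indicator {0<..<1} t * ennreal (t ^ (m + n + 1) * v t))"
    proof (cases "t \<in> {0<..<1}")
      case True
      thus ?thesis using v[of t] unfolding nn_integral_beta_scaled[of t, OF True[THEN greaterThanLessThan_iff[THEN iffD1], THEN conjunct1]]
        by (simp add: less_imp_le[OF mono_wt_pos] mult_ac flip: ennreal_mult)
    qed auto
  qed
  also have "\<dots> = ennreal (mono_wt m n) * (\<integral>\<^sup>+t. indicator {0<..<1} t * ennreal (t ^ (m + n + 1) * v t) \<partial>lborel)"
    by (rule nn_integral_cmult) measurable
  finally show ?thesis by (simp add: power2_eq_square ennreal_mult less_imp_le[OF mono_wt_pos] mult.assoc)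
qed

section \<open>Real determinants of complex linear maps\<close>

lemma det_4:
  "det (A::'a::comm_ring_1^4^4) =
    A$1$1 * (A$2$2 * (A$3$3 * A$4$4 - A$3$4 * A$4$3) - A$2$3 * (A$3$2 * A$4$4 - A$3$4 * A$4$2) + A$2$4 * (A$3$2 * A$4$3 - A$3$3 * A$4$2))
  - A$1$2 * (A$2$1 * (A$3$3 * A$4$4 - A$3$4 * A$4$3) - A$2$3 * (A$3$1 * A$4$4 - A$3$4 * A$4$1) + A$2$4 * (A$3$1 * A$4$3 - A$3$3 * A$4$1))
  + A$1$3 * (A$2$1 * (A$3$2 * A$4$4 - A$3$4 * A$4$2) - A$2$2 * (A$3$1 * A$4$4 - A$3$4 * A$4$1) + A$2$4 * (A$3$1 * A$4$2 - A$3$2 * A$4$1))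
  - A$1$4 * (A$2$1 * (A$3$2 * A$4$3 - A$3$3 * A$4$2) - A$2$2 * (A$3$1 * A$4$3 - A$3$3 * A$4$1) + A$2$3 * (A$3$1 * A$4$2 - A$3$2 * A$4$1))"
proof -
  have f1234: "finite {2::4, 3, 4}" "1 \<notin> {2::4, 3, 4}"
    by auto
  have f234: "finite {3::4, 4}" "2 \<notin> {3::4, 4}"
    by auto
  have f34: "finite {4::4}" "3 \<notin> {4::4}"
    by auto
  show ?thesis
    unfolding det_def UNIV_4
    unfolding sum_over_permutations_insert[OF f1234]
    unfolding sum_over_permutations_insert[OF f234]
    unfolding sum_over_permutations_insert[OF f34]
    unfolding permutes_sing
    by (simp add: sign_swap_id permutation_swap_id permutation_compose sign_compose sign_id swap_id_eq) (simp add: algebra_simps)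
qed

lemma vector_4 [simp]:
  "(vector [x,y,z,w] :: ('a::zero)^4)$1 = x"
  "(vector [x,y,z,w] :: ('a::zero)^4)$2 = y"
  "(vector [x,y,z,w] :: ('a::zero)^4)$3 = z"
  "(vector [x,y,z,w] :: ('a::zero)^4)$4 = w"
  unfolding vector_def by simp_all

lemma real_coords_nth [simp]:
  "real_coords v $ 1 = Re (v $ 1)" "real_coords v $ 2 = Im (v $ 1)"
  "real_coords v $ 3 = Re (v $ 2)" "real_coords v $ 4 = Im (v $ 2)"
  by (simp_all add: real_coords_def)

lemma linear_real_coords: "linear real_coords"
  by (rule linearI) (simp_all add: vec_eq_iff forall_4)

definition of_real_coords :: "real^4 \<Rightarrow> complex^2" where
  "of_real_coords x = vector [Complex (x$1) (x$2), Complex (x$3) (x$4)]"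

lemma of_real_coords_nth [simp]:
  "of_real_coords x $ 1 = Complex (x$1) (x$2)" "of_real_coords x $ 2 = Complex (x$3) (x$4)"
  by (simp_all add: of_real_coords_def)

lemma linear_of_real_coords: "linear of_real_coords"
  by (rule linearI) (simp_all add: c2_eq_iff complex_eq_iff)

lemma real_coords_inverse [simp]: "real_coords (of_real_coords x) = x" "of_real_coords (real_coords z) = z"
  by (simp_all add: vec_eq_iff forall_4 forall_2 complex_eq_iff)

definition complex_linear :: "(complex^2 \<Rightarrow> complex^2) \<Rightarrow> bool" where
  "complex_linear A \<longleftrightarrow> linear A \<and> (\<forall>c v. A (c *s v) = c *s A v)"

definition cdet :: "(complex^2 \<Rightarrow> complex^2) \<Rightarrow> complex" where
  "cdet A = A (axis 1 1) $ 1 * A (axis 2 1) $ 2 - A (axis 2 1) $ 1 * A (axis 1 1) $ 2"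

lemma complex_linear_expand:
  assumes "complex_linear A"
  shows "A v $ 1 = v $ 1 * A (axis 1 1) $ 1 + v $ 2 * A (axis 2 1) $ 1"
    and "A v $ 2 = v $ 1 * A (axis 1 1) $ 2 + v $ 2 * A (axis 2 1) $ 2"
proof -
  have v: "v = v $ 1 *s axis 1 1 + v $ 2 *s axis 2 1"
    by (simp add: c2_eq_iff axis_def)
  have "A v = v $ 1 *s A (axis 1 1) + v $ 2 *s A (axis 2 1)"
    using assms by (subst v) (simp add: complex_linear_def linear_add)
  thus "A v $ 1 = v $ 1 * A (axis 1 1) $ 1 + v $ 2 * A (axis 2 1) $ 1"
    and "A v $ 2 = v $ 1 * A (axis 1 1) $ 2 + v $ 2 * A (axis 2 1) $ 2" by simp_all
qed

text \<open>Vectors are rows here, so A acts by right multiplication with the real matrix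
  \<open>B\<close>, and det B is the sum of the squares of the real and imaginary parts of
  \<open>cdet A\<close>.\<close>

lemma vol_form_complex_linear:
  assumes "complex_linear A"
  shows "vol_form (A v1) (A v2) (A v3) (A v4) = (cmod (cdet A))\<^sup>2 * vol_form v1 v2 v3 v4"
proof -
  define a b c d where abcd: "a = A (axis 1 1) $ 1" "b = A (axis 2 1) $ 1" "c = A (axis 1 1) $ 2" "d = A (axis 2 1) $ 2"
  have e: "A v $ 1 = v $ 1 * a + v $ 2 * b" "A v $ 2 = v $ 1 * c + v $ 2 * d" for v
    unfolding abcd by (rule complex_linear_expand[OF assms])+
  define B :: "real^4^4" where "B = vector [vector [Re a, Im a, Re c, Im c], vector [- Im a, Re a, - Im c, Re c],
     vector [Re b, Im b, Re d, Im d], vector [- Im b, Re b, - Im d, Re d]]"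
  have "vector [real_coords (A v1), real_coords (A v2), real_coords (A v3), real_coords (A v4)]
     = (vector [real_coords v1, real_coords v2, real_coords v3, real_coords v4] :: real^4^4) ** B"
    unfolding vec_eq_iff forall_4 matrix_matrix_mult_def B_def
    by (simp add: sum_4 e algebra_simps)
  hence "vol_form (A v1) (A v2) (A v3) (A v4) = vol_form v1 v2 v3 v4 * det B"
    unfolding vol_form_def by (simp add: det_mul)
  also have "det B = (cmod (cdet A))\<^sup>2"
  proof -
    have "det B = (Re a * Re d - Im a * Im d - (Re b * Re c - Im b * Im c))\<^sup>2 + (Re a * Im d + Im a * Re d - (Re b * Im c + Im b * Re c))\<^sup>2"
      unfolding det_4 B_def vector_4 by (simp only: power2_eq_square algebra_simps mult_minus_left mult_minus_right minus_minus)
    thus ?thesis unfolding cdet_def abcd[symmetric] cmod_power2 by simp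
  qed
  finally show ?thesis by simp
qed

lemma det_real_coords:
  assumes "linear A"
  shows "det (matrix (real_coords \<circ> A \<circ> of_real_coords))
      = vol_form (A (axis 1 1)) (A (axis 1 \<i>)) (A (axis 2 1)) (A (axis 2 \<i>))"
proof -
  have o: "of_real_coords (axis 1 1) = axis 1 1" "of_real_coords (axis 2 1) = axis 1 \<i>"
    "of_real_coords (axis 3 1) = axis 2 1" "of_real_coords (axis 4 1) = axis 2 \<i>"
    by (simp_all add: c2_eq_iff axis_def complex_eq_iff)
  have "transpose (matrix (real_coords \<circ> A \<circ> of_real_coords)) =
     vector [real_coords (A (axis 1 1)), real_coords (A (axis 1 \<i>)), real_coords (A (axis 2 1)), real_coords (A (axis 2 \<i>))]"
    unfolding vec_eq_iff forall_4 by (simp add: transpose_def matrix_def o)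
  thus ?thesis unfolding vol_form_def by (metis det_transpose)
qed

lemma vol_form_standard: "vol_form (axis 1 1) (axis 1 \<i>) (axis 2 1) (axis 2 \<i>) = 1"
  unfolding vol_form_def det_4 by (simp add: axis_def)

lemma det_complex_linear:
  assumes "complex_linear A"
  shows "det (matrix (real_coords \<circ> A \<circ> of_real_coords)) = (cmod (cdet A))\<^sup>2"
  using assms by (simp add: det_real_coords vol_form_complex_linear vol_form_standard complex_linear_def)

section \<open>Change of variables in C^2\<close>

lemma lebesgue_distr_basis_bij:
  fixes T :: "'a::euclidean_space \<Rightarrow> 'b::euclidean_space"
  assumes "linear T" and "bij_betw T Basis Basis"
  shows "distr lebesgue lebesgue T = lebesgue" and "T \<in> lebesgue \<rightarrow>\<^sub>M lebesgue"
proof -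
  have [measurable]: "T \<in> borel \<rightarrow>\<^sub>M borel"
    using \<open>linear T\<close> by (intro borel_measurable_continuous_onI linear_continuous_on) (simp add: linear_conv_bounded_linear[symmetric])
  have TL: "T \<in> lebesgue \<rightarrow>\<^sub>M lborel" by (rule measurable_completion) simp
  have eq: "distr lebesgue lborel T = lborel"
  proof (rule measure_eqI)
    fix A assume "A \<in> sets (distr lebesgue lborel T)"
    hence A[measurable]: "A \<in> sets borel" by simp
    have "T -` A \<in> sets borel" using measurable_sets[of T borel borel A] by simp
    hence "emeasure (distr lebesgue lborel T) A = emeasure (distr lborel borel T) A"
      using TL by (simp add: emeasure_distr)
    thus "emeasure (distr lebesgue lborel T) A = emeasure lborel A"
      using lborel_distr_basis_bij[OF assms] by simp
  qed simp
  from completion.completion_distr_eq[OF TL] eq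
  show d: "distr lebesgue lebesgue T = lebesgue" by simp
  show "T \<in> lebesgue \<rightarrow>\<^sub>M lebesgue"
    by (rule completion.measurable_completion2[OF TL]) (simp add: eq)
qed

lemma basis_bij_change_of_variables:
  fixes T :: "'a::euclidean_space \<Rightarrow> 'b::euclidean_space" and f :: "'b \<Rightarrow> real"
  assumes T: "linear T" "bij_betw T Basis Basis" and T': "linear T'" "bij_betw T' Basis Basis"
    and inv: "\<And>x. T' (T x) = x" "\<And>y. T (T' y) = y"
  shows "f absolutely_integrable_on T ` S \<longleftrightarrow> (\<lambda>x. f (T x)) absolutely_integrable_on S"
    and "f absolutely_integrable_on T ` S \<Longrightarrow> integral (T ` S) f = integral S (\<lambda>x. f (T x))"
proof -
  note Tm[measurable] = lebesgue_distr_basis_bij(2)[OF T] and T'm[measurable] = lebesgue_distr_basis_bij(2)[OF T']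
  define g where "g y = indicator (T ` S) y *\<^sub>R f y" for y
  have gT: "g (T x) = indicator S x *\<^sub>R f (T x)" for x
    using inv by (auto simp: g_def indicator_def image_iff) metis
  have meas: "g \<in> borel_measurable lebesgue \<longleftrightarrow> (\<lambda>x. g (T x)) \<in> borel_measurable lebesgue"
  proof
    assume "g \<in> borel_measurable lebesgue"
    thus "(\<lambda>x. g (T x)) \<in> borel_measurable lebesgue" by (rule measurable_compose[OF Tm])
  next
    assume "(\<lambda>x. g (T x)) \<in> borel_measurable lebesgue"
    from measurable_compose[OF T'm this] show "g \<in> borel_measurable lebesgue" by (simp add: inv)
  qed
  have int: "integrable lebesgue g \<longleftrightarrow> integrable lebesgue (\<lambda>x. g (T x))"
  proof (cases "g \<in> borel_measurable lebesgue")
    case True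
    from integrable_distr_eq[OF Tm True] show ?thesis by (simp add: lebesgue_distr_basis_bij(1)[OF T])
  next
    case False
    thus ?thesis using meas borel_measurable_integrable by blast
  qed
  thus eq: "f absolutely_integrable_on T ` S \<longleftrightarrow> (\<lambda>x. f (T x)) absolutely_integrable_on S"
    unfolding set_integrable_def gT[symmetric] g_def[symmetric] .
  assume ai: "f absolutely_integrable_on T ` S"
  hence "integrable lebesgue g" unfolding set_integrable_def g_def[symmetric] .
  hence gm: "g \<in> borel_measurable lebesgue" by (rule borel_measurable_integrable)
  have "integral (T ` S) f = integral\<^sup>L lebesgue g"
    using set_lebesgue_integral_eq_integral(2)[OF ai] by (simp add: set_lebesgue_integral_def g_def[abs_def])
  also have "\<dots> = integral\<^sup>L lebesgue (\<lambda>x. g (T x))"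
    using integral_distr[OF Tm gm] by (simp add: lebesgue_distr_basis_bij(1)[OF T])
  also have "\<dots> = integral S (\<lambda>x. f (T x))"
    using set_lebesgue_integral_eq_integral(2)[OF ai[unfolded eq]] by (simp add: set_lebesgue_integral_def gT)
  finally show "integral (T ` S) f = integral S (\<lambda>x. f (T x))" .
qed

lemma basis_bij_real_coords: "bij_betw real_coords Basis Basis" "bij_betw of_real_coords Basis Basis"
proof -
  have 1: "real_coords ` Basis \<subseteq> Basis"
  proof
    fix y assume "y \<in> real_coords ` Basis"
    then obtain i u where u: "u \<in> Basis" "y = real_coords (axis i u)" by (auto simp: Basis_vec_def)
    have "i = 1 \<or> i = 2" by (rule exhaust_2)
    moreover have "u = 1 \<or> u = \<i>" using u by (simp add: Basis_complex_def)
    ultimately have "y = axis 1 1 \<or> y = axis 2 1 \<or> y = axis 3 1 \<or> y = axis 4 1"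
      unfolding u vec_eq_iff forall_4 by (auto simp: axis_def)
    thus "y \<in> Basis" by auto
  qed
  have 2: "of_real_coords ` Basis \<subseteq> Basis"
  proof
    fix y assume "y \<in> of_real_coords ` Basis"
    then obtain i where i: "y = of_real_coords (axis i 1)" by (auto simp: Basis_vec_def)
    have "i = 1 \<or> i = 2 \<or> i = 3 \<or> i = 4" by (rule exhaust_4)
    hence "y = axis 1 1 \<or> y = axis 1 \<i> \<or> y = axis 2 1 \<or> y = axis 2 \<i>"
      unfolding i c2_eq_iff by (auto simp: axis_def complex_eq_iff)
    thus "y \<in> Basis" by (auto simp: Basis_complex_def)
  qed
  show "bij_betw real_coords Basis Basis"
    by (rule bij_betwI[where g = of_real_coords]) (use 1 2 in auto)
  show "bij_betw of_real_coords Basis Basis"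
    by (rule bij_betwI[where g = real_coords]) (use 1 2 in auto)
qed

lemmas real_coords_change_of_variables =
  basis_bij_change_of_variables[OF linear_real_coords basis_bij_real_coords(1) linear_of_real_coords basis_bij_real_coords(2) real_coords_inverse(2,1)]

lemma bounded_linear_real_coords: "bounded_linear real_coords" "bounded_linear of_real_coords"
  by (simp_all add: linear_real_coords linear_of_real_coords linear_conv_bounded_linear[symmetric])

lemma real_coords_change_of_variables_iff:
  fixes f :: "real^4 \<Rightarrow> real"
  shows "f absolutely_integrable_on real_coords ` S \<and> integral (real_coords ` S) f = b
    \<longleftrightarrow> (\<lambda>x. f (real_coords x)) absolutely_integrable_on S \<and> integral S (\<lambda>x. f (real_coords x)) = b"
  using real_coords_change_of_variables[where f = f and S = S] by auto

lemma lebesgue_image_real_coords: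
  assumes "S \<in> sets lebesgue"
  shows "real_coords ` S \<in> sets lebesgue"
proof -
  have "real_coords ` S = of_real_coords -` S \<inter> space lebesgue"
    by (auto simp: image_iff) (metis real_coords_inverse(1))
  thus ?thesis using measurable_sets[OF lebesgue_distr_basis_bij(2)[OF linear_of_real_coords basis_bij_real_coords(2)] assms] by simp
qed

text \<open>The scalar integrand is embedded in real^1, since the general change of variables
  theorem takes vector-valued integrands.\<close>

lemma real_change_of_variables_vec1:
  fixes f :: "real^4 \<Rightarrow> real" and g :: "real^4 \<Rightarrow> real^4"
  assumes S: "S \<in> sets lebesgue"
    and der_g: "\<And>x. x \<in> S \<Longrightarrow> (g has_derivative g' x) (at x within S)"
    and inj: "inj_on g S"
  shows "(\<lambda>x. \<bar>det (matrix (g' x))\<bar> * f (g x)) absolutely_integrable_on S \<and>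
           integral S (\<lambda>x. \<bar>det (matrix (g' x))\<bar> * f (g x)) = b
     \<longleftrightarrow> f absolutely_integrable_on (g ` S) \<and> integral (g ` S) f = b"
proof -
  have *: "h absolutely_integrable_on A \<and> integral A h = b \<longleftrightarrow>
     (\<lambda>x. vec (h x) :: real^1) absolutely_integrable_on A \<and> integral A (\<lambda>x. vec (h x) :: real^1) = vec b"
    for h :: "real^4 \<Rightarrow> real" and A
    unfolding absolutely_integrable_on_1_iff by (auto simp: integral_on_1_eq absolutely_integrable_on_def integrable_on_1_iff vec_eq_iff)
  show ?thesis
    using has_absolute_integral_change_of_variables[OF S der_g inj, of "\<lambda>x. vec (f x) :: real^1" "vec b"]
    unfolding * by (simp add: vec_eq_iff[abs_def] vec_def scaleR_vec_def)
qed

text \<open>Conjugation by \<open>real_coords\<close> reduces this to R^4, where complex linearity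
  of the derivative turns the absolute Jacobian determinant into the squared modulus of
  \<open>cdet\<close>.\<close>

lemma c2_change_of_variables:
  fixes f :: "complex^2 \<Rightarrow> real" and g :: "complex^2 \<Rightarrow> complex^2"
  assumes S: "S \<in> sets lebesgue"
    and der_g: "\<And>x. x \<in> S \<Longrightarrow> (g has_derivative g' x) (at x within S)"
    and cl: "\<And>x. x \<in> S \<Longrightarrow> complex_linear (g' x)"
    and inj: "inj_on g S"
  shows "(\<lambda>x. (cmod (cdet (g' x)))\<^sup>2 * f (g x)) absolutely_integrable_on S \<and>
           integral S (\<lambda>x. (cmod (cdet (g' x)))\<^sup>2 * f (g x)) = b
     \<longleftrightarrow> f absolutely_integrable_on (g ` S) \<and> integral (g ` S) f = b"
proof -
  let ?S = "real_coords ` S" and ?g = "real_coords \<circ> g \<circ> of_real_coords" and ?f = "\<lambda>y. f (of_real_coords y)"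
  let ?g' = "\<lambda>x. real_coords \<circ> g' (of_real_coords x) \<circ> of_real_coords"
  have "?S \<in> sets lebesgue" by (rule lebesgue_image_real_coords[OF S])
  moreover have "(?g has_derivative ?g' x) (at x within ?S)" if "x \<in> ?S" for x
  proof -
    have x: "of_real_coords x \<in> S" using that by auto
    have im: "of_real_coords ` ?S = S" by (simp add: image_image)
    have "(g \<circ> of_real_coords has_derivative g' (of_real_coords x) \<circ> of_real_coords) (at x within ?S)"
      by (rule diff_chain_within) (use der_g[OF x] im in \<open>auto intro: bounded_linear_imp_has_derivative bounded_linear_real_coords\<close>)
    hence "(real_coords \<circ> (g \<circ> of_real_coords) has_derivative real_coords \<circ> (g' (of_real_coords x) \<circ> of_real_coords)) (at x within ?S)"
      by (rule diff_chain_within) (auto intro: bounded_linear_imp_has_derivative bounded_linear_real_coords)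
    thus ?thesis by (simp add: o_assoc)
  qed
  moreover have "inj_on ?g ?S"
    using inj by (auto simp: inj_on_def) (metis real_coords_inverse(2))
  ultimately have "(\<lambda>x. \<bar>det (matrix (?g' x))\<bar> * ?f (?g x)) absolutely_integrable_on ?S \<and>
           integral ?S (\<lambda>x. \<bar>det (matrix (?g' x))\<bar> * ?f (?g x)) = b
     \<longleftrightarrow> ?f absolutely_integrable_on (?g ` ?S) \<and> integral (?g ` ?S) ?f = b"
    by (rule real_change_of_variables_vec1)
  also have "?g ` ?S = real_coords ` (g ` S)" by (auto simp: image_image)
  also have "?f absolutely_integrable_on (real_coords ` (g ` S)) \<and> integral (real_coords ` (g ` S)) ?f = b
      \<longleftrightarrow> f absolutely_integrable_on (g ` S) \<and> integral (g ` S) f = b"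
    by (subst real_coords_change_of_variables_iff) simp
  also have "(\<lambda>x. \<bar>det (matrix (?g' x))\<bar> * ?f (?g x)) absolutely_integrable_on ?S \<and>
           integral ?S (\<lambda>x. \<bar>det (matrix (?g' x))\<bar> * ?f (?g x)) = b
     \<longleftrightarrow> (\<lambda>x. \<bar>det (matrix (?g' (real_coords x)))\<bar> * ?f (?g (real_coords x))) absolutely_integrable_on S \<and>
           integral S (\<lambda>x. \<bar>det (matrix (?g' (real_coords x)))\<bar> * ?f (?g (real_coords x))) = b"
    by (rule real_coords_change_of_variables_iff)
  also have "\<dots> \<longleftrightarrow> (\<lambda>x. (cmod (cdet (g' x)))\<^sup>2 * f (g x)) absolutely_integrable_on S \<and>
           integral S (\<lambda>x. (cmod (cdet (g' x)))\<^sup>2 * f (g x)) = b"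
    using cl by (intro arg_cong2[where f = "(\<and>)"] set_integrable_cong arg_cong[where f = "\<lambda>x. x = b"] integral_cong)
      (auto simp: det_complex_linear)
  finally show ?thesis by blast
qed

section \<open>Polynomials on the ball and the sphere\<close>

definition ev :: "complex poly poly \<Rightarrow> complex^2 \<Rightarrow> complex" where
  "ev P z = poly (poly P [:z $ 2:]) (z $ 1)"

lemma ev_mult: "ev (P * Q) z = ev P z * ev Q z"
  by (simp add: ev_def)

lemma finite_triangle: "finite {(m,n). m + n \<le> (K::nat)}"
  by (rule finite_subset[of _ "{..K}\<times>{..K}"]) auto

lemma sum_triangle:
  "(\<Sum>(m,n)\<in>{(m,n). m + n \<le> K}. h m n) = (\<Sum>k\<le>K. \<Sum>m\<le>k. h m (k - m))" for h :: "nat \<Rightarrow> nat \<Rightarrow> 'a::comm_monoid_add"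
  by (subst sum.Sigma, simp, simp, rule sum.reindex_bij_witness[of _ "\<lambda>(k,m). (m,k-m)" "\<lambda>(i,j). (i+j,i)"]) auto

text \<open>The expansion runs over the triangle m + n <= K and holds for every large
  \<open>K\<close>, so that several polynomials can share one \<open>K\<close> and sums can be
  regrouped by degree.\<close>

lemma ev_expansion:
  obtains K0 where "\<And>K z. K \<ge> K0 \<Longrightarrow> ev P z = (\<Sum>(m,n)\<in>{(m,n). m + n \<le> K}. cf P m n * z $ 1 ^ m * z $ 2 ^ n)"
proof -
  define d where "d = degree P + (\<Sum>n\<le>degree P. degree (coeff P n))"
  have vanish: "cf P m n = 0" if "m > d \<or> n > d" for m n
  proof (cases "n \<le> degree P")
    case True
    hence "degree (coeff P n) \<le> (\<Sum>n\<le>degree P. degree (coeff P n))" by (intro member_le_sum) auto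
    thus ?thesis using that True by (auto simp: cf_def d_def intro!: coeff_eq_0)
  qed (simp add: cf_def coeff_eq_0)
  have bounds: "m \<le> d" "n \<le> d" if "cf P m n \<noteq> 0" for m n
    using vanish[of m n] that by (auto simp: not_le[symmetric])
  have "ev P z = (\<Sum>(m,n)\<in>{(m,n). m + n \<le> K}. cf P m n * z $ 1 ^ m * z $ 2 ^ n)" if K: "K \<ge> 2 * d" for K z
  proof -
    have "ev P z = (\<Sum>n\<le>degree P. poly (coeff P n) (z $ 1) * z $ 2 ^ n)"
      unfolding ev_def by (simp add: poly_altdef[of P] poly_sum)
    also have "\<dots> = (\<Sum>n\<le>d. poly (coeff P n) (z $ 1) * z $ 2 ^ n)"
      by (rule sum.mono_neutral_left) (auto simp: d_def coeff_eq_0)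
    also have "\<dots> = (\<Sum>n\<le>d. \<Sum>m\<le>d. cf P m n * z $ 1 ^ m * z $ 2 ^ n)"
    proof (rule sum.cong[OF refl])
      fix n assume "n \<in> {..d}"
      have "poly (coeff P n) (z $ 1) = (\<Sum>m\<le>d. cf P m n * z $ 1 ^ m)"
        unfolding poly_altdef cf_def
        by (rule sum.mono_neutral_cong) (use vanish in \<open>auto simp: cf_def coeff_eq_0 not_le\<close>)
      thus "poly (coeff P n) (z $ 1) * z $ 2 ^ n = (\<Sum>m\<le>d. cf P m n * z $ 1 ^ m * z $ 2 ^ n)"
        by (simp add: sum_distrib_right)
    qed
    also have "\<dots> = (\<Sum>(m,n)\<in>{..d}\<times>{..d}. cf P m n * z $ 1 ^ m * z $ 2 ^ n)"
      by (subst sum.swap) (simp add: sum.cartesian_product)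
    also have "\<dots> = (\<Sum>(m,n)\<in>{(m,n). m + n \<le> K}. cf P m n * z $ 1 ^ m * z $ 2 ^ n)"
      by (rule sum.mono_neutral_left) (use K finite_triangle in \<open>auto dest: bounds\<close>)
    finally show ?thesis .
  qed
  thus ?thesis by (rule that)
qed

section \<open>The Euler operator\<close>

text \<open>The operator z_1 d/dz_1 + z_2 d/dz_2. The outer variable is z_2, so the first summand
  differentiates in z_2 and the second, coefficientwise, in z_1.\<close>

definition euler :: "complex poly poly \<Rightarrow> complex poly poly" where
  "euler P = [:0, 1:] * pderiv P + map_poly (\<lambda>q. [:0, 1:] * pderiv q) P"

lemma coeff_X_pderiv: "coeff ([:0, 1:] * pderiv P) n = of_nat n * coeff P n" for P :: "'a::idom poly"
  by (cases n) (simp_all add: coeff_pderiv)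

lemma cf_euler: "cf (euler P) m n = of_nat (m + n) * cf P m n"
proof -
  have a: "coeff (coeff ([:0, 1:] * pderiv P) n) m = of_nat n * coeff (coeff P n) m"
    proof -
    have "of_nat n * q = smult (of_nat n) q" for q :: "complex poly"
      by (induction n) (simp_all add: algebra_simps smult_add_left)
    thus ?thesis by (simp only: coeff_X_pderiv coeff_smult)
  qed
  have b: "coeff (map_poly (\<lambda>q. [:0, 1:] * pderiv q) P) n = [:0, 1:] * pderiv (coeff P n)"
    by (rule coeff_map_poly) simp
  show ?thesis unfolding cf_def euler_def coeff_add a b unfolding coeff_X_pderiv by (simp add: algebra_simps)
qed

lemma cf_eqI: "(\<And>m n. cf P m n = cf Q m n) \<Longrightarrow> P = Q"
  by (intro poly_eqI) (simp add: cf_def)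

lemma cf_add: "cf (P + Q) m n = cf P m n + cf Q m n"
  by (simp add: cf_def)

text \<open>On coefficients the operator multiplies by the degree, and degrees add in a
  product.\<close>

lemma euler_mult: "euler (P * Q) = euler P * Q + P * euler Q"
proof (rule cf_eqI)
  fix m n
  show "cf (euler (P * Q)) m n = cf (euler P * Q + P * euler Q) m n"
    unfolding cf_euler cf_mult cf_add sum_distrib_left sum.distrib[symmetric]
  proof (intro sum.cong refl)
    fix i j assume "i \<in> {..m}" "j \<in> {..n}"
    hence "of_nat (m + n) = (of_nat (i + j) + of_nat (m - i + (n - j)) :: complex)"
      by (simp flip: of_nat_add)
    thus "of_nat (m + n) * (cf P i j * cf Q (m - i) (n - j)) =
       of_nat (i + j) * cf P i j * cf Q (m - i) (n - j) + cf P i j * (of_nat (m - i + (n - j)) * cf Q (m - i) (n - j))"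
      by (simp only:) (simp add: algebra_simps)
  qed
qed

lemma hom_norm_euler: "hom_norm k (euler P) = (real k)\<^sup>2 * hom_norm k P"
  unfolding hom_norm_def sum_distrib_left
  by (intro sum.cong refl) (simp add: cf_euler norm_mult power_mult_distrib flip: of_nat_add)

lemma ev_add: "ev (P + Q) z = ev P z + ev Q z"
  by (simp add: ev_def)

section \<open>Rotations and Parseval's identity on the ball\<close>

lemma rotation_change_of_variables:
  fixes f :: "complex^2 \<Rightarrow> real"
  assumes ab: "cmod a = 1" "cmod b = 1" and f: "f absolutely_integrable_on ball 0 1"
  shows "integral (ball 0 1) (\<lambda>z::complex^2. f (vector [a * z $ 1, b * z $ 2])) = integral (ball 0 1) f"
proof -
  define g :: "complex^2 \<Rightarrow> complex^2" where "g z = vector [a * z $ 1, b * z $ 2]" for z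
  have lin: "linear g" by (rule linearI) (auto simp: g_def c2_eq_iff algebra_simps)
  have cl: "complex_linear g" using lin by (auto simp: complex_linear_def g_def c2_eq_iff)
  have "cdet g = a * b" by (simp add: cdet_def g_def axis_def)
  hence cd: "(cmod (cdet g))\<^sup>2 = 1" using ab by (simp add: norm_mult)
  have norm_g: "norm (g z) = norm z" for z
    using ab by (simp add: norm_vec_def L2_set_def sum_2 g_def norm_mult)
  have "a \<noteq> 0" "b \<noteq> 0" using ab by auto
  hence inj: "inj_on g (ball 0 1)" by (auto simp: inj_on_def g_def c2_eq_iff)
  have im: "g ` ball 0 1 = ball 0 1"
  proof (intro equalityI subsetI)
    fix y :: "complex^2" assume y: "y \<in> ball 0 1"
    define x :: "complex^2" where "x = vector [y $ 1 / a, y $ 2 / b]"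
    have gx: "g x = y" using \<open>a \<noteq> 0\<close> \<open>b \<noteq> 0\<close> by (simp add: x_def g_def c2_eq_iff)
    hence "norm x = norm y" using norm_g by metis
    thus "y \<in> g ` ball 0 1" using y gx by (intro image_eqI[of _ _ x]) auto
  qed (auto simp: norm_g)
  have "(\<lambda>x. (cmod (cdet g))\<^sup>2 * f (g x)) absolutely_integrable_on (ball 0 1) \<and>
           integral (ball 0 1) (\<lambda>x. (cmod (cdet g))\<^sup>2 * f (g x)) = integral (ball 0 1) f"
  proof (subst c2_change_of_variables[where g' = "\<lambda>x. g"])
    show "(g has_derivative g) (at x within ball 0 1)" for x
      using lin by (auto intro: bounded_linear_imp_has_derivative simp: linear_conv_bounded_linear)
  qed (use f inj im cl in auto)
  thus ?thesis by (simp add: cd g_def)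
qed

lemma absolutely_integrable_on_ball_bounded:
  fixes f :: "complex^2 \<Rightarrow> real"
  assumes "f \<in> borel_measurable borel" "\<And>z. z \<in> ball 0 1 \<Longrightarrow> \<bar>f z\<bar> \<le> C"
  shows "f absolutely_integrable_on ball 0 1"
proof (rule measurable_bounded_by_integrable_imp_absolutely_integrable)
  show "f \<in> borel_measurable (lebesgue_on (ball 0 1))"
    using assms(1) by (intro measurable_restrict_space1 measurable_completion) simp
  show "(\<lambda>x. C) integrable_on (ball (0::complex^2) 1)"
    by (rule integrable_on_const) simp
qed (use assms in auto)

lemma measurable_c2_nth [measurable]: "(\<lambda>z::complex^2. z $ 1) \<in> borel_measurable borel" "(\<lambda>z::complex^2. z $ 2) \<in> borel_measurable borel"
  by (intro borel_measurable_continuous_onI continuous_intros)+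

lemma c2_nth_le: "cmod (z $ 1) \<le> norm z" "cmod (z $ 2) \<le> norm z" for z :: "complex^2"
  by (simp_all add: Finite_Cartesian_Product.norm_nth_le)

lemma monomial_bound:
  fixes z :: "complex^2"
  shows "cmod (z $ 1 ^ m * z $ 2 ^ n) \<le> norm z ^ (m + n)"
  unfolding norm_mult norm_power power_add
  by (intro mult_mono power_mono c2_nth_le) auto

text \<open>A rotation of the two coordinates that multiplies one monomial times the conjugate of
  the other by -1 takes \<open>h\<close> to its negative and preserves the ball, so the integral is
  its own negative. The factors \<open>u\<close> are radial and depend only on the degree; the
  product \<open>u k x * x ^ k\<close> is what is bounded, since \<open>u\<close> itself may blow up
  at the origin.\<close>

lemma monomials_orthogonal:
  fixes u :: "nat \<Rightarrow> real \<Rightarrow> real" and \<kappa> :: complex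
  assumes [measurable]: "\<And>k. u k \<in> borel_measurable borel"
    and bd: "\<And>k x. 0 \<le> x \<Longrightarrow> x < 1 \<Longrightarrow> \<bar>u k x * x ^ k\<bar> \<le> C k"
    and ne: "(m, n) \<noteq> (m', n')"
  defines "h \<equiv> \<lambda>z::complex^2. Re (\<kappa> * (of_real (u (m + n) (norm z)) * z $ 1 ^ m * z $ 2 ^ n)
     * cnj (of_real (u (m' + n') (norm z)) * z $ 1 ^ m' * z $ 2 ^ n'))"
  shows "h absolutely_integrable_on ball 0 1" "integral (ball 0 1) h = 0"
proof -
  have mb: "cmod (of_real (u (m + n) (norm z)) * z $ 1 ^ m * z $ 2 ^ n) \<le> C (m + n)" if "z \<in> ball 0 1" for m n and z :: "complex^2"
  proof -
    have "cmod (of_real (u (m + n) (norm z)) * z $ 1 ^ m * z $ 2 ^ n) \<le> \<bar>u (m + n) (norm z)\<bar> * norm z ^ (m + n)"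
      using monomial_bound[of z m n] by (simp add: norm_mult mult.assoc mult_left_mono)
    also have "\<dots> \<le> C (m + n)" using bd[of "norm z" "m + n"] that by (simp add: abs_mult)
    finally show ?thesis .
  qed
  have [measurable]: "cnj \<in> borel_measurable borel" by (intro borel_measurable_continuous_onI continuous_intros)
  have [measurable]: "h \<in> borel_measurable borel" unfolding h_def by measurable
  show ai: "h absolutely_integrable_on ball 0 1"
  proof (rule absolutely_integrable_on_ball_bounded)
    fix z :: "complex^2" assume z: "z \<in> ball 0 1"
    have "\<bar>h z\<bar> \<le> cmod \<kappa> * cmod (of_real (u (m + n) (norm z)) * z $ 1 ^ m * z $ 2 ^ n)
       * cmod (of_real (u (m' + n') (norm z)) * z $ 1 ^ m' * z $ 2 ^ n')"
      unfolding h_def by (rule order.trans[OF abs_Re_le_cmod]) (simp only: norm_mult complex_mod_cnj mult.assoc order.refl)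
    also have "\<dots> \<le> cmod \<kappa> * C (m + n) * C (m' + n')"
      using mb[OF z] by (intro mult_mono mult_left_mono mult_nonneg_nonneg order.trans[OF norm_ge_zero mb[OF z]]) auto
    finally show "\<bar>h z\<bar> \<le> cmod \<kappa> * C (m + n) * C (m' + n')" .
  qed measurable
  have key: "integral (ball 0 1) h = 0" if ab: "cmod a = 1" "cmod b = 1" "a ^ m * b ^ n * cnj (a ^ m' * b ^ n') = -1" for a b
  proof -
    have "h (vector [a * z $ 1, b * z $ 2]) = - h z" for z
    proof -
      have nz: "norm (vector [a * z $ 1, b * z $ 2] :: complex^2) = norm z"
        using ab by (simp add: norm_vec_def L2_set_def sum_2 norm_mult)
      have "\<kappa> * (x * (a * z $ 1) ^ m * (b * z $ 2) ^ n) * cnj (y * (a * z $ 1) ^ m' * (b * z $ 2) ^ n')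
        = (a ^ m * b ^ n * cnj (a ^ m' * b ^ n')) * (\<kappa> * (x * z $ 1 ^ m * z $ 2 ^ n) * cnj (y * z $ 1 ^ m' * z $ 2 ^ n'))" for x y
        by (simp add: power_mult_distrib mult_ac)
      note eq = this[of "of_real (u (m + n) (norm z))" "of_real (u (m' + n') (norm z))"]
      show ?thesis unfolding h_def nz vector_2 eq ab(3) by (simp only: mult_minus1 uminus_complex.sel)
    qed
    hence "integral (ball 0 1) h = integral (ball 0 1) (\<lambda>z. - h z)"
      using rotation_change_of_variables[OF ab(1,2) ai] by simp
    thus ?thesis by simp
  qed
  \<comment> \<open>The angle pi/(p - q) gives z^p times the conjugate of z^q the value exp(i
    pi).\<close>
  have cis: "cis (pi / (real p - real q)) ^ p * cnj (cis (pi / (real p - real q)) ^ q) = -1" if "p \<noteq> q" for p q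
  proof -
    have "cis (pi / (real p - real q)) ^ p * cnj (cis (pi / (real p - real q)) ^ q)
       = cis (real p * (pi / (real p - real q)) - real q * (pi / (real p - real q)))"
      by (simp only: Complex.DeMoivre cis_cnj cis_mult add_uminus_conv_diff)
    also have "real p * (pi / (real p - real q)) - real q * (pi / (real p - real q)) = pi"
    proof -
      have "real p * x - real q * x = (real p - real q) * x" for x by (simp add: left_diff_distrib)
      thus ?thesis using that by (simp del: times_divide_eq_right) simp
    qed
    finally show ?thesis by simp
  qed
  show "integral (ball 0 1) h = 0"
  proof (cases "m = m'")
    case True
    hence "n \<noteq> n'" using ne by simp
    from cis[OF this] show ?thesis by (intro key[of 1 "cis (pi / (real n - real n'))"]) auto
  next
    case False
    from cis[OF this] show ?thesis by (intro key[of "cis (pi / (real m - real m'))" 1]) auto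
  qed
qed

lemma integral_monomial_ball:
  fixes u :: "nat \<Rightarrow> real \<Rightarrow> real"
  assumes [measurable]: "\<And>k. u k \<in> borel_measurable borel"
    and I: "((\<lambda>t. t ^ (m + n + 1) * (u (m + n) (sqrt t))\<^sup>2) has_integral I) {0<..<1}"
  shows "(\<lambda>z::complex^2. (cmod (of_real (u (m + n) (norm z)) * z $ 1 ^ m * z $ 2 ^ n))\<^sup>2) absolutely_integrable_on ball 0 1"
    and "integral (ball 0 1) (\<lambda>z::complex^2. (cmod (of_real (u (m + n) (norm z)) * z $ 1 ^ m * z $ 2 ^ n))\<^sup>2) = pi\<^sup>2 * mono_wt m n * I"
proof -
  let ?f = "\<lambda>z::complex^2. (cmod (of_real (u (m + n) (norm z)) * z $ 1 ^ m * z $ 2 ^ n))\<^sup>2"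
  have I0: "I \<ge> 0" by (rule has_integral_nonneg[OF I]) auto
  have [measurable]: "(indicator (ball 0 1) :: complex^2 \<Rightarrow> real) \<in> borel_measurable borel"
    by (intro borel_measurable_indicator borel_open open_ball)
  have "(\<integral>\<^sup>+z. ennreal (indicator (ball 0 1) z * ?f z) \<partial>lborel)
    = (\<integral>\<^sup>+z. indicator (ball (0::complex^2) 1) z * ennreal ((cmod (z$1)) ^ (2 * m) * (cmod (z$2)) ^ (2 * n) * (u (m + n) (sqrt ((norm z)\<^sup>2)))\<^sup>2) \<partial>lborel)"
    by (intro nn_integral_cong) (auto simp: indicator_def norm_mult norm_power power_mult_distrib power_mult mult_ac simp flip: power_mult)
  also have "\<dots> = ennreal (pi\<^sup>2 * mono_wt m n) * (\<integral>\<^sup>+t. indicator {0<..<1} t * ennreal (t ^ (m + n + 1) * (u (m + n) (sqrt t))\<^sup>2) \<partial>lborel)"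
    by (rule nn_integral_monomial_ball) auto
  also have "(\<integral>\<^sup>+t. indicator {0<..<1} t * ennreal (t ^ (m + n + 1) * (u (m + n) (sqrt t))\<^sup>2) \<partial>lborel) = ennreal I"
    using nn_integral_has_integral_lebesgue'[OF _ I] by (auto simp: mult.commute)
  finally have nn: "(\<integral>\<^sup>+z. ennreal (indicator (ball 0 1) z * ?f z) \<partial>lborel) = ennreal (pi\<^sup>2 * mono_wt m n * I)"
    using I0 by (simp add: ennreal_mult less_imp_le[OF mono_wt_pos])
  have hb: "has_bochner_integral lborel (\<lambda>z. indicator (ball 0 1) z * ?f z) (pi\<^sup>2 * mono_wt m n * I)"
    by (rule has_bochner_integral_nn_integral) (use nn I0 in \<open>auto simp: less_imp_le[OF mono_wt_pos]\<close>)
  hence *: "integrable lebesgue (\<lambda>z. indicator (ball 0 1) z * ?f z)" "integral\<^sup>L lebesgue (\<lambda>z. indicator (ball 0 1) z * ?f z) = pi\<^sup>2 * mono_wt m n * I"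
    by (auto simp: has_bochner_integral_iff integrable_completion integral_completion)
  from *(1) show ai: "?f absolutely_integrable_on ball 0 1" by (simp add: set_integrable_def)
  from set_lebesgue_integral_eq_integral(2)[OF ai] *(2)
  show "integral (ball 0 1) ?f = pi\<^sup>2 * mono_wt m n * I" by (simp add: set_lebesgue_integral_def)
qed

text \<open>One identity for two uses: u = 1 gives the Bergman norm, and u k x = (s/x)^k moves each
  homogeneous part to the sphere of radius s. Cross terms vanish by rotation, and the diagonal ones
  are beta integrals.\<close>

lemma parseval_ball:
  fixes u :: "nat \<Rightarrow> real \<Rightarrow> real" and K :: nat and P :: "complex poly poly"
  assumes meas: "\<And>k. u k \<in> borel_measurable borel"
    and bd: "\<And>k x. 0 \<le> x \<Longrightarrow> x < 1 \<Longrightarrow> \<bar>u k x * x ^ k\<bar> \<le> C k"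
    and I: "\<And>k. ((\<lambda>t. t ^ (k + 1) * (u k (sqrt t))\<^sup>2) has_integral I k) {0<..<1}"
  defines "F \<equiv> \<lambda>z::complex^2. \<Sum>(m,n)\<in>{(m,n). m + n \<le> K}. cf P m n * (of_real (u (m + n) (norm z)) * z $ 1 ^ m * z $ 2 ^ n)"
  shows "(\<lambda>z. (cmod (F z))\<^sup>2) absolutely_integrable_on ball 0 1"
    and "integral (ball 0 1) (\<lambda>z. (cmod (F z))\<^sup>2) = pi\<^sup>2 * (\<Sum>k\<le>K. hom_norm k P * I k)"
proof -
  define S where "S = {(m,n). m + n \<le> K}"
  have fS: "finite S" unfolding S_def by (rule finite_triangle)
  define \<phi> where "\<phi> = (\<lambda>(m,n) (z::complex^2). of_real (u (m + n) (norm z)) * z $ 1 ^ m * z $ 2 ^ n :: complex)"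
  define h where "h x y z = Re ((case_prod (cf P) x * cnj (case_prod (cf P) y)) * \<phi> x z * cnj (\<phi> y z))" for x y z
  have F: "(cmod (F z))\<^sup>2 = (\<Sum>x\<in>S. \<Sum>y\<in>S. h x y z)" for z
  proof -
    have Fz: "F z = (\<Sum>x\<in>S. case_prod (cf P) x * \<phi> x z)"
      unfolding F_def S_def \<phi>_def by (intro sum.cong refl) auto
    have "complex_of_real ((cmod (F z))\<^sup>2) = F z * cnj (F z)" by (rule complex_norm_square)
    also have "\<dots> = (\<Sum>x\<in>S. \<Sum>y\<in>S. (case_prod (cf P) x * cnj (case_prod (cf P) y)) * \<phi> x z * cnj (\<phi> y z))"
      unfolding Fz cnj_sum sum_product by (intro sum.cong refl) (simp add: mult_ac)
    finally have "(cmod (F z))\<^sup>2 = Re (\<Sum>x\<in>S. \<Sum>y\<in>S. (case_prod (cf P) x * cnj (case_prod (cf P) y)) * \<phi> x z * cnj (\<phi> y z))"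
      by (metis Re_complex_of_real)
    thus ?thesis by (simp add: h_def)
  qed
  define v where "v x = (cmod (case_prod (cf P) x))\<^sup>2 * (pi\<^sup>2 * case_prod mono_wt x * I (fst x + snd x))" for x
  have h: "h x y absolutely_integrable_on ball 0 1" "integral (ball 0 1) (h x y) = (if x = y then v x else 0)" for x y
  proof -
    obtain m n m' n' where xy: "x = (m,n)" "y = (m',n')" by (metis surj_pair)
    have "h x y absolutely_integrable_on ball 0 1 \<and> integral (ball 0 1) (h x y) = (if x = y then v x else 0)"
    proof (cases "x = y")
      case False
      hence ne: "(m, n) \<noteq> (m', n')" by (simp add: xy)
      have hxy: "h x y = (\<lambda>z. Re (cf P m n * cnj (cf P m' n') * (of_real (u (m + n) (norm z)) * z $ 1 ^ m * z $ 2 ^ n)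
         * cnj (of_real (u (m' + n') (norm z)) * z $ 1 ^ m' * z $ 2 ^ n')))"
        by (rule ext) (simp only: h_def \<phi>_def xy prod.case)
      show ?thesis
        using monomials_orthogonal[OF meas bd ne, where \<kappa> = "cf P m n * cnj (cf P m' n')"] False
        by (simp only: hxy if_False simp_thms)
    next
      case True
      have "h x x z = (cmod (cf P m n))\<^sup>2 * (cmod (\<phi> x z))\<^sup>2" for z
      proof -
        have "(cf P m n * cnj (cf P m n)) * \<phi> x z * cnj (\<phi> x z) = of_real ((cmod (cf P m n))\<^sup>2 * (cmod (\<phi> x z))\<^sup>2)"
          by (simp only: complex_norm_square of_real_mult mult_ac)
        thus ?thesis unfolding h_def xy prod.case by (simp del: of_real_mult of_real_power)
      qed
      hence hx: "h x x = (\<lambda>z. (cmod (cf P m n))\<^sup>2 * (cmod (\<phi> x z))\<^sup>2)" by auto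
      have \<phi>x: "\<phi> x = (\<lambda>z. of_real (u (m + n) (norm z)) * z $ 1 ^ m * z $ 2 ^ n)"
        by (simp add: \<phi>_def xy)
      have A: "(\<lambda>z. (cmod (\<phi> x z))\<^sup>2) absolutely_integrable_on ball 0 1"
        "integral (ball 0 1) (\<lambda>z. (cmod (\<phi> x z))\<^sup>2) = pi\<^sup>2 * mono_wt m n * I (m + n)"
        unfolding \<phi>x by (rule integral_monomial_ball[of u m n "I (m + n)", OF meas I])+
      have "h x x absolutely_integrable_on ball 0 1" unfolding hx by (intro set_integrable_mult_right A(1))
      moreover have "integral (ball 0 1) (h x x) = v x" unfolding hx by (simp only: integral_mult_right A(2)) (simp add: v_def xy(1))
      ultimately show ?thesis using True by simp
    qed
    thus "h x y absolutely_integrable_on ball 0 1" "integral (ball 0 1) (h x y) = (if x = y then v x else 0)" by auto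
  qed
  show "(\<lambda>z. (cmod (F z))\<^sup>2) absolutely_integrable_on ball 0 1"
    unfolding F by (intro absolutely_integrable_sum fS h)
  have "integral (ball 0 1) (\<lambda>z. (cmod (F z))\<^sup>2) = (\<Sum>x\<in>S. \<Sum>y\<in>S. integral (ball 0 1) (h x y))"
    unfolding F by (subst integral_sum, simp add: fS, intro integrable_sum fS set_lebesgue_integral_eq_integral(1) h,
      intro sum.cong refl integral_sum fS set_lebesgue_integral_eq_integral(1) h)
  also have "\<dots> = (\<Sum>x\<in>S. v x)" unfolding h(2) using fS by (simp add: sum.delta)
  also have "\<dots> = (\<Sum>(m,n)\<in>{(m,n). m + n \<le> K}. (cmod (cf P m n))\<^sup>2 * (pi\<^sup>2 * mono_wt m n * I (m + n)))"
    unfolding S_def v_def by (intro sum.cong refl) auto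
  also have "\<dots> = pi\<^sup>2 * (\<Sum>k\<le>K. hom_norm k P * I k)"
    unfolding sum_triangle hom_norm_def sum_distrib_left sum_distrib_right
    by (intro sum.cong refl) auto
  finally show "integral (ball 0 1) (\<lambda>z. (cmod (F z))\<^sup>2) = pi\<^sup>2 * (\<Sum>k\<le>K. hom_norm k P * I k)" .
qed


lemma integral_ball_ev:
  assumes K: "\<And>z. ev P z = (\<Sum>(m,n)\<in>{(m,n). m + n \<le> K}. cf P m n * z $ 1 ^ m * z $ 2 ^ n)"
  shows "(\<lambda>z. (cmod (ev P z))\<^sup>2) absolutely_integrable_on ball 0 1"
    and "integral (ball 0 1) (\<lambda>z. (cmod (ev P z))\<^sup>2) = pi\<^sup>2 / 2 * (\<Sum>k\<le>K. hom_norm k P * (2 / (real k + 2)))"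
proof -
  have I: "((\<lambda>t. t ^ (k + 1) * ((\<lambda>_ _. 1) k (sqrt t))\<^sup>2) has_integral (1 / (real k + 2))) {0<..<1}" for k
    using has_integral_beta_nat[of "k + 1" 0] by (simp add: has_integral_Icc_iff_Ioo mono_wt_def add.commute)
  have bd: "\<bar>(\<lambda>_ _. 1) k x * x ^ k\<bar> \<le> 1" if "0 \<le> x" "x < 1" for k and x :: real
    using that by (simp add: power_le_one)
  have eq: "(\<Sum>(m,n)\<in>{(m,n). m + n \<le> K}. cf P m n * (of_real ((\<lambda>_ _. 1) (m + n) (norm z)) * z $ 1 ^ m * z $ 2 ^ n)) = ev P z" for z
    unfolding K by (intro sum.cong refl) (auto simp: mult_ac)
  from parseval_ball[of "\<lambda>_ _. 1", OF _ bd I, where K = K and P = P]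
  show "(\<lambda>z. (cmod (ev P z))\<^sup>2) absolutely_integrable_on ball 0 1"
    and "integral (ball 0 1) (\<lambda>z. (cmod (ev P z))\<^sup>2) = pi\<^sup>2 / 2 * (\<Sum>k\<le>K. hom_norm k P * (2 / (real k + 2)))"
    unfolding eq by (simp_all add: sum_distrib_left)
qed

text \<open>Means over the sphere are written as means of radially constant functions over the ball.\<close>

lemma integral_sphere_ev:
  fixes s :: real
  assumes K: "\<And>z. ev P z = (\<Sum>(m,n)\<in>{(m,n). m + n \<le> K}. cf P m n * z $ 1 ^ m * z $ 2 ^ n)"
  shows "(\<lambda>z. (cmod (ev P ((s / norm z) *\<^sub>R z)))\<^sup>2) absolutely_integrable_on ball 0 1"
    and "integral (ball 0 1) (\<lambda>z. (cmod (ev P ((s / norm z) *\<^sub>R z)))\<^sup>2) = pi\<^sup>2 / 2 * (\<Sum>k\<le>K. hom_norm k P * s ^ (2 * k))"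
proof -
  define u where "u k x = (s / x) ^ k" for k and x :: real
  have meas: "u k \<in> borel_measurable borel" for k unfolding u_def by measurable
  have I: "((\<lambda>t. t ^ (k + 1) * (u k (sqrt t))\<^sup>2) has_integral (s ^ (2 * k) / 2)) {0<..<1}" for k
  proof (rule has_integral_eq)
    show "((\<lambda>t. s ^ (2 * k) * t) has_integral (s ^ (2 * k) / 2)) {0<..<1}"
      using has_integral_mult_right[OF has_integral_beta_nat[of 1 0], of "s ^ (2 * k)"]
      by (simp add: has_integral_Icc_iff_Ioo mono_wt_def)
    fix t :: real assume t: "t \<in> {0<..<1}"
    have "(u k (sqrt t))\<^sup>2 = ((s / sqrt t)\<^sup>2) ^ k" unfolding u_def by (simp only: power_mult[symmetric] mult.commute)
    also have "(s / sqrt t)\<^sup>2 = s\<^sup>2 / t" using t by (simp add: power_divide)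
    finally show "s ^ (2 * k) * t = t ^ (k + 1) * (u k (sqrt t))\<^sup>2"
      using t by (simp add: power_divide power_mult)
  qed
  \<comment> \<open>With s/0 = 0 and 0^0 = 1 the product at x = 0 is 1 for k = 0 and 0 otherwise;
    the summand 1 covers this.\<close>
  have bd: "\<bar>u k x * x ^ k\<bar> \<le> \<bar>s\<bar> ^ k + 1" for k x
    by (cases "x = 0") (auto simp: u_def power_divide power_abs power_0_left)
  have eq: "(\<Sum>(m,n)\<in>{(m,n). m + n \<le> K}. cf P m n * (of_real (u (m + n) (norm z)) * z $ 1 ^ m * z $ 2 ^ n)) = ev P ((s / norm z) *\<^sub>R z)" for z
  proof -
    have nth: "((s / norm z) *\<^sub>R z) $ i = of_real (s / norm z) * z $ i" for i
      by (simp only: vector_scaleR_component scaleR_conv_of_real[where 'a = complex])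
    define c where "c = complex_of_real (s / norm z)"
    have uc: "complex_of_real (u k (norm z)) = c ^ k" for k by (simp add: u_def c_def)
    show ?thesis unfolding K nth uc c_def[symmetric]
      by (intro sum.cong refl) (auto simp: power_add power_mult_distrib mult_ac)
  qed
  from parseval_ball[of u, OF meas bd I, where K = K and P = P]
  show "(\<lambda>z. (cmod (ev P ((s / norm z) *\<^sub>R z)))\<^sup>2) absolutely_integrable_on ball 0 1"
    and "integral (ball 0 1) (\<lambda>z. (cmod (ev P ((s / norm z) *\<^sub>R z)))\<^sup>2) = pi\<^sup>2 / 2 * (\<Sum>k\<le>K. hom_norm k P * s ^ (2 * k))"
    unfolding eq by (simp_all add: sum_distrib_left)
qed

text \<open>At a point with |z|^2 = t put x = |e|^2, r = |R e|^2, q = (1 - t) x. The Euler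
  derivatives of e^2, e^3, e^4 have squared moduli 4 x r, 9 x^2 r, 16 x^3 r, so the pointwise claim
  is q <= M/4 + q^2/M multiplied by 9 x r (1 - t). The coefficients 9/16 M and 9/(16 M) are 9 M/4
  divided by 4 and 9/M divided by 16.\<close>

lemma bergman_hardy_polynomial:
  assumes M: "M > 0" and h: "2 / pi\<^sup>2 * integral (ball 0 1) (\<lambda>z. cmod (ev e ((1 / norm z) *\<^sub>R z)) ^ 4) \<le> M\<^sup>2"
  shows "2 / pi\<^sup>2 * integral (ball 0 1) (\<lambda>z. cmod (ev e z) ^ 6) \<le> 2 * M ^ 3"
proof -
  obtain K0 where K0: "\<And>P K z. P \<in> {e * e, e * e * e, euler (e * e), euler (e * e * e), euler (e * e * (e * e))} \<Longrightarrow> K \<ge> K0 \<Longrightarrow>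
     ev P z = (\<Sum>(m,n)\<in>{(m,n). m + n \<le> K}. cf P m n * z $ 1 ^ m * z $ 2 ^ n)"
  proof -
    have "\<forall>P. \<exists>k. \<forall>K z. K \<ge> k \<longrightarrow> ev P z = (\<Sum>(m,n)\<in>{(m,n). m + n \<le> K}. cf P m n * z $ 1 ^ m * z $ 2 ^ n)"
      by (intro allI, rule ev_expansion) blast
    from choice[OF this] obtain k where "\<forall>P K z. K \<ge> k P \<longrightarrow> ev P z = (\<Sum>(m,n)\<in>{(m,n). m + n \<le> K}. cf P m n * z $ 1 ^ m * z $ 2 ^ n)" ..
    hence k: "\<And>P K z. K \<ge> k P \<Longrightarrow> ev P z = (\<Sum>(m,n)\<in>{(m,n). m + n \<le> K}. cf P m n * z $ 1 ^ m * z $ 2 ^ n)" by blast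
    let ?S = "{e * e, e * e * e, euler (e * e), euler (e * e * e), euler (e * e * (e * e))}"
    show ?thesis
    proof (rule that[of "\<Sum>P\<in>?S. k P"])
      fix P K z assume P: "P \<in> ?S" and K: "(\<Sum>P\<in>?S. k P) \<le> K"
      have "k P \<le> (\<Sum>P\<in>?S. k P)" using P by (intro member_le_sum) auto
      with K show "ev P z = (\<Sum>(m,n)\<in>{(m,n). m + n \<le> K}. cf P m n * z $ 1 ^ m * z $ 2 ^ n)" by (intro k) simp
    qed
  qed
  note K = K0[OF _ order.refl]
  have e2: "(cmod (ev (e * e) z))\<^sup>2 = cmod (ev e z) ^ 4" for z
    by (simp add: ev_mult norm_mult eval_nat_numeral)
  have e3: "(cmod (ev (e * e * e) z))\<^sup>2 = cmod (ev e z) ^ 6" for z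
    by (simp add: ev_mult norm_mult eval_nat_numeral)
  have "(\<Sum>k\<le>K0. hom_norm k (e * e)) \<le> M\<^sup>2"
  proof -
    have "integral (ball 0 1) (\<lambda>z. cmod (ev e ((1 / norm z) *\<^sub>R z)) ^ 4) = pi\<^sup>2 / 2 * (\<Sum>k\<le>K0. hom_norm k (e * e))"
      using integral_sphere_ev(2)[OF K, of "e * e" 1] unfolding e2 by simp
    with h show ?thesis by simp
  qed
  moreover have "(1 - t)\<^sup>2 * (\<Sum>k\<le>K0. (real k)\<^sup>2 * hom_norm k (e * e * e) * t ^ k)
       \<le> 9/16 * M * ((1 - t) * (\<Sum>k\<le>K0. (real k)\<^sup>2 * hom_norm k (e * e) * t ^ k))
        + 9/(16 * M) * ((1 - t) ^ 3 * (\<Sum>k\<le>K0. (real k)\<^sup>2 * hom_norm k (e * e * (e * e)) * t ^ k))"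
    if t: "0 < t" "t < 1" for t
  proof -
    define w where "w z = (sqrt t / norm z) *\<^sub>R z" for z :: "complex^2"
    define X where "X P = (\<lambda>z. (cmod (ev (euler P) (w z)))\<^sup>2)" for P
    have int: "X P absolutely_integrable_on ball 0 1"
      "integral (ball 0 1) (X P) = pi\<^sup>2 / 2 * (\<Sum>k\<le>K0. (real k)\<^sup>2 * hom_norm k P * t ^ k)"
      if "euler P \<in> {e * e, e * e * e, euler (e * e), euler (e * e * e), euler (e * e * (e * e))}" for P
      using integral_sphere_ev[OF K[OF that], of "sqrt t"] t
      by (simp_all add: X_def[abs_def] w_def hom_norm_euler power_mult)
    have pt: "(1 - t)\<^sup>2 * X (e * e * e) z \<le> 9/16 * M * ((1 - t) * X (e * e) z) + 9/(16 * M) * ((1 - t) ^ 3 * X (e * e * (e * e)) z)" for z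
    proof -
      define x where "x = (cmod (ev e (w z)))\<^sup>2"
      define r where "r = (cmod (ev (euler e) (w z)))\<^sup>2"
      define q where "q = (1 - t) * x"
      have a: "ev (euler (e * e)) (w z) = 2 * (ev e (w z) * ev (euler e) (w z))"
        "ev (euler (e * e * e)) (w z) = 3 * (ev e (w z) * ev e (w z) * ev (euler e) (w z))"
        "ev (euler (e * e * (e * e))) (w z) = 4 * (ev e (w z) * ev e (w z) * ev e (w z) * ev (euler e) (w z))"
        unfolding euler_mult ev_mult ev_add by (simp_all add: algebra_simps)
      have X: "X (e * e) z = 4 * (x * r)" "X (e * e * e) z = 9 * (x * x * r)" "X (e * e * (e * e)) z = 16 * (x * x * x * r)"
        unfolding X_def a by (simp_all add: norm_mult power_mult_distrib x_def r_def)
      have "0 \<le> (M / 2 - q)\<^sup>2 / M" using M by simp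
      also have "(M / 2 - q)\<^sup>2 / M = M / 4 + q\<^sup>2 / M - q"
        using M by (simp add: power2_eq_square field_simps)
      finally have "q \<le> M / 4 + q\<^sup>2 / M" by simp
      hence "9 * (x * r) * (1 - t) * q \<le> 9 * (x * r) * (1 - t) * (M / 4 + q\<^sup>2 / M)"
        using t by (intro mult_left_mono) (auto simp: x_def r_def)
      moreover have "(1 - t)\<^sup>2 * (9 * (x * x * r)) = 9 * (x * r) * (1 - t) * q"
        by (simp add: q_def power2_eq_square)
      moreover have "9/16 * M * ((1 - t) * (4 * (x * r))) = 9 * (x * r) * (1 - t) * (M / 4)" by simp
      moreover have "9/(16 * M) * ((1 - t) ^ 3 * (16 * (x * x * x * r))) = 9 * (x * r) * (1 - t) * (q\<^sup>2 / M)"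
        by (simp add: q_def power2_eq_square power3_eq_cube)
      ultimately show ?thesis unfolding X by (simp only: distrib_left)
    qed
    have i: "X (e * e) integrable_on ball 0 1" "X (e * e * e) integrable_on ball 0 1" "X (e * e * (e * e)) integrable_on ball 0 1"
      by (rule set_lebesgue_integral_eq_integral(1)[OF int(1)], simp)+
    have j: "integral (ball 0 1) (X (e * e)) = pi\<^sup>2 / 2 * (\<Sum>k\<le>K0. (real k)\<^sup>2 * hom_norm k (e * e) * t ^ k)"
      "integral (ball 0 1) (X (e * e * e)) = pi\<^sup>2 / 2 * (\<Sum>k\<le>K0. (real k)\<^sup>2 * hom_norm k (e * e * e) * t ^ k)"
      "integral (ball 0 1) (X (e * e * (e * e))) = pi\<^sup>2 / 2 * (\<Sum>k\<le>K0. (real k)\<^sup>2 * hom_norm k (e * e * (e * e)) * t ^ k)"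
      by (rule int(2), simp)+
    have i1: "(\<lambda>z. 9/16 * M * ((1 - t) * X (e * e) z)) integrable_on ball 0 1"
      by (intro integrable_on_mult_right i)
    have i2: "(\<lambda>z. 9/(16 * M) * ((1 - t) ^ 3 * X (e * e * (e * e)) z)) integrable_on ball 0 1"
      by (intro integrable_on_mult_right i)
    have i3: "(\<lambda>z. (1 - t)\<^sup>2 * X (e * e * e) z) integrable_on ball 0 1"
      by (intro integrable_on_mult_right i)
    have "integral (ball 0 1) (\<lambda>z. (1 - t)\<^sup>2 * X (e * e * e) z)
       \<le> integral (ball 0 1) (\<lambda>z. 9/16 * M * ((1 - t) * X (e * e) z) + 9/(16 * M) * ((1 - t) ^ 3 * X (e * e * (e * e)) z))"
      by (rule integral_le[OF i3 integrable_add[OF i1 i2] pt])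
    also have "\<dots> = 9/16 * M * ((1 - t) * integral (ball 0 1) (X (e * e))) + 9/(16 * M) * ((1 - t) ^ 3 * integral (ball 0 1) (X (e * e * (e * e))))"
      unfolding integral_add[OF i1 i2] by (simp only: integral_mult_right)
    also have "integral (ball 0 1) (\<lambda>z. (1 - t)\<^sup>2 * X (e * e * e) z) = (1 - t)\<^sup>2 * integral (ball 0 1) (X (e * e * e))"
      by (simp only: integral_mult_right)
    finally have "pi\<^sup>2 / 2 * ((1 - t)\<^sup>2 * (\<Sum>k\<le>K0. (real k)\<^sup>2 * hom_norm k (e * e * e) * t ^ k))
       \<le> pi\<^sup>2 / 2 * (9/16 * M * ((1 - t) * (\<Sum>k\<le>K0. (real k)\<^sup>2 * hom_norm k (e * e) * t ^ k))
        + 9/(16 * M) * ((1 - t) ^ 3 * (\<Sum>k\<le>K0. (real k)\<^sup>2 * hom_norm k (e * e * (e * e)) * t ^ k)))"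
      unfolding j by (simp only: distrib_left mult_ac)
    thus ?thesis by (rule mult_left_le_imp_le) simp
  qed
  ultimately have "(\<Sum>k\<le>K0. hom_norm k (e * e * e) * (2 / (real k + 2))) \<le> 2 * M ^ 3"
    using bergman_hardy_series[OF M] by blast
  moreover have "integral (ball 0 1) (\<lambda>z. cmod (ev e z) ^ 6) = pi\<^sup>2 / 2 * (\<Sum>k\<le>K0. hom_norm k (e * e * e) * (2 / (real k + 2)))"
    using integral_ball_ev(2)[OF K, of "e * e * e"] unfolding e3 by simp
  hence "2 / pi\<^sup>2 * integral (ball 0 1) (\<lambda>z. cmod (ev e z) ^ 6) = (\<Sum>k\<le>K0. hom_norm k (e * e * e) * (2 / (real k + 2)))"
    by (simp only:) simp
  ultimately show ?thesis by (simp only:)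
qed


section \<open>Polynomial approximation in the ball\<close>

lemma sums_geometric_tail:
  fixes f :: "nat \<Rightarrow> complex"
  assumes "f sums s" "\<And>n. cmod (f n) \<le> C * \<kappa> ^ n" "0 \<le> \<kappa>" "\<kappa> < 1"
  shows "cmod (s - (\<Sum>n<N. f n)) \<le> C * \<kappa> ^ N / (1 - \<kappa>)"
proof -
  have "(\<lambda>n. f (n + N)) sums (s - (\<Sum>n<N. f n))"
    using sums_split_initial_segment[OF assms(1)] .
  moreover have "(\<lambda>n. C * \<kappa> ^ N * \<kappa> ^ n) sums (C * \<kappa> ^ N * (1 / (1 - \<kappa>)))"
    using assms(3,4) by (intro sums_mult geometric_sums) auto
  moreover have "cmod (f (n + N)) \<le> C * \<kappa> ^ N * \<kappa> ^ n" for n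
    using assms(2)[of "n + N"] by (simp add: power_add mult_ac)
  ultimately show ?thesis
    using norm_suminf_le[of "\<lambda>n. f (n + N)" "\<lambda>n. C * \<kappa> ^ N * \<kappa> ^ n"] by (simp add: sums_iff)
qed

lemma c2_ball_iff: "vector [x, y] \<in> ball (0::complex^2) 1 \<longleftrightarrow> (cmod x)\<^sup>2 + (cmod y)\<^sup>2 < 1"
  using c2_norm[of "vector [x, y]"] abs_square_less_1[of "norm (vector [x, y] :: complex^2)"] by simp

lemma has_derivative_c2_slice:
  "((\<lambda>x. vector [x, y] :: complex^2) has_derivative (\<lambda>h. h *s axis 1 1)) (at x)"
  "((\<lambda>y. vector [x, y] :: complex^2) has_derivative (\<lambda>h. h *s axis 2 1)) (at y)"
proof -
  have l: "bounded_linear (\<lambda>h::complex. h *s (axis i 1 :: complex^2))" for i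
    unfolding linear_conv_bounded_linear[symmetric]
    by (rule linearI) (simp_all add: vec_eq_iff distrib_right)
  have 1: "(\<lambda>x. vector [x, y] :: complex^2) = (\<lambda>x. vector [0, y] + x *s axis 1 1)"
    by (auto simp: c2_eq_iff axis_def)
  show "((\<lambda>x. vector [x, y] :: complex^2) has_derivative (\<lambda>h. h *s axis 1 1)) (at x)"
    unfolding 1 by (auto intro!: derivative_eq_intros bounded_linear_imp_has_derivative l)
  have 2: "(\<lambda>y. vector [x, y] :: complex^2) = (\<lambda>y. vector [x, 0] + y *s axis 2 1)"
    by (auto simp: c2_eq_iff axis_def)
  show "((\<lambda>y. vector [x, y] :: complex^2) has_derivative (\<lambda>h. h *s axis 2 1)) (at y)"
    unfolding 2 by (auto intro!: derivative_eq_intros bounded_linear_imp_has_derivative l)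
qed

text \<open>Iterated one-variable expansion, in x for fixed y and then of the coefficients
  \<open>b m\<close> in y. The latter are Cauchy integrals over a circle; continuity of the
  derivative allows differentiation under the integral, which makes them holomorphic. The bounds are
  Cauchy's inequalities on discs with r^2 + s^2 < 1.\<close>

lemma taylor_coefficients_ball:
  fixes e :: "complex^2 \<Rightarrow> complex"
  assumes D: "\<And>p. p \<in> ball 0 1 \<Longrightarrow> (e has_derivative D p) (at p)"
    and lin: "\<And>p c v. p \<in> ball 0 1 \<Longrightarrow> D p (c *s v) = c * D p v"
    and cont: "\<And>v. continuous_on (ball 0 1) (\<lambda>p. D p v)"
    and bd: "\<And>p. p \<in> ball 0 1 \<Longrightarrow> cmod (e p) \<le> M"
  obtains b c where
    "\<And>x y. (cmod x)\<^sup>2 + (cmod y)\<^sup>2 < 1 \<Longrightarrow> (\<lambda>m. b m y * x ^ m) sums e (vector [x, y])"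
    "\<And>m y. cmod y < 1 \<Longrightarrow> (\<lambda>n. c m n * y ^ n) sums b m y"
    "\<And>m r y. 0 < r \<Longrightarrow> r\<^sup>2 + (cmod y)\<^sup>2 < 1 \<Longrightarrow> cmod (b m y) \<le> M / r ^ m"
    "\<And>m n r s. 0 < r \<Longrightarrow> 0 < s \<Longrightarrow> r\<^sup>2 + s\<^sup>2 < 1 \<Longrightarrow> cmod (c m n) \<le> M / (r ^ m * s ^ n)"
proof -
  define E where "E x y = e (vector [x, y])" for x y
  have d1: "((\<lambda>x. E x y) has_field_derivative D (vector [x, y]) (axis 1 1)) (at x)"
    and d2: "((\<lambda>y. E x y) has_field_derivative D (vector [x, y]) (axis 2 1)) (at y)"
    if "(cmod x)\<^sup>2 + (cmod y)\<^sup>2 < 1" for x y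
  proof -
    have p: "vector [x, y] \<in> ball (0::complex^2) 1" using that by (simp only: c2_ball_iff)
    have "((\<lambda>x. E x y) has_derivative (\<lambda>h. D (vector [x, y]) (h *s axis 1 1))) (at x)"
      unfolding E_def by (rule has_derivative_compose[OF has_derivative_c2_slice(1)]) (rule D[OF p])
    thus "((\<lambda>x. E x y) has_field_derivative D (vector [x, y]) (axis 1 1)) (at x)"
      by (simp add: has_field_derivative_def lin[OF p] mult.commute[of _ "D _ _"])
    have "((\<lambda>y. E x y) has_derivative (\<lambda>h. D (vector [x, y]) (h *s axis 2 1))) (at y)"
      unfolding E_def by (rule has_derivative_compose[OF has_derivative_c2_slice(2)]) (rule D[OF p])
    thus "((\<lambda>y. E x y) has_field_derivative D (vector [x, y]) (axis 2 1)) (at y)"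
      by (simp add: has_field_derivative_def lin[OF p] mult.commute[of _ "D _ _"])
  qed
  have sq: "(cmod x)\<^sup>2 + (cmod y)\<^sup>2 < 1" if "cmod x < sqrt (1 - (cmod y)\<^sup>2)" for x y
  proof -
    have "sqrt ((cmod x)\<^sup>2) < sqrt (1 - (cmod y)\<^sup>2)" using that by simp
    hence "(cmod x)\<^sup>2 < 1 - (cmod y)\<^sup>2" by (simp only: real_sqrt_less_iff)
    thus ?thesis by simp
  qed
  have sq': "cmod x < sqrt (1 - (cmod y)\<^sup>2)" if "(cmod x)\<^sup>2 + (cmod y)\<^sup>2 < 1" for x y
    using that by (intro real_less_rsqrt) simp
  have hol1: "(\<lambda>x. E x y) holomorphic_on ball 0 (sqrt (1 - (cmod y)\<^sup>2))" for y
    by (rule holomorphic_onI, rule field_differentiable_at_within) (auto simp: field_differentiable_def intro!: exI d1 sq)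
  define b where "b m y = (deriv ^^ m) (\<lambda>x. E x y) 0 / fact m" for m y
  have b_sums: "(\<lambda>m. b m y * x ^ m) sums e (vector [x, y])" if "(cmod x)\<^sup>2 + (cmod y)\<^sup>2 < 1" for x y
    using holomorphic_power_series[OF hol1, of x y] sq'[OF that] by (simp add: b_def E_def)
  have Ebd: "cmod (E x y) \<le> M" if "(cmod x)\<^sup>2 + (cmod y)\<^sup>2 < 1" for x y
    unfolding E_def by (rule bd) (use that in \<open>simp only: c2_ball_iff\<close>)
  have b_bd: "cmod (b m y) \<le> M / r ^ m" if r: "0 < r" "r\<^sup>2 + (cmod y)\<^sup>2 < 1" for m r y
  proof -
    have in_r: "(cmod x)\<^sup>2 + (cmod y)\<^sup>2 < 1" if "cmod x \<le> r" for x
      using power_mono[OF that norm_ge_zero, of 2] r by linarith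
    have "cmod ((deriv ^^ m) (\<lambda>x. E x y) 0) \<le> fact m * M / r ^ m"
    proof (rule Cauchy_inequality)
      show "(\<lambda>x. E x y) holomorphic_on ball 0 r"
        by (rule holomorphic_on_subset[OF hol1]) (auto intro!: sq' in_r)
      show "continuous_on (cball 0 r) (\<lambda>x. E x y)"
        by (rule holomorphic_on_imp_continuous_on, rule holomorphic_on_subset[OF hol1]) (auto intro!: sq' in_r)
    qed (use r in_r in \<open>auto intro!: Ebd\<close>)
    thus ?thesis by (simp add: b_def norm_divide field_simps)
  qed
  have b_hol: "b m holomorphic_on ball 0 1" for m
  proof -
    have "b m holomorphic_on ball 0 s" if s: "0 < s" "s < 1" for s
    proof -
      \<comment> \<open>Then r^2 + s^2 = (1 + s^2)/2 < 1, so the circle of radius r times the disc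
        of radius s stays in the ball.\<close>
      define r where "r = sqrt ((1 - s\<^sup>2) / 2)"
      have s2: "s\<^sup>2 < 1" using s by (simp add: abs_square_less_1)
      have r: "r > 0" "r\<^sup>2 + s\<^sup>2 < 1" using s2 by (auto simp: r_def field_simps)
      have in_r: "(cmod x)\<^sup>2 + (cmod y)\<^sup>2 < 1" if "cmod x \<le> r" "cmod y < s" for x y
        using power_mono[OF that(1) norm_ge_zero, of 2] power_mono[OF less_imp_le[OF that(2)] norm_ge_zero, of 2] r by linarith
      define \<gamma> where "\<gamma> t = of_real r * exp (2 * of_real pi * \<i> * of_real t)" for t :: real
      have \<gamma>n: "cmod (\<gamma> t) = r" for t using r by (simp add: \<gamma>_def norm_mult)
      have \<gamma>0: "\<gamma> t \<noteq> 0" for t using r by (simp add: \<gamma>_def)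
      have \<gamma>c: "continuous_on A \<gamma>" for A unfolding \<gamma>_def by (intro continuous_intros)
      have cp: "circlepath 0 r = \<gamma>" by (auto simp: circlepath \<gamma>_def fun_eq_iff)
      have rep: "b m y = 1 / (2 * pi * \<i>) * integral {0..1} (\<lambda>t. E (\<gamma> t) y / (\<gamma> t) ^ Suc m * (2 * of_real pi * \<i> * \<gamma> t))"
        if y: "y \<in> ball 0 s" for y
      proof -
        have sub: "cball (0::complex) r \<subseteq> ball 0 (sqrt (1 - (cmod y)\<^sup>2))"
        proof
          fix x :: complex assume "x \<in> cball 0 r"
          hence "(cmod x)\<^sup>2 + (cmod y)\<^sup>2 < 1" using y by (intro in_r) auto
          from sq'[OF this] show "x \<in> ball 0 (sqrt (1 - (cmod y)\<^sup>2))" by simp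
        qed
        have "((\<lambda>u. E u y / (u - 0) ^ Suc m) has_contour_integral (2 * pi * \<i> / fact m * (deriv ^^ m) (\<lambda>x. E x y) 0)) (circlepath 0 r)"
        proof (rule Cauchy_has_contour_integral_higher_derivative_circlepath[where f = "\<lambda>x. E x y"])
          show "continuous_on (cball 0 r) (\<lambda>x. E x y)"
            by (intro holomorphic_on_imp_continuous_on holomorphic_on_subset[OF hol1 sub])
          show "(\<lambda>x. E x y) holomorphic_on ball 0 r"
            using sub by (intro holomorphic_on_subset[OF hol1]) auto
        qed (use r in simp)
        hence "2 * of_real pi * \<i> * b m y = integral {0..1} (\<lambda>t. E (\<gamma> t) y / (\<gamma> t) ^ Suc m * vector_derivative (circlepath 0 r) (at t))"
        proof -
          assume "((\<lambda>u. E u y / (u - 0) ^ Suc m) has_contour_integral (2 * pi * \<i> / fact m * (deriv ^^ m) (\<lambda>x. E x y) 0)) (circlepath 0 r)"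
          from contour_integral_unique[OF this]
          have "2 * of_real pi * \<i> * b m y = contour_integral (circlepath 0 r) (\<lambda>u. E u y / (u - 0) ^ Suc m)"
            by (simp add: b_def)
          thus ?thesis unfolding contour_integral_integral by (simp only: cp diff_zero)
        qed
        also have "\<dots> = integral {0..1} (\<lambda>t. E (\<gamma> t) y / (\<gamma> t) ^ Suc m * (2 * of_real pi * \<i> * \<gamma> t))"
          by (intro integral_cong) (simp add: vector_derivative_circlepath \<gamma>_def)
        finally show ?thesis by (simp add: field_simps)
      qed
      have "(\<lambda>y. integral (cbox 0 1) (\<lambda>t::real. E (\<gamma> t) y / (\<gamma> t) ^ Suc m * (2 * of_real pi * \<i> * \<gamma> t))) holomorphic_on ball 0 s"
      proof (rule leibniz_rule_holomorphic)
        fix y :: complex and t :: real assume y: "y \<in> ball 0 s"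
        show "((\<lambda>y. E (\<gamma> t) y / (\<gamma> t) ^ Suc m * (2 * of_real pi * \<i> * \<gamma> t)) has_field_derivative
            D (vector [\<gamma> t, y]) (axis 2 1) / (\<gamma> t) ^ Suc m * (2 * of_real pi * \<i> * \<gamma> t)) (at y within ball 0 s)"
          by (rule has_field_derivative_at_within, intro DERIV_cmult_right DERIV_cdivide d2 in_r) (use y in \<open>auto simp: \<gamma>n\<close>)
      next
        fix y :: complex assume y: "y \<in> ball 0 s"
        have "continuous_on {0..1} (\<lambda>t. E (\<gamma> t) y)"
        proof (rule continuous_on_compose2[OF holomorphic_on_imp_continuous_on[OF hol1[of y]] \<gamma>c])
          show "\<gamma> ` {0..1} \<subseteq> ball 0 (sqrt (1 - (cmod y)\<^sup>2))"
          proof (rule image_subsetI)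
            fix t :: real
            have "(cmod (\<gamma> t))\<^sup>2 + (cmod y)\<^sup>2 < 1" using y by (intro in_r) (auto simp: \<gamma>n)
            from sq'[OF this] show "\<gamma> t \<in> ball 0 (sqrt (1 - (cmod y)\<^sup>2))" by simp
          qed
        qed
        thus "(\<lambda>t. E (\<gamma> t) y / (\<gamma> t) ^ Suc m * (2 * of_real pi * \<i> * \<gamma> t)) integrable_on cbox 0 1"
          unfolding cbox_interval by (intro integrable_continuous_interval continuous_intros \<gamma>c) (auto simp: \<gamma>0)
      next
        have "continuous_on (ball 0 s \<times> cbox 0 1) (\<lambda>z. vector [\<gamma> (snd z), fst z] :: complex^2)"
        proof -
          have "(\<lambda>z. vector [\<gamma> (snd z), fst z] :: complex^2) = (\<lambda>z. \<chi> i. if i = 1 then \<gamma> (snd z) else fst z)"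
            by (auto simp: c2_eq_iff)
          moreover have "continuous_on (ball 0 s \<times> cbox 0 1) (\<lambda>z. if i = (1::2) then \<gamma> (snd z) else fst z)" for i
            by (cases "i = 1") (auto intro!: continuous_intros continuous_on_compose2[OF \<gamma>c[of UNIV]])
          ultimately show ?thesis by (simp only:) (rule continuous_on_vec_lambda)
        qed
        hence "continuous_on (ball 0 s \<times> cbox 0 1) (\<lambda>z. D (vector [\<gamma> (snd z), fst z]) (axis 2 1))"
        proof (rule continuous_on_compose2[OF cont[of "axis 2 1"]], intro image_subsetI)
          fix z :: "complex \<times> real" assume "z \<in> ball 0 s \<times> cbox 0 1"
          thus "vector [\<gamma> (snd z), fst z] \<in> ball (0::complex^2) 1"
            unfolding c2_ball_iff by (intro in_r) (auto simp: \<gamma>n)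
        qed
        thus "continuous_on (ball 0 s \<times> cbox 0 1) (\<lambda>(y, t). D (vector [\<gamma> t, y]) (axis 2 1) / (\<gamma> t) ^ Suc m * (2 * of_real pi * \<i> * \<gamma> t))"
        proof -
          assume D: "continuous_on (ball 0 s \<times> cbox 0 1) (\<lambda>z. D (vector [\<gamma> (snd z), fst z]) (axis 2 1))"
          have g: "continuous_on (ball 0 s \<times> cbox 0 1) (\<lambda>z::complex\<times>real. \<gamma> (snd z))"
            by (rule continuous_on_compose2[OF \<gamma>c[of UNIV] continuous_on_snd[OF continuous_on_id]]) auto
          show ?thesis
            unfolding case_prod_unfold
            by (intro continuous_on_mult continuous_on_divide continuous_on_power continuous_on_const g D) (simp add: \<gamma>0)
        qed
      qed simp
      hence "(\<lambda>y. 1 / (2 * pi * \<i>) * integral {0..1} (\<lambda>t. E (\<gamma> t) y / (\<gamma> t) ^ Suc m * (2 * of_real pi * \<i> * \<gamma> t))) holomorphic_on ball 0 s"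
        unfolding cbox_interval by (intro holomorphic_intros)
      thus ?thesis by (rule holomorphic_transform) (simp add: rep)
    qed
    hence diff: "b m field_differentiable (at y)" if y: "y \<in> ball 0 1" for y
    proof -
      obtain s where "cmod y < s" "s < 1" using y dense[of "cmod y" 1] by auto
      moreover have "0 < s" using \<open>cmod y < s\<close> norm_ge_zero[of y] by linarith
      ultimately show ?thesis
        using \<open>\<And>s. 0 < s \<Longrightarrow> s < 1 \<Longrightarrow> b m holomorphic_on ball 0 s\<close>[of s] holomorphic_on_imp_differentiable_at[of "b m" "ball 0 s" y] by auto
    qed
    show ?thesis by (rule holomorphic_onI, rule field_differentiable_at_within, rule diff)
  qed
  define c where "c m n = (deriv ^^ n) (b m) 0 / fact n" for m n
  have c_sums: "(\<lambda>n. c m n * y ^ n) sums b m y" if "cmod y < 1" for m y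
    using holomorphic_power_series[OF b_hol, of y m] that by (simp add: c_def)
  have c_bd: "cmod (c m n) \<le> M / (r ^ m * s ^ n)" if rs: "0 < r" "0 < s" "r\<^sup>2 + s\<^sup>2 < 1" for m n r s
  proof -
    have "s\<^sup>2 < 1" using rs zero_less_power[of r 2] by linarith
    hence s1: "s < 1" using rs by (simp add: abs_square_less_1)
    have "cmod ((deriv ^^ n) (b m) 0) \<le> fact n * (M / r ^ m) / s ^ n"
    proof (rule Cauchy_inequality)
      show "b m holomorphic_on ball 0 s"
        by (rule holomorphic_on_subset[OF b_hol]) (use s1 in auto)
      show "continuous_on (cball 0 s) (b m)"
        by (rule holomorphic_on_imp_continuous_on, rule holomorphic_on_subset[OF b_hol]) (use s1 in auto)
    qed (use rs b_bd in auto)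
    thus ?thesis by (simp add: c_def norm_divide field_simps)
  qed
  show ?thesis by (rule that[OF b_sums c_sums b_bd c_bd])
qed

text \<open>Up to the sphere \<open>e\<close> is only continuous, so the Taylor series is summed for
  the dilate e(\<rho> z), which is uniformly close to e; a partial sum with the powers of \<rho>
  absorbed in the coefficients is the polynomial. The ball is not a polydisc, so a uniform geometric
  majorant needs radii adapted to the point.\<close>

lemma polynomial_approximation_ball:
  fixes e :: "complex^2 \<Rightarrow> complex"
  assumes D: "\<And>p. p \<in> ball 0 1 \<Longrightarrow> (e has_derivative D p) (at p)"
    and lin: "\<And>p c v. p \<in> ball 0 1 \<Longrightarrow> D p (c *s v) = c * D p v"
    and cont: "\<And>v. continuous_on (ball 0 1) (\<lambda>p. D p v)"
    and e: "continuous_on (cball 0 1) e" and \<epsilon>: "\<epsilon> > 0"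
  obtains P where "\<And>z. z \<in> cball 0 1 \<Longrightarrow> cmod (e z - ev P z) < \<epsilon>"
proof -
  obtain M where M: "M > 0" "\<And>p. p \<in> cball 0 1 \<Longrightarrow> cmod (e p) \<le> M"
    using compact_imp_bounded[OF compact_continuous_image[OF e compact_cball]] by (auto simp: bounded_pos)
  have Mb: "\<And>p. p \<in> ball 0 1 \<Longrightarrow> cmod (e p) \<le> M" using M(2) by auto
  obtain b c where b: "\<And>x y. (cmod x)\<^sup>2 + (cmod y)\<^sup>2 < 1 \<Longrightarrow> (\<lambda>m. b m y * x ^ m) sums e (vector [x, y])"
    and c: "\<And>m y. cmod y < 1 \<Longrightarrow> (\<lambda>n. c m n * y ^ n) sums b m y"
    and b_bd: "\<And>m r y. 0 < r \<Longrightarrow> r\<^sup>2 + (cmod y)\<^sup>2 < 1 \<Longrightarrow> cmod (b m y) \<le> M / r ^ m"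
    and c_bd: "\<And>m n r s. 0 < r \<Longrightarrow> 0 < s \<Longrightarrow> r\<^sup>2 + s\<^sup>2 < 1 \<Longrightarrow> cmod (c m n) \<le> M / (r ^ m * s ^ n)"
    by (rule taylor_coefficients_ball[of e D M, OF D lin cont Mb]; (assumption | rule that))
  obtain \<delta> where \<delta>: "\<delta> > 0" "\<And>x y. x \<in> cball 0 1 \<Longrightarrow> y \<in> cball 0 1 \<Longrightarrow> dist y x < \<delta> \<Longrightarrow> dist (e y) (e x) < \<epsilon> / 2"
    using compact_uniformly_continuous[OF e compact_cball] \<epsilon> unfolding uniformly_continuous_on_def by (metis half_gt_zero)
  define \<rho> where "\<rho> = max (1/2) (1 - \<delta> / 2)"
  have \<rho>: "0 < \<rho>" "\<rho> < 1" "1 - \<rho> < \<delta>" using \<delta>(1) by (auto simp: \<rho>_def max_def)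
  define \<kappa> where "\<kappa> = (1 + \<rho>) / 2"
  have \<kappa>: "\<rho> < \<kappa>" "\<kappa> < 1" "0 < \<kappa>" using \<rho> by (auto simp: \<kappa>_def)
  \<comment> \<open>A slack that keeps the radii r and s below positive. Replacing |x|, |y| by |x| +
    \<eta>, |y| + \<eta> raises the sum of squares by at most 6 \<eta>, and 12 \<eta> <= \<kappa>^2
    - \<rho>^2 keeps it strictly below \<kappa>^2.\<close>
  define \<eta> where "\<eta> = min 1 ((\<kappa>\<^sup>2 - \<rho>\<^sup>2) / 12)"
  have "\<rho>\<^sup>2 < \<kappa>\<^sup>2" using \<rho> \<kappa> by (intro power_strict_mono) auto
  hence \<eta>: "\<eta> > 0" "\<eta> \<le> 1" "12 * \<eta> \<le> \<kappa>\<^sup>2 - \<rho>\<^sup>2" by (auto simp: \<eta>_def min_def)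
  have term_bds: "cmod (b m y * x ^ m) \<le> M * \<kappa> ^ m" "cmod (c m n * y ^ n * x ^ m) \<le> M * \<kappa> ^ m * \<kappa> ^ n"
    if xy: "(cmod x)\<^sup>2 + (cmod y)\<^sup>2 \<le> \<rho>\<^sup>2" for x y m n
  proof -
    \<comment> \<open>Dividing by \<kappa> ensures |x| <= \<kappa> r and |y| <= \<kappa> s, so
      Cauchy's bounds for the radii r, s decay like \<kappa>^m \<kappa>^n uniformly in the
      point.\<close>
    define r where "r = (cmod x + \<eta>) / \<kappa>"
    define s where "s = (cmod y + \<eta>) / \<kappa>"
    have rs: "r > 0" "s > 0" using \<eta> \<kappa> by (auto simp: r_def s_def intro!: divide_pos_pos add_nonneg_pos)
    have "(cmod x)\<^sup>2 \<le> \<rho>\<^sup>2" "(cmod y)\<^sup>2 \<le> \<rho>\<^sup>2" using xy zero_le_power2[of "cmod x"] zero_le_power2[of "cmod y"] by linarith+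
    hence le: "cmod x \<le> 1" "cmod y \<le> 1" using \<rho> power2_le_imp_le[of "cmod x" \<rho>] power2_le_imp_le[of "cmod y" \<rho>] by auto
    have "\<eta> * cmod x \<le> \<eta>" "\<eta> * cmod y \<le> \<eta>" "\<eta> * \<eta> \<le> \<eta>"
      by (rule mult_left_le[OF le(1)] mult_left_le[OF le(2)] mult_left_le[OF \<eta>(2)], use \<eta> in simp)+
    moreover have "(cmod x + \<eta>)\<^sup>2 + (cmod y + \<eta>)\<^sup>2 = (cmod x)\<^sup>2 + (cmod y)\<^sup>2 + 2 * (\<eta> * cmod x) + 2 * (\<eta> * cmod y) + 2 * (\<eta> * \<eta>)"
      by (simp add: power2_eq_square algebra_simps)
    ultimately have "(cmod x + \<eta>)\<^sup>2 + (cmod y + \<eta>)\<^sup>2 \<le> (cmod x)\<^sup>2 + (cmod y)\<^sup>2 + 6 * \<eta>" by linarith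
    also have "\<dots> < \<kappa>\<^sup>2" using xy \<eta> by linarith
    finally have "((cmod x + \<eta>)\<^sup>2 + (cmod y + \<eta>)\<^sup>2) / \<kappa>\<^sup>2 < 1" using \<kappa> by (simp add: divide_less_eq)
    hence rs1: "r\<^sup>2 + s\<^sup>2 < 1" unfolding r_def s_def power_divide by (simp only: add_divide_distrib[of "(cmod x + \<eta>)\<^sup>2"])
    have xr: "cmod x \<le> \<kappa> * r" "cmod y \<le> \<kappa> * s" using \<kappa> \<eta> by (auto simp: r_def s_def)
    have "\<kappa> * s \<le> s" using \<kappa> rs by (simp add: mult_left_le_one_le)
    hence "(cmod y)\<^sup>2 \<le> s\<^sup>2" using xr by (intro power_mono) auto
    hence "r\<^sup>2 + (cmod y)\<^sup>2 < 1" using rs1 by linarith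
    have px: "cmod x ^ m \<le> \<kappa> ^ m * r ^ m" using power_mono[OF xr(1) norm_ge_zero] by (simp add: power_mult_distrib)
    have py: "cmod y ^ n \<le> \<kappa> ^ n * s ^ n" using power_mono[OF xr(2) norm_ge_zero] by (simp add: power_mult_distrib)
    have "cmod (b m y * x ^ m) \<le> (M / r ^ m) * (\<kappa> ^ m * r ^ m)"
      unfolding norm_mult norm_power using M rs
      by (intro mult_mono b_bd[OF rs(1) \<open>r\<^sup>2 + (cmod y)\<^sup>2 < 1\<close>] px) auto
    thus "cmod (b m y * x ^ m) \<le> M * \<kappa> ^ m" using rs by simp
    have "cmod (c m n * y ^ n * x ^ m) \<le> (M / (r ^ m * s ^ n)) * (\<kappa> ^ n * s ^ n) * (\<kappa> ^ m * r ^ m)"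
      unfolding norm_mult norm_power using M rs \<kappa>
      by (intro mult_mono c_bd[OF rs rs1] px py) auto
    thus "cmod (c m n * y ^ n * x ^ m) \<le> M * \<kappa> ^ m * \<kappa> ^ n" using rs by (simp add: mult_ac)
  qed
  \<comment> \<open>The first summand bounds the tail of the series in x, the second the total of
    the tails in y of its first N coefficients.\<close>
  define T where "T N = M * \<kappa> ^ N / (1 - \<kappa>) + M / (1 - \<kappa>) * (\<kappa> ^ N / (1 - \<kappa>))" for N
  have "T \<longlonglongrightarrow> M * 0 / (1 - \<kappa>) + M / (1 - \<kappa>) * (0 / (1 - \<kappa>))"
    unfolding T_def using \<kappa> by (intro tendsto_intros LIMSEQ_realpow_zero) auto
  hence "eventually (\<lambda>N. T N < \<epsilon> / 2) sequentially" using \<epsilon> by (intro order_tendstoD) auto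
  then obtain N where N: "T N < \<epsilon> / 2" by (auto simp: eventually_sequentially)
  have approx: "cmod (e (vector [x, y]) - (\<Sum>m<N. \<Sum>n<N. c m n * y ^ n * x ^ m)) \<le> T N"
    if xy: "(cmod x)\<^sup>2 + (cmod y)\<^sup>2 \<le> \<rho>\<^sup>2" for x y
  proof -
    have "\<rho>\<^sup>2 < 1" using \<rho> by (simp add: abs_square_less_1)
    hence xy1: "(cmod x)\<^sup>2 + (cmod y)\<^sup>2 < 1" using xy by linarith
    hence "(cmod y)\<^sup>2 < 1" using zero_le_power2[of "cmod x"] by linarith
    hence y1: "cmod y < 1" by (simp add: abs_square_less_1)
    have 1: "cmod (e (vector [x, y]) - (\<Sum>m<N. b m y * x ^ m)) \<le> M * \<kappa> ^ N / (1 - \<kappa>)"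
      by (rule sums_geometric_tail[OF b[OF xy1]]) (use term_bds(1)[OF xy] \<kappa> in auto)
    have 2: "cmod (b m y * x ^ m - (\<Sum>n<N. c m n * y ^ n * x ^ m)) \<le> (M * \<kappa> ^ m) * \<kappa> ^ N / (1 - \<kappa>)" for m
      by (rule sums_geometric_tail[OF sums_mult2[OF c[OF y1]]]) (use term_bds(2)[OF xy] \<kappa> in auto)
    have "cmod ((\<Sum>m<N. b m y * x ^ m) - (\<Sum>m<N. \<Sum>n<N. c m n * y ^ n * x ^ m)) \<le> (\<Sum>m<N. (M * \<kappa> ^ m) * \<kappa> ^ N / (1 - \<kappa>))"
      unfolding sum_subtractf[symmetric] by (rule sum_norm_le) (rule 2)
    also have "\<dots> = M * (\<kappa> ^ N / (1 - \<kappa>)) * (\<Sum>m<N. \<kappa> ^ m)" by (simp add: sum_distrib_left sum_divide_distrib mult_ac)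
    also have "\<dots> \<le> M * (\<kappa> ^ N / (1 - \<kappa>)) * (1 / (1 - \<kappa>))"
    proof (rule mult_left_mono)
      show "(\<Sum>m<N. \<kappa> ^ m) \<le> 1 / (1 - \<kappa>)" using \<kappa> by (simp add: sum_gp_strict divide_right_mono)
    qed (use M \<kappa> in auto)
    finally have 3: "cmod ((\<Sum>m<N. b m y * x ^ m) - (\<Sum>m<N. \<Sum>n<N. c m n * y ^ n * x ^ m)) \<le> M * (\<kappa> ^ N / (1 - \<kappa>)) * (1 / (1 - \<kappa>))" .
    have "cmod (e (vector [x, y]) - (\<Sum>m<N. \<Sum>n<N. c m n * y ^ n * x ^ m))
       \<le> cmod (e (vector [x, y]) - (\<Sum>m<N. b m y * x ^ m)) + cmod ((\<Sum>m<N. b m y * x ^ m) - (\<Sum>m<N. \<Sum>n<N. c m n * y ^ n * x ^ m))"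
      by (rule norm_diff_triangle_le) auto
    also have "\<dots> \<le> T N" using add_mono[OF 1 3] by (simp add: T_def)
    finally show ?thesis .
  qed
  define P where "P = (\<Sum>m<N. \<Sum>n<N. monom (monom (c m n * of_real (\<rho> ^ (m + n))) m) n)"
  have evP: "ev P z = (\<Sum>m<N. \<Sum>n<N. c m n * (of_real \<rho> * z $ 2) ^ n * (of_real \<rho> * z $ 1) ^ m)" for z
    by (simp add: ev_def P_def poly_sum poly_monom power_mult_distrib power_add mult_ac)
  show ?thesis
  proof (rule that[of P])
    fix z :: "complex^2" assume z: "z \<in> cball 0 1"
    have v: "vector [of_real \<rho> * z $ 1, of_real \<rho> * z $ 2] = \<rho> *\<^sub>R z"
      by (simp add: c2_eq_iff scaleR_conv_of_real[where 'a = complex])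
    have "(cmod (of_real \<rho> * z $ 1))\<^sup>2 + (cmod (of_real \<rho> * z $ 2))\<^sup>2 = \<rho>\<^sup>2 * (norm z)\<^sup>2"
      by (simp add: norm_mult power_mult_distrib c2_norm distrib_left)
    also have "\<dots> \<le> \<rho>\<^sup>2" using z by (simp add: mult_left_le power_le_one)
    finally have 1: "cmod (e (\<rho> *\<^sub>R z) - ev P z) \<le> T N" unfolding evP v[symmetric] by (rule approx)
    have "norm (\<rho> *\<^sub>R z) \<le> 1" using z \<rho> by (simp add: mult_le_one)
    moreover have "dist (\<rho> *\<^sub>R z) z < \<delta>"
    proof -
      have "\<rho> *\<^sub>R z - z = (\<rho> - 1) *\<^sub>R z" by (simp add: scaleR_left_diff_distrib)
      hence "dist (\<rho> *\<^sub>R z) z = (1 - \<rho>) * norm z" using \<rho> by (simp add: dist_norm)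
      also have "\<dots> \<le> 1 - \<rho>" using z \<rho> by (simp add: mult_left_le)
      finally show ?thesis using \<rho> by simp
    qed
    ultimately have 2: "cmod (e (\<rho> *\<^sub>R z) - e z) < \<epsilon> / 2" using \<delta>(2)[of z "\<rho> *\<^sub>R z"] z by (simp add: dist_norm)
    have "cmod (e z - ev P z) \<le> cmod (e z - e (\<rho> *\<^sub>R z)) + cmod (e (\<rho> *\<^sub>R z) - ev P z)"
      by (rule norm_diff_triangle_le) auto
    with 1 2 N show "cmod (e z - ev P z) < \<epsilon>" by (simp add: norm_minus_commute)
  qed
qed

text \<open>Dominated convergence handles both sides. The polynomial inequality asks for a positive
  bound, so it is applied with each N > sqrt J, which is valid for all late approximants, and N
  tends to sqrt J afterwards; this includes J = 0.\<close>

lemma bergman_hardy_ball: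
  fixes e :: "complex^2 \<Rightarrow> complex"
  assumes D: "\<And>p. p \<in> ball 0 1 \<Longrightarrow> (e has_derivative D p) (at p)"
    and lin: "\<And>p c v. p \<in> ball 0 1 \<Longrightarrow> D p (c *s v) = c * D p v"
    and cont: "\<And>v. continuous_on (ball 0 1) (\<lambda>p. D p v)"
    and e: "continuous_on (cball 0 1) e"
  shows "2 / pi\<^sup>2 * integral (ball 0 1) (\<lambda>z. cmod (e z) ^ 6)
     \<le> 2 * sqrt (2 / pi\<^sup>2 * integral (ball 0 1) (\<lambda>z. cmod (e ((1 / norm z) *\<^sub>R z)) ^ 4)) ^ 3"
proof -
  define u where "u z = (1 / norm z) *\<^sub>R z" for z :: "complex^2"
  have u: "u z \<in> cball 0 1" for z by (cases "z = 0") (auto simp: u_def)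
  obtain M where M: "M > 0" "\<And>p. p \<in> cball 0 1 \<Longrightarrow> cmod (e p) \<le> M"
    using compact_imp_bounded[OF compact_continuous_image[OF e compact_cball]] by (auto simp: bounded_pos)
  have "\<exists>P. \<forall>z\<in>cball 0 1. cmod (e z - ev P z) < 1 / real (Suc k)" for k
    using polynomial_approximation_ball[OF D lin cont e, of "1 / real (Suc k)"] by (metis of_nat_0_less_iff zero_less_Suc zero_less_divide_1_iff)
  then obtain P where P: "\<And>k z. z \<in> cball 0 1 \<Longrightarrow> cmod (e z - ev (P k) z) < 1 / real (Suc k)" by metis
  have lim: "(\<lambda>k. ev (P k) z) \<longlonglongrightarrow> e z" if "z \<in> cball 0 1" for z
  proof -
    have "(\<lambda>k. e z - ev (P k) z) \<longlonglongrightarrow> 0" by (rule LIMSEQ_norm_0) (rule P[OF that])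
    from tendsto_diff[OF tendsto_const[of "e z"] this] show ?thesis by simp
  qed
  have Pbd: "cmod (ev (P k) z) \<le> M + 1" if "z \<in> cball 0 1" for k z
  proof -
    have "cmod (ev (P k) z) \<le> cmod (e z) + cmod (e z - ev (P k) z)"
      by (metis norm_triangle_sub norm_minus_commute)
    moreover have "1 / real (Suc k) \<le> 1" by simp
    ultimately show ?thesis using P[OF that, of k] M(2)[OF that] by linarith
  qed
  have ev_meas[measurable]: "ev Q \<in> borel_measurable borel" for Q
  proof -
    obtain K where K: "\<And>z. ev Q z = (\<Sum>(m,n)\<in>{(m,n). m + n \<le> K}. cf Q m n * z $ 1 ^ m * z $ 2 ^ n)"
      by (rule ev_expansion[of Q]) blast
    have "continuous_on UNIV (\<lambda>z. ev Q z)"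
      unfolding K case_prod_unfold by (intro continuous_intros)
    thus ?thesis by (rule borel_measurable_continuous_onI)
  qed
  have u_meas[measurable]: "u \<in> borel_measurable borel" unfolding u_def by measurable
  have bd: "\<bar>cmod (ev (P k) z) ^ n\<bar> \<le> (M + 1) ^ n" if "z \<in> cball 0 1" for k z n
    using power_mono[OF Pbd[OF that]] by simp
  have int1: "(\<lambda>z. cmod (ev (P k) z) ^ n) integrable_on ball 0 1" for k n
    by (rule set_lebesgue_integral_eq_integral(1), rule absolutely_integrable_on_ball_bounded[where C = "(M + 1) ^ n"], measurable)
       (rule bd, auto)
  have int2: "(\<lambda>z. cmod (ev (P k) (u z)) ^ n) integrable_on ball 0 1" for k n
    by (rule set_lebesgue_integral_eq_integral(1), rule absolutely_integrable_on_ball_bounded[where C = "(M + 1) ^ n"], measurable)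
       (rule bd, rule u)
  have const: "(\<lambda>z. (M + 1) ^ n) integrable_on ball (0::complex^2) 1" for n
    by (rule integrable_on_const) simp
  have conv1: "(\<lambda>k. integral (ball 0 1) (\<lambda>z. cmod (ev (P k) z) ^ 6)) \<longlonglongrightarrow> integral (ball 0 1) (\<lambda>z. cmod (e z) ^ 6)"
  proof (rule dominated_convergence(2)[OF int1 const[of 6]])
    fix k and z :: "complex^2" assume "z \<in> ball 0 1"
    thus "norm (cmod (ev (P k) z) ^ 6) \<le> (M + 1) ^ 6" using bd[of z k 6] by simp
  next
    fix z :: "complex^2" assume "z \<in> ball 0 1"
    thus "(\<lambda>k. cmod (ev (P k) z) ^ 6) \<longlonglongrightarrow> cmod (e z) ^ 6" by (intro tendsto_intros lim) auto
  qed
  have conv2: "(\<lambda>k. integral (ball 0 1) (\<lambda>z. cmod (ev (P k) (u z)) ^ 4)) \<longlonglongrightarrow> integral (ball 0 1) (\<lambda>z. cmod (e (u z)) ^ 4)"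
  proof (rule dominated_convergence(2)[OF int2 const[of 4]])
    fix k and z :: "complex^2" assume "z \<in> ball 0 1"
    show "norm (cmod (ev (P k) (u z)) ^ 4) \<le> (M + 1) ^ 4" using bd[OF u, of k z 4] by simp
  next
    fix z :: "complex^2" assume "z \<in> ball 0 1"
    show "(\<lambda>k. cmod (ev (P k) (u z)) ^ 4) \<longlonglongrightarrow> cmod (e (u z)) ^ 4" by (intro tendsto_intros lim u)
  qed
  define J where "J = 2 / pi\<^sup>2 * integral (ball 0 1) (\<lambda>z. cmod (e (u z)) ^ 4)"
  define V where "V = 2 / pi\<^sup>2 * integral (ball 0 1) (\<lambda>z. cmod (e z) ^ 6)"
  have J_lim: "(\<lambda>k. 2 / pi\<^sup>2 * integral (ball 0 1) (\<lambda>z. cmod (ev (P k) (u z)) ^ 4)) \<longlonglongrightarrow> J"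
    unfolding J_def by (intro tendsto_intros conv2)
  have V_lim: "(\<lambda>k. 2 / pi\<^sup>2 * integral (ball 0 1) (\<lambda>z. cmod (ev (P k) z) ^ 6)) \<longlonglongrightarrow> V"
    unfolding V_def by (intro tendsto_intros conv1)
  have "0 \<le> J"
    by (rule LIMSEQ_le_const[OF J_lim]) (intro exI[of _ 0] allI impI mult_nonneg_nonneg integral_nonneg int2, auto)
  have V_le: "V \<le> 2 * N ^ 3" if N: "sqrt J < N" for N
  proof (rule LIMSEQ_le_const2[OF V_lim])
    have N0: "N > 0" using N \<open>0 \<le> J\<close> by (meson order.strict_trans1 real_sqrt_ge_zero)
    have "(sqrt J)\<^sup>2 < N\<^sup>2" using N \<open>0 \<le> J\<close> by (intro power_strict_mono) auto
    hence "J < N\<^sup>2" using \<open>0 \<le> J\<close> by simp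
    from order_tendstoD(2)[OF J_lim this] obtain k0 where
      k0: "\<And>k. k \<ge> k0 \<Longrightarrow> 2 / pi\<^sup>2 * integral (ball 0 1) (\<lambda>z. cmod (ev (P k) (u z)) ^ 4) < N\<^sup>2"
      by (auto simp: eventually_sequentially)
    show "\<exists>k0. \<forall>k\<ge>k0. 2 / pi\<^sup>2 * integral (ball 0 1) (\<lambda>z. cmod (ev (P k) z) ^ 6) \<le> 2 * N ^ 3"
      using bergman_hardy_polynomial[OF N0] k0 unfolding u_def by (meson less_imp_le)
  qed
  have "(\<lambda>k. 2 * (sqrt J + 1 / real (Suc k)) ^ 3) \<longlonglongrightarrow> 2 * (sqrt J + 0) ^ 3"
    by (intro tendsto_intros LIMSEQ_Suc[OF lim_1_over_n])
  hence "V \<le> 2 * (sqrt J + 0) ^ 3"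
    by (rule LIMSEQ_le_const) (auto intro!: exI[of _ 0] V_le)
  thus ?thesis unfolding V_def J_def u_def by simp
qed

section \<open>Calculus of smooth maps\<close>

lemma frechet_derivative_cong_open:
  assumes "open S" "x \<in> S" "\<And>y. y \<in> S \<Longrightarrow> f y = g y" "f differentiable (at x)"
  shows "g differentiable (at x)" "frechet_derivative g (at x) = frechet_derivative f (at x)"
proof -
  have "(f has_derivative frechet_derivative f (at x)) (at x)" using assms(4) frechet_derivative_works by blast
  hence "(g has_derivative frechet_derivative f (at x)) (at x)"
    by (rule has_derivative_transform_within_open) (use assms in auto)
  thus "g differentiable (at x)" "frechet_derivative g (at x) = frechet_derivative f (at x)"
    using frechet_derivative_at[of g "frechet_derivative f (at x)" x] by (auto simp: differentiable_def)
qed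

lemma Ck_on_cong:
  assumes "open S" "\<And>y. y \<in> S \<Longrightarrow> f y = g y" "Ck_on k S f"
  shows "Ck_on k S g"
  using assms(2,3)
proof (induction k arbitrary: f g)
  case 0
  thus ?case by (simp cong: continuous_on_cong)
next
  case (Suc k)
  have d: "f differentiable (at x)" if "x \<in> S" for x using Suc.prems(2) that by simp
  note c = frechet_derivative_cong_open[OF assms(1) _ Suc.prems(1) d]
  show ?case unfolding Ck_on.simps
  proof (intro conjI ballI allI)
    fix v
    show "Ck_on k S (\<lambda>x. frechet_derivative g (at x) v)"
      by (rule Suc.IH[of "\<lambda>x. frechet_derivative f (at x) v"]) (use c(2) Suc.prems in auto)
  qed (rule c(1), auto)
qed

lemma Ck_on_subset:
  assumes "Ck_on k S f" "T \<subseteq> S"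
  shows "Ck_on k T f"
  using assms by (induction k arbitrary: f) (auto intro: continuous_on_subset)

lemma Ck_on_SucD: "Ck_on (Suc k) S f \<Longrightarrow> Ck_on k S f"
proof (induction k arbitrary: f)
  case 0
  thus ?case by (auto intro!: continuous_at_imp_continuous_on differentiable_imp_continuous_within)
next
  case (Suc k)
  thus ?case by auto
qed

lemma Ck_on_const: "Ck_on k S (\<lambda>x. c)"
  by (induction k arbitrary: c) simp_all

lemma Ck_on_ident: "Ck_on k S (\<lambda>x. x)"
proof (cases k)
  case (Suc j)
  have "frechet_derivative (\<lambda>x. x) (at x) v = v" for x v :: 'a
    using frechet_derivative_at[OF has_derivative_ident] by metis
  thus ?thesis unfolding Suc by (simp add: Ck_on_const)
qed simp

lemma Ck_onD:
  assumes "Ck_on (Suc k) S f" "x \<in> S"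
  shows "(f has_derivative frechet_derivative f (at x)) (at x)"
  using assms frechet_derivative_works by auto

text \<open>Lets the closure properties below be proved by exhibiting a derivative from the usual
  rules instead of computing with \<open>frechet_derivative\<close>.\<close>

lemma Ck_on_SucI:
  assumes "open S" "\<And>x. x \<in> S \<Longrightarrow> (f has_derivative f' x) (at x)" "\<And>v. Ck_on k S (\<lambda>x. f' x v)"
  shows "Ck_on (Suc k) S f"
proof -
  have "frechet_derivative f (at x) = f' x" if "x \<in> S" for x
    using frechet_derivative_at[OF assms(2)[OF that]] by simp
  thus ?thesis unfolding Ck_on.simps
    using assms by (auto simp: differentiable_def intro!: Ck_on_cong[OF assms(1) _ assms(3)])
qed

lemma Ck_on_linear:
  assumes "bounded_linear L" "open S" "Ck_on k S f"
  shows "Ck_on k S (\<lambda>x. L (f x))"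
  using assms(3)
proof (induction k arbitrary: f)
  case 0
  thus ?case by (auto intro: continuous_on_compose2[OF linear_continuous_on[OF assms(1), of UNIV]])
next
  case (Suc k)
  show ?case
  proof (rule Ck_on_SucI[OF assms(2)])
    fix x assume "x \<in> S"
    show "((\<lambda>x. L (f x)) has_derivative (\<lambda>v. L (frechet_derivative f (at x) v))) (at x)"
      by (rule bounded_linear.has_derivative[OF assms(1) Ck_onD[OF Suc.prems \<open>x \<in> S\<close>]])
  next
    fix v show "Ck_on k S (\<lambda>x. L (frechet_derivative f (at x) v))"
      by (rule Suc.IH) (use Suc.prems in simp)
  qed
qed

lemma Ck_on_add:
  assumes "open S" "Ck_on k S f" "Ck_on k S g"
  shows "Ck_on k S (\<lambda>x. f x + g x)"
  using assms(2,3)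
proof (induction k arbitrary: f g)
  case 0
  thus ?case by (auto intro: continuous_intros)
next
  case (Suc k)
  show ?case
  proof (rule Ck_on_SucI[OF assms(1)])
    fix x assume "x \<in> S"
    show "((\<lambda>x. f x + g x) has_derivative (\<lambda>v. frechet_derivative f (at x) v + frechet_derivative g (at x) v)) (at x)"
      by (intro has_derivative_add Ck_onD[OF Suc.prems(1) \<open>x \<in> S\<close>] Ck_onD[OF Suc.prems(2) \<open>x \<in> S\<close>])
  next
    fix v show "Ck_on k S (\<lambda>x. frechet_derivative f (at x) v + frechet_derivative g (at x) v)"
      by (rule Suc.IH) (use Suc.prems in auto)
  qed
qed

lemma Ck_on_sum:
  assumes "open S" "\<And>i. i \<in> I \<Longrightarrow> Ck_on k S (f i)"
  shows "Ck_on k S (\<lambda>x. \<Sum>i\<in>I. f i x)"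
  using assms(2)
proof (induction I rule: infinite_finite_induct)
  case (insert i I)
  thus ?case by (simp add: Ck_on_add[OF assms(1)])
qed (simp_all add: Ck_on_const)

lemma Ck_on_bilinear:
  fixes f :: "'a::euclidean_space \<Rightarrow> 'b::euclidean_space" and g :: "'a \<Rightarrow> 'c::euclidean_space"
    and p :: "'b \<Rightarrow> 'c \<Rightarrow> 'd::euclidean_space"
  assumes "bounded_bilinear p" "open S" "Ck_on k S f" "Ck_on k S g"
  shows "Ck_on k S (\<lambda>x. p (f x) (g x))"
  using assms(3,4)
proof (induction k arbitrary: f g)
  case 0
  thus ?case by (auto intro: bounded_bilinear.continuous_on[OF assms(1)])
next
  case (Suc k)
  show ?case
  proof (rule Ck_on_SucI[OF assms(2)])
    fix x assume "x \<in> S"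
    show "((\<lambda>x. p (f x) (g x)) has_derivative (\<lambda>v. p (f x) (frechet_derivative g (at x) v) + p (frechet_derivative f (at x) v) (g x))) (at x)"
      by (intro bounded_bilinear.FDERIV[OF assms(1)] Ck_onD[OF Suc.prems(1) \<open>x \<in> S\<close>] Ck_onD[OF Suc.prems(2) \<open>x \<in> S\<close>])
  next
    fix v show "Ck_on k S (\<lambda>x. p (f x) (frechet_derivative g (at x) v) + p (frechet_derivative f (at x) v) (g x))"
      by (intro Ck_on_add[OF assms(2)] Suc.IH Ck_on_SucD[OF Suc.prems(1)] Ck_on_SucD[OF Suc.prems(2)])
         (use Suc.prems in auto)
  qed
qed

text \<open>The chain rule feeds a direction depending on \<open>x\<close> into the derivative of
  \<open>g\<close>. Expanded in the basis, this is a sum of products of a derivative of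
  \<open>f\<close> with derivatives of \<open>g\<close> in fixed directions at \<open>f x\<close>,
  and the induction hypothesis covers the latter.\<close>

lemma Ck_on_compose:
  fixes f :: "'a::euclidean_space \<Rightarrow> 'b::euclidean_space" and g :: "'b \<Rightarrow> 'c::euclidean_space"
  assumes "open S" "open T" "f ` S \<subseteq> T" "Ck_on k S f" "Ck_on k T g"
  shows "Ck_on k S (\<lambda>x. g (f x))"
  using assms(4,5)
proof (induction k arbitrary: g)
  case 0
  thus ?case using assms(3) by (auto intro: continuous_on_compose2)
next
  case (Suc k)
  have fT: "f x \<in> T" if "x \<in> S" for x using assms(3) that by auto
  show ?case
  proof (rule Ck_on_SucI[OF assms(1)])
    fix x assume x: "x \<in> S"
    note g' = Ck_onD[OF Suc.prems(2) fT[OF x]]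
    have "((\<lambda>x. g (f x)) has_derivative (\<lambda>v. frechet_derivative g (at (f x)) (frechet_derivative f (at x) v))) (at x)"
      by (rule has_derivative_compose[OF Ck_onD[OF Suc.prems(1) x] g'])
    also have "(\<lambda>v. frechet_derivative g (at (f x)) (frechet_derivative f (at x) v))
       = (\<lambda>v. \<Sum>b\<in>Basis. (frechet_derivative f (at x) v \<bullet> b) *\<^sub>R frechet_derivative g (at (f x)) b)"
    proof
      fix v
      interpret linear "frechet_derivative g (at (f x))" using g' has_derivative_linear by blast
      show "frechet_derivative g (at (f x)) (frechet_derivative f (at x) v) = (\<Sum>b\<in>Basis. (frechet_derivative f (at x) v \<bullet> b) *\<^sub>R frechet_derivative g (at (f x)) b)"
        by (subst euclidean_representation[of "frechet_derivative f (at x) v", symmetric]) (simp only: sum scale)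
    qed
    finally show "((\<lambda>x. g (f x)) has_derivative (\<lambda>v. \<Sum>b\<in>Basis. (frechet_derivative f (at x) v \<bullet> b) *\<^sub>R frechet_derivative g (at (f x)) b)) (at x)" .
  next
    fix v
    show "Ck_on k S (\<lambda>x. \<Sum>b\<in>Basis. (frechet_derivative f (at x) v \<bullet> b) *\<^sub>R frechet_derivative g (at (f x)) b)"
    proof (intro Ck_on_sum[OF assms(1)] Ck_on_bilinear[OF bounded_bilinear_scaleR assms(1)])
      fix b :: 'b
      show "Ck_on k S (\<lambda>x. frechet_derivative f (at x) v \<bullet> b)"
        using Suc.prems by (intro Ck_on_linear[OF bounded_linear_inner_left assms(1)]) simp
      show "Ck_on k S (\<lambda>x. frechet_derivative g (at (f x)) b)"
        by (rule Suc.IH) (use Suc.prems Ck_on_SucD[OF Suc.prems(1)] in auto)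
    qed
  qed
qed

lemma Ck_on_inverse:
  fixes f :: "'a::euclidean_space \<Rightarrow> real"
  assumes "open S" "\<And>x. x \<in> S \<Longrightarrow> f x \<noteq> 0" "Ck_on k S f"
  shows "Ck_on k S (\<lambda>x. inverse (f x))"
  using assms(3)
proof (induction k)
  case 0
  thus ?case using assms(2) by (auto intro: continuous_intros)
next
  case (Suc k)
  note IH = Suc.IH[OF Ck_on_SucD[OF Suc.prems]]
  show ?case
  proof (rule Ck_on_SucI[OF assms(1)])
    fix x assume x: "x \<in> S"
    show "((\<lambda>x. inverse (f x)) has_derivative (\<lambda>v. - (inverse (f x) * frechet_derivative f (at x) v * inverse (f x)))) (at x)"
      by (rule Deriv.has_derivative_inverse[OF assms(2)[OF x] Ck_onD[OF Suc.prems x]])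
  next
    fix v
    have "Ck_on k S (\<lambda>x. inverse (f x) * frechet_derivative f (at x) v * inverse (f x))"
      by (intro Ck_on_bilinear[OF bounded_bilinear_mult assms(1)] IH) (use Suc.prems in simp)
    from Ck_on_linear[OF bounded_linear_minus[OF bounded_linear_ident] assms(1) this]
    show "Ck_on k S (\<lambda>x. - (inverse (f x) * frechet_derivative f (at x) v * inverse (f x)))" .
  qed
qed

lemma smooth_on_openD:
  assumes "smooth_on_open S f"
  shows "open S" "\<And>x. x \<in> S \<Longrightarrow> (f has_derivative frechet_derivative f (at x)) (at x)"
    "\<And>v. smooth_on_open S (\<lambda>x. frechet_derivative f (at x) v)" "continuous_on S f"
proof -
  have C: "Ck_on k S f" for k using assms by (simp add: smooth_on_open_def)
  show "open S" using assms by (simp add: smooth_on_open_def)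
  show "(f has_derivative frechet_derivative f (at x)) (at x)" if "x \<in> S" for x
    by (rule Ck_onD[OF C that])
  show "smooth_on_open S (\<lambda>x. frechet_derivative f (at x) v)" for v
    using C[of "Suc k" for k] \<open>open S\<close> by (auto simp: smooth_on_open_def)
  show "continuous_on S f" using C[of 0] by simp
qed

lemma smooth_on_open_subset: "smooth_on_open S f \<Longrightarrow> open T \<Longrightarrow> T \<subseteq> S \<Longrightarrow> smooth_on_open T f"
  by (auto simp: smooth_on_open_def intro: Ck_on_subset)

lemma smooth_on_open_compose:
  "smooth_on_open S f \<Longrightarrow> smooth_on_open T g \<Longrightarrow> f ` S \<subseteq> T \<Longrightarrow> smooth_on_open S (\<lambda>x. g (f x))"
  by (auto simp: smooth_on_open_def intro: Ck_on_compose)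

lemma smooth_on_open_inner:
  "smooth_on_open S f \<Longrightarrow> smooth_on_open S g \<Longrightarrow> smooth_on_open S (\<lambda>x. f x \<bullet> g x)"
  by (auto simp: smooth_on_open_def intro: Ck_on_bilinear[OF bounded_bilinear_inner])

lemma smooth_on_open_scaleR:
  fixes f :: "'a::euclidean_space \<Rightarrow> real"
  shows "smooth_on_open S f \<Longrightarrow> smooth_on_open S g \<Longrightarrow> smooth_on_open S (\<lambda>x. f x *\<^sub>R g x)"
  by (auto simp: smooth_on_open_def intro: Ck_on_bilinear[OF bounded_bilinear_scaleR])

lemma smooth_on_open_add:
  "smooth_on_open S f \<Longrightarrow> smooth_on_open S g \<Longrightarrow> smooth_on_open S (\<lambda>x. f x + g x)"
  by (auto simp: smooth_on_open_def intro: Ck_on_add)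

lemma smooth_on_open_const: "open S \<Longrightarrow> smooth_on_open S (\<lambda>x. c)"
  by (simp add: smooth_on_open_def Ck_on_const)

lemma smooth_on_open_ident: "open S \<Longrightarrow> smooth_on_open S (\<lambda>x. x)"
  by (simp add: smooth_on_open_def Ck_on_ident)

lemma smooth_on_open_linear: "bounded_linear L \<Longrightarrow> smooth_on_open S f \<Longrightarrow> smooth_on_open S (\<lambda>x. L (f x))"
  by (auto simp: smooth_on_open_def intro: Ck_on_linear)

lemma smooth_on_open_inverse:
  fixes f :: "'a::euclidean_space \<Rightarrow> real"
  shows "smooth_on_open S f \<Longrightarrow> (\<And>x. x \<in> S \<Longrightarrow> f x \<noteq> 0) \<Longrightarrow> smooth_on_open S (\<lambda>x. inverse (f x))"
  by (auto simp: smooth_on_open_def intro: Ck_on_inverse)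

section \<open>Holomorphic maps up to the boundary\<close>

lemma continuous_eq_on_closure_within:
  fixes f g :: "'a::topological_space \<Rightarrow> 'b::real_normed_vector"
  assumes "continuous_on W f" "continuous_on W g" "\<And>x. x \<in> O' \<Longrightarrow> f x = g x" "O' \<subseteq> W" "q \<in> W" "q \<in> closure O'"
  shows "f q = g q"
proof -
  have "closedin (top_of_set W) {x \<in> W. f x - g x = 0}"
    by (intro continuous_closedin_preimage_constant continuous_on_diff assms)
  then obtain T where T: "closed T" "{x \<in> W. f x - g x = 0} = W \<inter> T" by (auto simp: closedin_closed)
  hence "O' \<subseteq> T" using assms(3,4) by auto
  hence "q \<in> T" using assms(6) T(1) closure_minimal by blast
  hence "q \<in> {x \<in> W. f x - g x = 0}" using T(2) assms(5) by auto
  thus ?thesis by simp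
qed

lemma bounded_linear_cscale: "bounded_linear (\<lambda>v. c *s v :: complex^2)"
  unfolding linear_conv_bounded_linear[symmetric]
  by (rule linearI) (simp_all add: vec_eq_iff algebra_simps)

lemma bounded_linear_cscale_left: "bounded_linear (\<lambda>c. c *s v :: complex^2)"
  unfolding linear_conv_bounded_linear[symmetric]
  by (rule linearI) (simp_all add: vec_eq_iff algebra_simps)

lemma cscale_simps: "\<i> *s (\<i> *s v) = - v" for v :: "complex^2"
  by (simp add: vec_eq_iff flip: mult.assoc)

lemma frechet_derivative_eqI: "(f has_derivative f') (at x) \<Longrightarrow> frechet_derivative f (at x) = f'"
  using frechet_derivative_at by metis

text \<open>On the complex line through \<open>x\<close> in direction \<open>w\<close> each
  component of F is a holomorphic function of one variable, and so is its derivative; the complex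
  derivative of the latter at 0 is the second derivative in question.\<close>

lemma second_derivative_complex_line:
  fixes F :: "complex^2 \<Rightarrow> complex^2"
  assumes F: "smooth_on_open W F" and O: "open O'" "O' \<subseteq> W"
    and cl: "\<And>x. x \<in> O' \<Longrightarrow> complex_linear (frechet_derivative F (at x))" and x: "x \<in> O'"
  shows "frechet_derivative (\<lambda>x. frechet_derivative F (at x) w) (at x) (\<i> *s w)
     = \<i> *s frechet_derivative (\<lambda>x. frechet_derivative F (at x) w) (at x) w"
proof -
  define l where "l \<zeta> = x + \<zeta> *s w" for \<zeta>
  define U where "U = l -` O'"
  have l': "(l has_derivative (\<lambda>h. h *s w)) (at \<zeta>)" for \<zeta>
    unfolding l_def by (auto intro!: derivative_eq_intros bounded_linear_imp_has_derivative bounded_linear_cscale_left)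
  have "continuous_on UNIV l"
    using l' by (intro continuous_at_imp_continuous_on ballI has_derivative_continuous) auto
  hence U: "open U" unfolding U_def by (rule open_vimage[OF O(1)])
  have U0: "0 \<in> U" using x by (simp add: U_def l_def)
  note F1 = smooth_on_openD(2)[OF F]
  note F2 = smooth_on_openD(2)[OF smooth_on_openD(3)[OF F]]
  show ?thesis
  proof (subst vec_eq_iff, intro allI)
    fix j :: 2
    define \<phi> where "\<phi> \<zeta> = F (l \<zeta>) $ j" for \<zeta>
    define \<psi> where "\<psi> \<zeta> = frechet_derivative F (at (l \<zeta>)) w $ j" for \<zeta>
    have d: "(\<phi> has_field_derivative \<psi> \<zeta>) (at \<zeta>)" if "\<zeta> \<in> U" for \<zeta>
    proof -
      have lO: "l \<zeta> \<in> O'" using that by (simp add: U_def)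
      have "((\<lambda>\<zeta>. F (l \<zeta>)) has_derivative (\<lambda>h. frechet_derivative F (at (l \<zeta>)) (h *s w))) (at \<zeta>)"
        by (rule has_derivative_compose[OF l' F1]) (use lO O in auto)
      from bounded_linear.has_derivative[OF bounded_linear_vec_nth this]
      have "(\<phi> has_derivative (\<lambda>h. frechet_derivative F (at (l \<zeta>)) (h *s w) $ j)) (at \<zeta>)" unfolding \<phi>_def .
      moreover have "frechet_derivative F (at (l \<zeta>)) (h *s w) $ j = \<psi> \<zeta> * h" for h
        using cl[OF lO] by (simp add: complex_linear_def \<psi>_def)
      ultimately show ?thesis by (simp add: has_field_derivative_def)
    qed
    have "\<phi> holomorphic_on U" using d U by (auto simp: holomorphic_on_open)
    hence "deriv \<phi> holomorphic_on U" by (rule holomorphic_deriv[OF _ U])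
    hence "\<psi> holomorphic_on U" by (rule holomorphic_transform) (use d DERIV_imp_deriv in blast)
    then obtain c where c: "(\<psi> has_field_derivative c) (at 0)" using U U0 by (auto simp: holomorphic_on_open)
    have l0: "l 0 = x" by (simp add: l_def)
    have "((\<lambda>\<zeta>. frechet_derivative F (at (l \<zeta>)) w) has_derivative
         (\<lambda>h. frechet_derivative (\<lambda>x. frechet_derivative F (at x) w) (at (l 0)) (h *s w))) (at 0)"
      by (rule has_derivative_compose[OF l' F2]) (use l0 x O in auto)
    from bounded_linear.has_derivative[OF bounded_linear_vec_nth this]
    have "(\<psi> has_derivative (\<lambda>h. frechet_derivative (\<lambda>x. frechet_derivative F (at x) w) (at x) (h *s w) $ j)) (at 0)"
      unfolding \<psi>_def l0 .
    from has_derivative_unique[OF this c[unfolded has_field_derivative_def]]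
    have e: "frechet_derivative (\<lambda>x. frechet_derivative F (at x) w) (at x) (h *s w) $ j = c * h" for h by metis
    show "frechet_derivative (\<lambda>x. frechet_derivative F (at x) w) (at x) (\<i> *s w) $ j
       = (\<i> *s frechet_derivative (\<lambda>x. frechet_derivative F (at x) w) (at x) w) $ j"
      using e[of \<i>] e[of 1] by simp
  qed
qed

text \<open>Both identities hold on the open set, where F is holomorphic, and their sides are
  continuous on \<open>W\<close>, so they persist on the closure. Thus holomorphy reaches the sphere
  although the extension need not be holomorphic beyond it. In the second identity each slot
  contributes one factor \<i>.\<close>

lemma holomorphic_boundary_derivatives:
  fixes F :: "complex^2 \<Rightarrow> complex^2"
  assumes F: "smooth_on_open W F" and O: "open O'" "O' \<subseteq> W"
    and cl: "\<And>x. x \<in> O' \<Longrightarrow> complex_linear (frechet_derivative F (at x))" and q: "q \<in> W" "q \<in> closure O'"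
  shows "complex_linear (frechet_derivative F (at q))"
    and "frechet_derivative (\<lambda>x. frechet_derivative F (at x) (\<i> *s w)) (at q) (\<i> *s w)
     = - frechet_derivative (\<lambda>x. frechet_derivative F (at x) w) (at q) w"
proof -
  note F1 = smooth_on_openD(2)[OF F] and F2 = smooth_on_openD(2)[OF smooth_on_openD(3)[OF F]]
  note c1 = smooth_on_openD(4)[OF smooth_on_openD(3)[OF F]]
  note c2 = smooth_on_openD(4)[OF smooth_on_openD(3)[OF smooth_on_openD(3)[OF F]]]
  have "frechet_derivative F (at q) (c *s v) = c *s frechet_derivative F (at q) v" for c v
    by (rule continuous_eq_on_closure_within[OF c1 bounded_linear.continuous_on[OF bounded_linear_cscale c1] _ O(2) q])
       (use cl in \<open>simp add: complex_linear_def\<close>)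
  thus "complex_linear (frechet_derivative F (at q))"
    using F1[OF q(1)] has_derivative_linear by (auto simp: complex_linear_def)
  show "frechet_derivative (\<lambda>x. frechet_derivative F (at x) (\<i> *s w)) (at q) (\<i> *s w)
     = - frechet_derivative (\<lambda>x. frechet_derivative F (at x) w) (at q) w"
  proof (rule continuous_eq_on_closure_within[OF c2 continuous_on_minus[OF c2] _ O(2) q])
    fix x assume x: "x \<in> O'"
    have "((\<lambda>x. \<i> *s frechet_derivative F (at x) w) has_derivative
        (\<lambda>h. \<i> *s frechet_derivative (\<lambda>x. frechet_derivative F (at x) w) (at x) h)) (at x)"
      by (rule bounded_linear.has_derivative[OF bounded_linear_cscale F2]) (use x O in auto)
    hence "((\<lambda>x. frechet_derivative F (at x) (\<i> *s w)) has_derivative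
        (\<lambda>h. \<i> *s frechet_derivative (\<lambda>x. frechet_derivative F (at x) w) (at x) h)) (at x)"
      by (rule has_derivative_transform_within_open[OF _ O(1) x]) (use cl in \<open>auto simp: complex_linear_def\<close>)
    from frechet_derivative_eqI[OF this]
    have "frechet_derivative (\<lambda>x. frechet_derivative F (at x) (\<i> *s w)) (at x) (\<i> *s w)
       = \<i> *s (\<i> *s frechet_derivative (\<lambda>x. frechet_derivative F (at x) w) (at x) w)"
      using second_derivative_complex_line[OF F O cl x, of w] by simp
    thus "frechet_derivative (\<lambda>x. frechet_derivative F (at x) (\<i> *s w)) (at x) (\<i> *s w)
       = - frechet_derivative (\<lambda>x. frechet_derivative F (at x) w) (at x) w"
      by (simp add: cscale_simps)
  qed
qed

section \<open>The Levi form\<close>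

lemma second_derivative_linear_left:
  assumes "smooth_on_open N \<rho>" "p \<in> N"
  shows "linear (\<lambda>v. frechet_derivative (\<lambda>x. frechet_derivative \<rho> (at x) v) (at p) w)"
proof (rule linearI)
  note op = smooth_on_openD(1)[OF assms(1)]
  note d1 = smooth_on_openD(2)[OF assms(1)] and d2 = smooth_on_openD(2)[OF smooth_on_openD(3)[OF assms(1)] assms(2)]
  fix v v'
  have "((\<lambda>x. frechet_derivative \<rho> (at x) (v + v')) has_derivative (\<lambda>w. frechet_derivative (\<lambda>x. frechet_derivative \<rho> (at x) v) (at p) w
      + frechet_derivative (\<lambda>x. frechet_derivative \<rho> (at x) v') (at p) w)) (at p)"
    by (rule has_derivative_transform_within_open[OF has_derivative_add[OF d2 d2] op assms(2)])
       (use has_derivative_linear[OF d1] in \<open>simp add: linear_add\<close>)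
  from frechet_derivative_eqI[OF this]
  show "frechet_derivative (\<lambda>x. frechet_derivative \<rho> (at x) (v + v')) (at p) w = frechet_derivative (\<lambda>x. frechet_derivative \<rho> (at x) v) (at p) w
      + frechet_derivative (\<lambda>x. frechet_derivative \<rho> (at x) v') (at p) w" by simp
next
  note op = smooth_on_openD(1)[OF assms(1)]
  note d1 = smooth_on_openD(2)[OF assms(1)] and d2 = smooth_on_openD(2)[OF smooth_on_openD(3)[OF assms(1)] assms(2)]
  fix r v
  have "((\<lambda>x. frechet_derivative \<rho> (at x) (r *\<^sub>R v)) has_derivative (\<lambda>w. r *\<^sub>R frechet_derivative (\<lambda>x. frechet_derivative \<rho> (at x) v) (at p) w)) (at p)"
    by (rule has_derivative_transform_within_open[OF has_derivative_scaleR_right[OF d2] op assms(2)])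
       (use has_derivative_linear[OF d1] in \<open>simp add: linear_scale\<close>)
  from frechet_derivative_eqI[OF this]
  show "frechet_derivative (\<lambda>x. frechet_derivative \<rho> (at x) (r *\<^sub>R v)) (at p) w = r *\<^sub>R frechet_derivative (\<lambda>x. frechet_derivative \<rho> (at x) v) (at p) w"
    by simp
qed

text \<open>The second-order chain rule. Expanding the first derivative in the basis makes it a sum
  of products of differentiable functions; linearity collapses the sums again.\<close>

lemma second_derivative_compose:
  fixes F :: "'a::euclidean_space \<Rightarrow> 'b::euclidean_space" and \<rho> :: "'b \<Rightarrow> real"
  assumes \<rho>: "smooth_on_open N \<rho>" and F: "smooth_on_open W F" and p: "p \<in> W" "F p \<in> N"
  shows "frechet_derivative (\<lambda>x. \<rho> (F x)) (at p) v = frechet_derivative \<rho> (at (F p)) (frechet_derivative F (at p) v)"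
    and "frechet_derivative (\<lambda>x. frechet_derivative (\<lambda>x. \<rho> (F x)) (at x) v) (at p) v'
     = frechet_derivative (\<lambda>y. frechet_derivative \<rho> (at y) (frechet_derivative F (at p) v)) (at (F p)) (frechet_derivative F (at p) v')
      + frechet_derivative \<rho> (at (F p)) (frechet_derivative (\<lambda>x. frechet_derivative F (at x) v) (at p) v')"
proof -
  note r1 = smooth_on_openD(2)[OF \<rho>] and r2 = smooth_on_openD(2)[OF smooth_on_openD(3)[OF \<rho>]]
  note f1 = smooth_on_openD(2)[OF F] and f2 = smooth_on_openD(2)[OF smooth_on_openD(3)[OF F]]
  define X where "X = W \<inter> F -` N"
  have X: "open X" unfolding X_def
    by (rule continuous_open_preimage[OF smooth_on_openD(4)[OF F] smooth_on_openD(1)[OF F] smooth_on_openD(1)[OF \<rho>]])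
  have pX: "p \<in> X" using p by (simp add: X_def)
  have d: "frechet_derivative (\<lambda>x. \<rho> (F x)) (at x) v = frechet_derivative \<rho> (at (F x)) (frechet_derivative F (at x) v)" if "x \<in> X" for x v
    using frechet_derivative_eqI[OF has_derivative_compose[OF f1 r1]] that by (simp add: X_def)
  show "frechet_derivative (\<lambda>x. \<rho> (F x)) (at p) v = frechet_derivative \<rho> (at (F p)) (frechet_derivative F (at p) v)"
    by (rule d[OF pX])
  have lin: "linear (frechet_derivative \<rho> (at (F x)))" if "x \<in> X" for x
    using has_derivative_linear[OF r1] that by (simp add: X_def)
  have ex: "frechet_derivative \<rho> (at (F x)) y = (\<Sum>b\<in>Basis. (y \<bullet> b) * frechet_derivative \<rho> (at (F x)) b)" if "x \<in> X" for x y
  proof -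
    interpret linear "frechet_derivative \<rho> (at (F x))" by (rule lin[OF that])
    show ?thesis by (subst euclidean_representation[of y, symmetric]) (simp only: sum scale real_scaleR_def)
  qed
  have "((\<lambda>x. \<Sum>b\<in>Basis. (frechet_derivative F (at x) v \<bullet> b) * frechet_derivative \<rho> (at (F x)) b) has_derivative
     (\<lambda>h. \<Sum>b\<in>Basis. (frechet_derivative F (at p) v \<bullet> b) * frechet_derivative (\<lambda>y. frechet_derivative \<rho> (at y) b) (at (F p)) (frechet_derivative F (at p) h)
        + (frechet_derivative (\<lambda>x. frechet_derivative F (at x) v) (at p) h \<bullet> b) * frechet_derivative \<rho> (at (F p)) b)) (at p)"
    by (intro has_derivative_sum has_derivative_mult bounded_linear.has_derivative[OF bounded_linear_inner_left]
        f2[OF p(1)] has_derivative_compose[OF f1[OF p(1)] r2[OF p(2)]])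
  hence "((\<lambda>x. frechet_derivative (\<lambda>x. \<rho> (F x)) (at x) v) has_derivative
     (\<lambda>h. \<Sum>b\<in>Basis. (frechet_derivative F (at p) v \<bullet> b) * frechet_derivative (\<lambda>y. frechet_derivative \<rho> (at y) b) (at (F p)) (frechet_derivative F (at p) h)
        + (frechet_derivative (\<lambda>x. frechet_derivative F (at x) v) (at p) h \<bullet> b) * frechet_derivative \<rho> (at (F p)) b)) (at p)"
    by (rule has_derivative_transform_within_open[OF _ X pX]) (simp add: d ex)
  from frechet_derivative_eqI[OF this]
  have "frechet_derivative (\<lambda>x. frechet_derivative (\<lambda>x. \<rho> (F x)) (at x) v) (at p) v'
    = (\<Sum>b\<in>Basis. (frechet_derivative F (at p) v \<bullet> b) * frechet_derivative (\<lambda>y. frechet_derivative \<rho> (at y) b) (at (F p)) (frechet_derivative F (at p) v'))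
      + (\<Sum>b\<in>Basis. (frechet_derivative (\<lambda>x. frechet_derivative F (at x) v) (at p) v' \<bullet> b) * frechet_derivative \<rho> (at (F p)) b)"
    by (simp add: sum.distrib)
  also have "(\<Sum>b\<in>Basis. (frechet_derivative (\<lambda>x. frechet_derivative F (at x) v) (at p) v' \<bullet> b) * frechet_derivative \<rho> (at (F p)) b)
     = frechet_derivative \<rho> (at (F p)) (frechet_derivative (\<lambda>x. frechet_derivative F (at x) v) (at p) v')"
    by (rule ex[OF pX, symmetric])
  also have "(\<Sum>b\<in>Basis. (frechet_derivative F (at p) v \<bullet> b) * frechet_derivative (\<lambda>y. frechet_derivative \<rho> (at y) b) (at (F p)) (frechet_derivative F (at p) v'))
     = frechet_derivative (\<lambda>y. frechet_derivative \<rho> (at y) (frechet_derivative F (at p) v)) (at (F p)) (frechet_derivative F (at p) v')"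
  proof -
    interpret linear "\<lambda>v. frechet_derivative (\<lambda>x. frechet_derivative \<rho> (at x) v) (at (F p)) (frechet_derivative F (at p) v')"
      by (rule second_derivative_linear_left[OF \<rho> p(2)])
    show ?thesis
      by (subst (2) euclidean_representation[of "frechet_derivative F (at p) v", symmetric]) (simp only: sum scale real_scaleR_def)
  qed
  finally show "frechet_derivative (\<lambda>x. frechet_derivative (\<lambda>x. \<rho> (F x)) (at x) v) (at p) v'
     = frechet_derivative (\<lambda>y. frechet_derivative \<rho> (at y) (frechet_derivative F (at p) v)) (at (F p)) (frechet_derivative F (at p) v')
      + frechet_derivative \<rho> (at (F p)) (frechet_derivative (\<lambda>x. frechet_derivative F (at x) v) (at p) v')" .
qed

lemma norm_eq_1I: "(norm x)\<^sup>2 = 1 \<Longrightarrow> norm x = 1"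
  using norm_ge_zero[of x] by (simp add: power2_eq_1_iff)

text \<open>R vanishes along the great circle cos s p + sin s w, whose velocity at s = 0 is w and
  whose acceleration is -p. Differentiating once gives R'(w) = 0, and twice R''(w,w) - R'(p) =
  0.\<close>

lemma vanishing_on_sphere_derivatives:
  fixes R :: "'a::euclidean_space \<Rightarrow> real"
  assumes R: "smooth_on_open X R" and X: "sphere 0 1 \<subseteq> X" and R0: "\<And>x. x \<in> sphere 0 1 \<Longrightarrow> R x = 0"
    and pw: "norm p = 1" "norm w = 1" "p \<bullet> w = 0"
  shows "frechet_derivative R (at p) w = 0"
    and "frechet_derivative (\<lambda>x. frechet_derivative R (at x) w) (at p) w = frechet_derivative R (at p) p"
proof -
  note d1 = smooth_on_openD(2)[OF R] and d2 = smooth_on_openD(2)[OF smooth_on_openD(3)[OF R]]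
  define \<gamma> where "\<gamma> s = cos s *\<^sub>R p + sin s *\<^sub>R w" for s
  have \<gamma>S: "\<gamma> s \<in> sphere 0 1" for s
  proof -
    have "(norm (\<gamma> s))\<^sup>2 = (cos s)\<^sup>2 * (p \<bullet> p) + (sin s)\<^sup>2 * (w \<bullet> w) + 2 * cos s * sin s * (p \<bullet> w)"
      unfolding power2_norm_eq_inner \<gamma>_def by (simp add: inner_add_left inner_add_right inner_commute power2_eq_square algebra_simps)
    moreover have "p \<bullet> p = 1" "w \<bullet> w = 1" using pw by (auto simp: norm_eq_1)
    ultimately have "(norm (\<gamma> s))\<^sup>2 = 1" using pw by simp
    thus ?thesis using norm_eq_1I by simp
  qed
  have \<gamma>X: "\<gamma> s \<in> X" for s using \<gamma>S X by auto
  have \<gamma>': "(\<gamma> has_derivative (\<lambda>h. (- sin s * h) *\<^sub>R p + (cos s * h) *\<^sub>R w)) (at s)" for s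
    unfolding \<gamma>_def by (auto intro!: derivative_eq_intros simp: mult.commute)
  have k: "- sin s * frechet_derivative R (at (\<gamma> s)) p + cos s * frechet_derivative R (at (\<gamma> s)) w = 0" for s
  proof -
    have "((\<lambda>s. R (\<gamma> s)) has_derivative (\<lambda>h. frechet_derivative R (at (\<gamma> s)) ((- sin s * h) *\<^sub>R p + (cos s * h) *\<^sub>R w))) (at s)"
      by (rule has_derivative_compose[OF \<gamma>' d1[OF \<gamma>X]])
    moreover have "((\<lambda>s. R (\<gamma> s)) has_derivative (\<lambda>h. 0)) (at s)" using R0[OF \<gamma>S] by simp
    ultimately have "(\<lambda>h. frechet_derivative R (at (\<gamma> s)) ((- sin s * h) *\<^sub>R p + (cos s * h) *\<^sub>R w)) = (\<lambda>h. 0)"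
      by (rule has_derivative_unique)
    from fun_cong[OF this, of 1] show ?thesis
      using has_derivative_linear[OF d1[OF \<gamma>X[of s]]] by (simp add: linear_add linear_diff linear_scale linear_neg)
  qed
  have \<gamma>0: "\<gamma> 0 = p" by (simp add: \<gamma>_def)
  show "frechet_derivative R (at p) w = 0" using k[of 0] by (simp add: \<gamma>0)
  have a: "((\<lambda>s. frechet_derivative R (at (\<gamma> s)) u) has_derivative
     (\<lambda>h. frechet_derivative (\<lambda>x. frechet_derivative R (at x) u) (at p) (h *\<^sub>R w))) (at 0)" for u
    using has_derivative_compose[OF \<gamma>'[of 0] d2[OF \<gamma>X[of 0]], of u] by (simp add: \<gamma>0)
  have "((\<lambda>s. - sin s * frechet_derivative R (at (\<gamma> s)) p + cos s * frechet_derivative R (at (\<gamma> s)) w) has_derivative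
     (\<lambda>h. - h * frechet_derivative R (at p) p + frechet_derivative (\<lambda>x. frechet_derivative R (at x) w) (at p) (h *\<^sub>R w))) (at 0)"
    by (auto intro!: derivative_eq_intros a simp: \<gamma>0)
  moreover have "((\<lambda>s. - sin s * frechet_derivative R (at (\<gamma> s)) p + cos s * frechet_derivative R (at (\<gamma> s)) w) has_derivative (\<lambda>h. 0)) (at 0)"
    unfolding k by simp
  ultimately have "(\<lambda>h. - h * frechet_derivative R (at p) p + frechet_derivative (\<lambda>x. frechet_derivative R (at x) w) (at p) (h *\<^sub>R w)) = (\<lambda>h. 0)"
    by (rule has_derivative_unique)
  from fun_cong[OF this, of 1]
  show "frechet_derivative (\<lambda>x. frechet_derivative R (at x) w) (at p) w = frechet_derivative R (at p) p" by simp
qed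


section \<open>Wirtinger derivatives of a real function\<close>

lemma wirtinger_of_real:
  assumes \<rho>: "smooth_on_open N \<rho>" and p: "p \<in> N"
  shows "d_z j (\<lambda>q. of_real (\<rho> q)) p = (of_real (frechet_derivative \<rho> (at p) (axis j 1)) - \<i> * of_real (frechet_derivative \<rho> (at p) (axis j \<i>))) / 2"
    and "d_zbar j (\<lambda>q. of_real (\<rho> q)) p = (of_real (frechet_derivative \<rho> (at p) (axis j 1)) + \<i> * of_real (frechet_derivative \<rho> (at p) (axis j \<i>))) / 2"
proof -
  have "frechet_derivative (\<lambda>q. complex_of_real (\<rho> q)) (at p) v = of_real (frechet_derivative \<rho> (at p) v)" for v
  proof -
    have "((\<lambda>q. complex_of_real (\<rho> q)) has_derivative (\<lambda>h. complex_of_real (frechet_derivative \<rho> (at p) h))) (at p)"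
      by (rule has_derivative_of_real[OF smooth_on_openD(2)[OF \<rho> p]])
    from frechet_derivative_eqI[OF this] show ?thesis by simp
  qed
  thus "d_z j (\<lambda>q. of_real (\<rho> q)) p = (of_real (frechet_derivative \<rho> (at p) (axis j 1)) - \<i> * of_real (frechet_derivative \<rho> (at p) (axis j \<i>))) / 2"
    and "d_zbar j (\<lambda>q. of_real (\<rho> q)) p = (of_real (frechet_derivative \<rho> (at p) (axis j 1)) + \<i> * of_real (frechet_derivative \<rho> (at p) (axis j \<i>))) / 2"
    by (simp_all add: d_z_def d_zbar_def)
qed

lemma wirtinger_second:
  assumes \<rho>: "smooth_on_open N \<rho>" and p: "p \<in> N"
  defines "B \<equiv> \<lambda>v w. frechet_derivative (\<lambda>x. frechet_derivative \<rho> (at x) v) (at p) w"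
  shows "d_z j (d_zbar k (\<lambda>q. of_real (\<rho> q))) p = Complex ((B (axis k 1) (axis j 1) + B (axis k \<i>) (axis j \<i>)) / 4)
      ((B (axis k \<i>) (axis j 1) - B (axis k 1) (axis j \<i>)) / 4)"
proof -
  let ?g = "\<lambda>q. (complex_of_real (frechet_derivative \<rho> (at q) (axis k 1)) + \<i> * complex_of_real (frechet_derivative \<rho> (at q) (axis k \<i>))) / 2"
  note d2 = smooth_on_openD(2)[OF smooth_on_openD(3)[OF \<rho>] p]
  have "(?g has_derivative (\<lambda>h. (complex_of_real (B (axis k 1) h) + \<i> * complex_of_real (B (axis k \<i>) h)) / 2)) (at p)"
    unfolding B_def
    by (intro bounded_linear.has_derivative[OF bounded_linear_divide] has_derivative_add has_derivative_mult_right has_derivative_of_real d2)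
  hence "(d_zbar k (\<lambda>q. of_real (\<rho> q)) has_derivative (\<lambda>h. (complex_of_real (B (axis k 1) h) + \<i> * complex_of_real (B (axis k \<i>) h)) / 2)) (at p)"
    by (rule has_derivative_transform_within_open[OF _ smooth_on_openD(1)[OF \<rho>] p])
       (simp add: wirtinger_of_real[OF \<rho>])
  from frechet_derivative_eqI[OF this] show ?thesis
    by (simp add: d_z_def complex_eq_iff)
qed

lemma c2_real_basis: "w = Re (w $ 1) *\<^sub>R axis 1 1 + Im (w $ 1) *\<^sub>R axis 1 \<i> + Re (w $ 2) *\<^sub>R axis 2 1 + Im (w $ 2) *\<^sub>R axis 2 \<i>"
  for w :: "complex^2"
  by (simp add: c2_eq_iff axis_def complex_eq_iff)

text \<open>The Levi form is, up to a constant, the real Hessian averaged over w and \<i> w. Both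
  quadratic forms are expanded in the real coordinates of \<open>w\<close>, where the terms outside
  the complex Hessian cancel.\<close>

lemma Re_levi_form:
  assumes \<rho>: "smooth_on_open N \<rho>" and p: "p \<in> N"
  shows "Re (levi_form \<rho> p w) = (frechet_derivative (\<lambda>x. frechet_derivative \<rho> (at x) w) (at p) w
      + frechet_derivative (\<lambda>x. frechet_derivative \<rho> (at x) (\<i> *s w)) (at p) (\<i> *s w)) / 4"
proof -
  define B where "B v w = frechet_derivative (\<lambda>x. frechet_derivative \<rho> (at x) v) (at p) w" for v w
  have l1: "linear (\<lambda>v. B v w)" for w unfolding B_def by (rule second_derivative_linear_left[OF \<rho> p])
  have l2: "linear (\<lambda>w. B v w)" for v
    unfolding B_def using has_derivative_linear[OF smooth_on_openD(2)[OF smooth_on_openD(3)[OF \<rho>] p]] by simp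
  have b1: "B (v + v') w = B v w + B v' w" "B (r *\<^sub>R v) w = r * B v w" for v v' w r
    using linear_add[OF l1] linear_scale[OF l1] by auto
  have b2: "B v (w + w') = B v w + B v w'" "B v (r *\<^sub>R w) = r * B v w" for v w w' r
    using linear_add[OF l2] linear_scale[OF l2] by auto
  define x1 y1 x2 y2 where xy: "x1 = Re (w $ 1)" "y1 = Im (w $ 1)" "x2 = Re (w $ 2)" "y2 = Im (w $ 2)"
  have w: "w = x1 *\<^sub>R axis 1 1 + y1 *\<^sub>R axis 1 \<i> + x2 *\<^sub>R axis 2 1 + y2 *\<^sub>R axis 2 \<i>"
    unfolding xy by (rule c2_real_basis)
  have iw: "\<i> *s w = (- y1) *\<^sub>R axis 1 1 + x1 *\<^sub>R axis 1 \<i> + (- y2) *\<^sub>R axis 2 1 + x2 *\<^sub>R axis 2 \<i>"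
    unfolding xy by (subst c2_real_basis) simp
  have e1: "B w w = x1 * x1 * B (axis 1 1) (axis 1 1) + x1 * y1 * (B (axis 1 1) (axis 1 \<i>) + B (axis 1 \<i>) (axis 1 1))
      + y1 * y1 * B (axis 1 \<i>) (axis 1 \<i>) + x1 * x2 * (B (axis 1 1) (axis 2 1) + B (axis 2 1) (axis 1 1))
      + x1 * y2 * (B (axis 1 1) (axis 2 \<i>) + B (axis 2 \<i>) (axis 1 1)) + y1 * x2 * (B (axis 1 \<i>) (axis 2 1) + B (axis 2 1) (axis 1 \<i>))
      + y1 * y2 * (B (axis 1 \<i>) (axis 2 \<i>) + B (axis 2 \<i>) (axis 1 \<i>)) + x2 * x2 * B (axis 2 1) (axis 2 1)
      + x2 * y2 * (B (axis 2 1) (axis 2 \<i>) + B (axis 2 \<i>) (axis 2 1)) + y2 * y2 * B (axis 2 \<i>) (axis 2 \<i>)"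
    unfolding arg_cong2[of w _ w _ B, OF w w] b1 b2 by (simp add: algebra_simps)
  have e2: "B (\<i> *s w) (\<i> *s w) = y1 * y1 * B (axis 1 1) (axis 1 1) - x1 * y1 * (B (axis 1 1) (axis 1 \<i>) + B (axis 1 \<i>) (axis 1 1))
      + x1 * x1 * B (axis 1 \<i>) (axis 1 \<i>) + y1 * y2 * (B (axis 1 1) (axis 2 1) + B (axis 2 1) (axis 1 1))
      - y1 * x2 * (B (axis 1 1) (axis 2 \<i>) + B (axis 2 \<i>) (axis 1 1)) - x1 * y2 * (B (axis 1 \<i>) (axis 2 1) + B (axis 2 1) (axis 1 \<i>))
      + x1 * x2 * (B (axis 1 \<i>) (axis 2 \<i>) + B (axis 2 \<i>) (axis 1 \<i>)) + y2 * y2 * B (axis 2 1) (axis 2 1)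
      - x2 * y2 * (B (axis 2 1) (axis 2 \<i>) + B (axis 2 \<i>) (axis 2 1)) + x2 * x2 * B (axis 2 \<i>) (axis 2 \<i>)"
    unfolding iw b1 b2 by (simp add: algebra_simps)
  have "Re (levi_form \<rho> p w) = (B w w + B (\<i> *s w) (\<i> *s w)) / 4"
    unfolding e1 e2 unfolding levi_form_def sum_2 wirtinger_second[OF \<rho> p] B_def[symmetric]
    by (simp add: xy[symmetric]) (simp add: field_simps)
  thus ?thesis unfolding B_def .
qed

lemma levi_form_scale: "levi_form \<rho> p (c *s w) = of_real ((cmod c)\<^sup>2) * levi_form \<rho> p w"
proof -
  have "of_real ((cmod c)\<^sup>2) = c * cnj c" by (rule complex_norm_square)
  thus ?thesis unfolding levi_form_def sum_distrib_left by (intro sum.cong refl) (simp add: mult_ac)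
qed

text \<open>Expansion of the bordered determinant. The vector (\<rho>_2, -\<rho>_1) is annihilated
  by the holomorphic differential of \<rho>, so \<open>fefferman_M\<close> is the Levi form at one
  complex tangent vector.\<close>

lemma fefferman_M_levi_form:
  assumes \<rho>: "smooth_on_open N \<rho>" and p: "p \<in> N"
  shows "fefferman_M \<rho> p = Re (levi_form \<rho> p (vector [d_z 2 (\<lambda>q. of_real (\<rho> q)) p, - d_z 1 (\<lambda>q. of_real (\<rho> q)) p]))"
proof -
  have "d_zbar j (\<lambda>q. of_real (\<rho> q)) p = cnj (d_z j (\<lambda>q. of_real (\<rho> q)) p)" for j
    unfolding wirtinger_of_real[OF \<rho> p] by simp
  thus ?thesis
    unfolding fefferman_M_def Let_def levi_form_def det_3 sum_2
    by (simp add: algebra_simps)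
qed

lemma c2_inner: "v \<bullet> w = Re (v $ 1 * cnj (w $ 1) + v $ 2 * cnj (w $ 2))" for v w :: "complex^2"
  by (simp add: inner_vec_def sum_2 inner_complex_def)

lemma real_form_wirtinger:
  fixes v :: "complex^2"
  assumes \<rho>: "smooth_on_open N \<rho>" and p: "p \<in> N"
  shows "frechet_derivative \<rho> (at p) v = 2 * Re (d_z 1 (\<lambda>q. of_real (\<rho> q)) p * v $ 1 + d_z 2 (\<lambda>q. of_real (\<rho> q)) p * v $ 2)"
proof -
  interpret linear "frechet_derivative \<rho> (at p)" using has_derivative_linear[OF smooth_on_openD(2)[OF \<rho> p]] .
  show ?thesis
    unfolding wirtinger_of_real[OF \<rho> p]
    by (subst c2_real_basis[of v]) (simp add: add scale field_simps)
qed

section \<open>The Fefferman form at a boundary point\<close>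

text \<open>On the complex tangent line of the sphere at \<open>p\<close>, second differentiation of \<open>\<rho> \<circ> F = 0\<close> along
  the great circles through \<open>p\<close> in the directions \<open>w\<close> and \<open>\<i>w\<close> gives the Levi form of \<open>\<rho>\<close> at
  \<open>A w\<close>: the terms with \<open>F''\<close> cancel, as \<open>F''(\<i>w, \<i>w) = - F''(w, w)\<close>.\<close>

lemma boundary_levi_form:
  assumes \<rho>: "strongly_psc_defining_function \<rho> Z"
    and F: "smooth_on_open W F" "cball 0 1 \<subseteq> W" "\<And>x. x \<in> ball 0 1 \<Longrightarrow> complex_linear (frechet_derivative F (at x))"
    and FZ: "F ` sphere 0 1 \<subseteq> Z" and p: "norm p = 1"
  defines "A \<equiv> frechet_derivative F (at p)" and "u \<equiv> frechet_derivative \<rho> (at (F p)) (frechet_derivative F (at p) p) / 2"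
  assumes inj: "cdet A \<noteq> 0"
  shows "complex_linear A" "u > 0" "fefferman_M \<rho> (F p) = u ^ 3 / (cmod (cdet A))\<^sup>2"
proof -
  obtain N where N: "smooth_on_open N \<rho>" "Z = {q\<in>N. \<rho> q = 0}"
    using \<rho> unfolding strongly_psc_defining_function_def defining_function_def by blast
  have psc: "Re (levi_form \<rho> q w) > 0" if "q \<in> Z" "w \<noteq> 0" "(\<Sum>j\<in>UNIV. d_z j (\<lambda>q. of_real (\<rho> q)) q * (w $ j)) = 0" for q w
    using \<rho> that unfolding strongly_psc_defining_function_def by blast
  have S: "sphere 0 1 \<subseteq> W" using F(2) by auto
  have pW: "p \<in> W" "p \<in> closure (ball 0 1)" using F(2) p by auto
  have qZ: "F p \<in> Z" using FZ p by auto
  have qN: "F p \<in> N" using qZ N by auto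
  have bW: "ball 0 1 \<subseteq> W" using F(2) by auto
  note hb = holomorphic_boundary_derivatives[OF F(1) open_ball bW F(3) pW]
  show cl: "complex_linear A" unfolding A_def by (rule hb(1))
  hence Ai: "A (c *s v) = c *s A v" for c v by (simp add: complex_linear_def)
  define X where "X = W \<inter> F -` N"
  have X: "open X" unfolding X_def
    by (rule continuous_open_preimage[OF smooth_on_openD(4)[OF F(1)] smooth_on_openD(1)[OF F(1)] smooth_on_openD(1)[OF N(1)]])
  have R: "smooth_on_open X (\<lambda>x. \<rho> (F x))"
    by (rule smooth_on_open_compose[OF smooth_on_open_subset[OF F(1) X] N(1)]) (auto simp: X_def)
  have SX: "sphere 0 1 \<subseteq> X" using S FZ N by (auto simp: X_def)
  have R0: "\<rho> (F x) = 0" if "x \<in> sphere 0 1" for x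
  proof -
    have "F x \<in> Z" using FZ that by blast
    thus ?thesis using N(2) by simp
  qed
  note sc = second_derivative_compose[OF N(1) F(1) pW(1) qN]
  have tang: "frechet_derivative \<rho> (at (F p)) (A w) = 0" if "norm w = 1" "p \<bullet> w = 0" for w
    using vanishing_on_sphere_derivatives(1)[OF R SX R0 p that] sc(1) by (simp add: A_def)
  define B where "B v w = frechet_derivative (\<lambda>x. frechet_derivative \<rho> (at x) v) (at (F p)) w" for v w
  have second: "B (A w) (A w) + frechet_derivative \<rho> (at (F p)) (frechet_derivative (\<lambda>x. frechet_derivative F (at x) w) (at p) w) = 2 * u"
    if "norm w = 1" "p \<bullet> w = 0" for w
    using vanishing_on_sphere_derivatives(2)[OF R SX R0 p that] sc by (simp add: A_def B_def u_def)
  have lin: "linear (frechet_derivative \<rho> (at (F p)))" using has_derivative_linear[OF smooth_on_openD(2)[OF N(1) qN]] .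
  \<comment> \<open>Together with \<i> w this unit vector spans the complex tangent line of the
    sphere at p.\<close>
  define w :: "complex^2" where "w = vector [- cnj (p $ 2), cnj (p $ 1)]"
  have pn: "(cmod (p $ 1))\<^sup>2 + (cmod (p $ 2))\<^sup>2 = 1" using c2_norm[of p] p by simp
  have w1: "norm w = 1"
  proof -
    have "(norm w)\<^sup>2 = 1" using pn by (simp add: c2_norm w_def)
    thus ?thesis by (rule norm_eq_1I)
  qed
  have iw1: "norm (\<i> *s w) = 1"
  proof -
    have "(norm (\<i> *s w))\<^sup>2 = 1" using pn by (simp add: c2_norm w_def norm_mult)
    thus ?thesis by (rule norm_eq_1I)
  qed
  have pw: "p \<bullet> w = 0" "p \<bullet> (\<i> *s w) = 0" by (simp_all add: c2_inner w_def)
  have levi: "Re (levi_form \<rho> (F p) (A w)) = u"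
  proof -
    have "Re (levi_form \<rho> (F p) (A w)) = (B (A w) (A w) + B (A (\<i> *s w)) (A (\<i> *s w))) / 4"
      unfolding Re_levi_form[OF N(1) qN] B_def Ai ..
    moreover have "frechet_derivative \<rho> (at (F p)) (frechet_derivative (\<lambda>x. frechet_derivative F (at x) (\<i> *s w)) (at p) (\<i> *s w))
        = - frechet_derivative \<rho> (at (F p)) (frechet_derivative (\<lambda>x. frechet_derivative F (at x) w) (at p) w)"
      by (simp only: hb(2)[of w] linear_neg[OF lin])
    ultimately show ?thesis using second[OF w1 pw(1)] second[OF iw1 pw(2)] by simp
  qed
  define a1 a2 where a: "a1 = d_z 1 (\<lambda>q. of_real (\<rho> q)) (F p)" "a2 = d_z 2 (\<lambda>q. of_real (\<rho> q)) (F p)"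
  have real_form: "frechet_derivative \<rho> (at (F p)) v = 2 * Re (a1 * v $ 1 + a2 * v $ 2)" for v
    unfolding a by (rule real_form_wirtinger[OF N(1) qN])
  have zero_if: "a1 * A v $ 1 + a2 * A v $ 2 = 0" if "frechet_derivative \<rho> (at (F p)) (A v) = 0" "frechet_derivative \<rho> (at (F p)) (A (\<i> *s v)) = 0" for v
    using that unfolding real_form Ai by (simp add: complex_eq_iff algebra_simps)
  have aw: "a1 * A w $ 1 + a2 * A w $ 2 = 0"
    by (rule zero_if[OF tang[OF w1 pw(1)] tang[OF iw1 pw(2)]])
  have ap: "a1 * A p $ 1 + a2 * A p $ 2 = of_real u"
  proof -
    have ip: "norm (\<i> *s p) = 1"
    proof -
      have "(norm (\<i> *s p))\<^sup>2 = 1" using pn by (simp add: c2_norm norm_mult)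
      thus ?thesis by (rule norm_eq_1I)
    qed
    have "p \<bullet> (\<i> *s p) = 0" by (simp add: c2_inner algebra_simps)
    from tang[OF ip this] have "Im (a1 * A p $ 1 + a2 * A p $ 2) = 0"
      unfolding real_form Ai by (simp add: algebra_simps)
    moreover have "Re (a1 * A p $ 1 + a2 * A p $ 2) = u" unfolding u_def A_def[symmetric] real_form by simp
    ultimately show ?thesis by (simp add: complex_eq_iff)
  qed
  define A11 A21 A12 A22 where AA: "A11 = A (axis 1 1) $ 1" "A21 = A (axis 1 1) $ 2" "A12 = A (axis 2 1) $ 1" "A22 = A (axis 2 1) $ 2"
  have A1: "A v $ 1 = v $ 1 * A11 + v $ 2 * A12" and A2: "A v $ 2 = v $ 1 * A21 + v $ 2 * A22" for v
    unfolding AA by (rule complex_linear_expand[OF cl])+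
  have cd: "cdet A = A11 * A22 - A12 * A21" by (simp add: cdet_def AA)
  have pn': "p $ 1 * cnj (p $ 1) + p $ 2 * cnj (p $ 2) = 1"
    using pn by (metis complex_norm_square of_real_1 of_real_add)
  \<comment> \<open>The holomorphic differential of \<rho> composed with A is a row vector that
    vanishes on w and equals u at p, hence it is u times the conjugate of p.\<close>
  have g1: "a1 * A11 + a2 * A21 = of_real u * cnj (p $ 1)" and g2: "a1 * A12 + a2 * A22 = of_real u * cnj (p $ 2)"
  proof -
    define \<alpha> \<beta> where "\<alpha> = a1 * A11 + a2 * A21" and "\<beta> = a1 * A12 + a2 * A22"
    have 1: "\<alpha> * p $ 1 + \<beta> * p $ 2 = of_real u" using ap unfolding A1 A2 \<alpha>_def \<beta>_def by (simp add: algebra_simps)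
    have 2: "\<beta> * cnj (p $ 1) = \<alpha> * cnj (p $ 2)" using aw unfolding A1 A2 \<alpha>_def \<beta>_def w_def by (simp add: algebra_simps)
    have "\<alpha> = \<alpha> * (p $ 1 * cnj (p $ 1) + p $ 2 * cnj (p $ 2))" using pn' by simp
    also have "\<dots> = (\<alpha> * p $ 1) * cnj (p $ 1) + p $ 2 * (\<alpha> * cnj (p $ 2))" by (simp add: algebra_simps)
    also have "\<dots> = (\<alpha> * p $ 1 + \<beta> * p $ 2) * cnj (p $ 1)" unfolding 2[symmetric] by (simp add: algebra_simps)
    finally have *: "\<alpha> = of_real u * cnj (p $ 1)" unfolding 1 .
    have "\<beta> = \<beta> * (p $ 1 * cnj (p $ 1) + p $ 2 * cnj (p $ 2))" using pn' by simp
    also have "\<dots> = (\<beta> * cnj (p $ 1)) * p $ 1 + \<beta> * p $ 2 * cnj (p $ 2)" by (simp add: algebra_simps)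
    also have "\<dots> = (\<alpha> * p $ 1 + \<beta> * p $ 2) * cnj (p $ 2)" unfolding 2 by (simp add: algebra_simps)
    finally have "\<beta> = of_real u * cnj (p $ 2)" unfolding 1 .
    with * show "a1 * A11 + a2 * A21 = of_real u * cnj (p $ 1)" "a1 * A12 + a2 * A22 = of_real u * cnj (p $ 2)"
      by (simp_all add: \<alpha>_def \<beta>_def)
  qed
  \<comment> \<open>By Cramer's rule the vector in \<open>fefferman_M_levi_form\<close> is A w
    scaled by -u / cdet A; the Levi form u at A w then yields u^3 / |cdet A|^2.\<close>
  have "cdet A *s vector [a2, - a1] = (- of_real u) *s A w"
  proof -
    have "cdet A * a2 = A11 * (a1 * A12 + a2 * A22) - A12 * (a1 * A11 + a2 * A21)" by (simp add: cd algebra_simps)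
    also have "\<dots> = - of_real u * A w $ 1" unfolding g1 g2 A1 w_def by (simp add: algebra_simps)
    finally have 1: "cdet A * a2 = - of_real u * A w $ 1" .
    have "cdet A * - a1 = A21 * (a1 * A12 + a2 * A22) - A22 * (a1 * A11 + a2 * A21)" by (simp add: cd algebra_simps)
    also have "\<dots> = - of_real u * A w $ 2" unfolding g1 g2 A2 w_def by (simp add: algebra_simps)
    finally have 2: "cdet A * - a1 = - of_real u * A w $ 2" .
    show ?thesis using 1 2 by (simp add: c2_eq_iff)
  qed
  hence "of_real ((cmod (cdet A))\<^sup>2) * levi_form \<rho> (F p) (vector [a2, - a1]) = of_real (u\<^sup>2) * levi_form \<rho> (F p) (A w)"
    using levi_form_scale[of \<rho> "F p" "cdet A" "vector [a2, - a1]"] levi_form_scale[of \<rho> "F p" "- of_real u" "A w"]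
    by (simp flip: of_real_power)
  from arg_cong[OF this, of Re]
  have "(cmod (cdet A))\<^sup>2 * Re (levi_form \<rho> (F p) (vector [a2, - a1])) = u\<^sup>2 * Re (levi_form \<rho> (F p) (A w))"
    by (simp only: times_complex.sel Re_complex_of_real Im_complex_of_real mult_zero_left diff_zero)
  hence "(cmod (cdet A))\<^sup>2 * fefferman_M \<rho> (F p) = u ^ 3"
    unfolding levi fefferman_M_levi_form[OF N(1) qN] a by (simp add: power2_eq_square power3_eq_cube)
  thus "fefferman_M \<rho> (F p) = u ^ 3 / (cmod (cdet A))\<^sup>2" using inj by (simp add: field_simps)
  \<comment> \<open>A w is a complex tangent vector of Z; once it is nonzero, strong pseudoconvexity
    says that its Levi form u is positive.\<close>
  have "A w \<noteq> 0"
  proof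
    assume "A w = 0"
    hence e: "w $ 1 * A11 + w $ 2 * A12 = 0" "w $ 1 * A21 + w $ 2 * A22 = 0" using A1[of w] A2[of w] by simp_all
    have "cdet A * w $ 1 = (w $ 1 * A11 + w $ 2 * A12) * A22 - (w $ 1 * A21 + w $ 2 * A22) * A12" by (simp add: cd algebra_simps)
    hence "w $ 1 = 0" using e inj by simp
    have "cdet A * w $ 2 = (w $ 1 * A21 + w $ 2 * A22) * A11 - (w $ 1 * A11 + w $ 2 * A12) * A21" by (simp add: cd algebra_simps)
    hence "w $ 2 = 0" using e inj by simp
    with \<open>w $ 1 = 0\<close> have "w = 0" by (simp add: c2_eq_iff)
    thus False using w1 by simp
  qed
  from psc[OF qZ this] show "u > 0" using aw levi by (simp add: sum_2 a)
qed

section \<open>Smooth extensions of a biholomorphism and of its inverse\<close>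

text \<open>\<open>F\<close> extends the map and \<open>G\<close> its inverse, both smoothly to open
  sets. Complex linearity is demanded over the open ball and its image only, and G inverts F on the
  closed ball only: beyond these sets the extensions are arbitrary.\<close>

definition extended_biholomorphism ::
  "(complex^2 \<Rightarrow> complex^2) \<Rightarrow> (complex^2) set \<Rightarrow> (complex^2 \<Rightarrow> complex^2) \<Rightarrow> (complex^2) set \<Rightarrow> bool" where
  "extended_biholomorphism F W G V \<longleftrightarrow>
     smooth_on_open W F \<and> cball 0 1 \<subseteq> W \<and> (\<forall>x\<in>ball 0 1. complex_linear (frechet_derivative F (at x))) \<and>
     smooth_on_open V G \<and> F ` cball 0 1 \<subseteq> V \<and> (\<forall>x\<in>cball 0 1. G (F x) = x) \<and>
     open (F ` ball 0 1) \<and> (\<forall>y\<in>F ` ball 0 1. complex_linear (frechet_derivative G (at y)))"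

lemma extended_biholomorphismD:
  assumes "extended_biholomorphism F W G V"
  shows "smooth_on_open W F" "cball 0 1 \<subseteq> W" "\<And>x. x \<in> ball 0 1 \<Longrightarrow> complex_linear (frechet_derivative F (at x))"
    "smooth_on_open V G" "F ` cball 0 1 \<subseteq> V" "\<And>x. norm x \<le> 1 \<Longrightarrow> G (F x) = x"
    "open (F ` ball 0 1)" "\<And>y. y \<in> F ` ball 0 1 \<Longrightarrow> complex_linear (frechet_derivative G (at y))"
  using assms unfolding extended_biholomorphism_def by auto

text \<open>At a boundary point \<open>d\<close> is known on one side only, but the directions q - p
  of segments into the ball span the space, and the one-sided derivative along each of them is
  0.\<close>

lemma derivative_zero_on_cball:
  fixes d :: "'a::euclidean_space \<Rightarrow> 'b::real_normed_vector"
  assumes L: "(d has_derivative L) (at p)" and p: "p \<in> cball 0 1" and d0: "\<And>x. x \<in> cball 0 1 \<Longrightarrow> d x = 0"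
  shows "L v = 0"
proof -
  interpret L: bounded_linear L using L by (rule has_derivative_bounded_linear)
  have Lq: "L (q - p) = 0" if q: "q \<in> cball 0 1" for q
  proof -
    define l where "l t = p + t *\<^sub>R (q - p)" for t :: real
    have "(l has_derivative (\<lambda>t. t *\<^sub>R (q - p))) (at 0 within {0..1})"
      unfolding l_def by (auto intro!: derivative_eq_intros)
    moreover have "(d has_derivative L) (at (l 0))" using L by (simp add: l_def)
    ultimately have "((\<lambda>t. d (l t)) has_derivative (\<lambda>t. L (t *\<^sub>R (q - p)))) (at 0 within {0..1})"
      by (rule has_derivative_compose)
    hence 1: "((\<lambda>t. d (l t)) has_vector_derivative L (q - p)) (at 0 within {0..1})"
      by (simp add: has_vector_derivative_def L.scaleR)
    have "l t \<in> cball 0 1" if "t \<in> {0..1}" for t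
    proof -
      have "l t = (1 - t) *\<^sub>R p + t *\<^sub>R q" by (simp add: l_def algebra_simps)
      thus ?thesis using convexD_alt[OF convex_cball p q, of t] that by simp
    qed
    hence "((\<lambda>t. d (l t)) has_vector_derivative 0) (at 0 within {0..1})"
      by (intro has_vector_derivative_transform[OF _ _ has_vector_derivative_const]) (auto simp: d0)
    with 1 show ?thesis
      using vector_derivative_unique_within_closed_interval[of 0 1 0 "\<lambda>t. d (l t)" "L (q - p)" 0] by simp
  qed
  \<comment> \<open>The point q = c v lies in the ball; comparison with q = 0 isolates L (c
    v).\<close>
  define c where "c = 1 / (norm v + 1)"
  have c: "c > 0" by (simp add: c_def add_nonneg_pos)
  have "c *\<^sub>R v \<in> cball 0 1" by (simp add: c_def divide_le_eq add_nonneg_pos)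
  from Lq[OF this] Lq[of 0] have "L (c *\<^sub>R v) = 0" by (simp add: L.diff L.neg)
  thus ?thesis using c by (simp add: L.scaleR)
qed

lemma extended_biholomorphism_inverse_derivative:
  assumes "extended_biholomorphism F W G V" and p: "norm p \<le> 1"
  shows "frechet_derivative G (at (F p)) (frechet_derivative F (at p) v) = v"
proof -
  note E = extended_biholomorphismD[OF assms(1)]
  have pc: "p \<in> cball 0 1" using p by simp
  have "((\<lambda>x. G (F x) - x) has_derivative (\<lambda>v. frechet_derivative G (at (F p)) (frechet_derivative F (at p) v) - v)) (at p)"
    by (intro has_derivative_diff has_derivative_compose[OF smooth_on_openD(2)[OF E(1)] smooth_on_openD(2)[OF E(4)]] has_derivative_ident)
       (use E(2,5) pc in auto)
  from derivative_zero_on_cball[OF this pc, of v] show ?thesis by (simp add: E(6))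
qed

lemma cdet_nonzero_iff_inj:
  assumes "complex_linear A" "\<And>v. A v = 0 \<Longrightarrow> v = 0"
  shows "cdet A \<noteq> 0"
proof
  assume c0: "cdet A = 0"
  define a b c d where abcd: "a = A (axis 1 1) $ 1" "b = A (axis 2 1) $ 1" "c = A (axis 1 1) $ 2" "d = A (axis 2 1) $ 2"
  have e: "A v $ 1 = v $ 1 * a + v $ 2 * b" "A v $ 2 = v $ 1 * c + v $ 2 * d" for v
    unfolding abcd by (rule complex_linear_expand[OF assms(1)])+
  have ad: "a * d = b * c" using c0 by (simp add: cdet_def abcd)
  \<comment> \<open>Up to sign these are the columns of the adjugate, which A annihilates when its
    determinant is 0.\<close>
  have "A (vector [b, - a]) = 0" "A (vector [d, - c]) = 0"
    unfolding c2_eq_iff e using ad by (simp_all add: algebra_simps)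
  from assms(2)[OF this(1)] assms(2)[OF this(2)] have "a = 0" "b = 0" "c = 0" "d = 0"
    by (simp_all add: c2_eq_iff)
  hence "A (axis 1 1) = 0" by (simp add: c2_eq_iff abcd)
  from assms(2)[OF this] show False by (simp add: axis_eq_0_iff)
qed

lemma extended_biholomorphism_cdet:
  assumes E: "extended_biholomorphism F W G V" and p: "norm p \<le> 1"
  shows "complex_linear (frechet_derivative F (at p))" "cdet (frechet_derivative F (at p)) \<noteq> 0"
proof -
  note E' = extended_biholomorphismD[OF E]
  have b: "ball 0 1 \<subseteq> W" using E'(2) by auto
  show cl: "complex_linear (frechet_derivative F (at p))"
    by (rule holomorphic_boundary_derivatives(1)[OF E'(1) open_ball b E'(3)]) (use p E'(2) in auto)
  have pV: "F p \<in> V" using E'(5) p by auto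
  have G0: "frechet_derivative G (at (F p)) 0 = 0"
    using has_derivative_linear[OF smooth_on_openD(2)[OF E'(4) pV]] by (rule linear_0)
  show "cdet (frechet_derivative F (at p)) \<noteq> 0"
  proof (rule cdet_nonzero_iff_inj[OF cl])
    fix v assume "frechet_derivative F (at p) v = 0"
    thus "v = 0" using extended_biholomorphism_inverse_derivative[OF E p, of v] G0 by simp
  qed
qed

text \<open>Taking A p as fourth vector in the defining equation leaves one term of the wedge, as
  d\<rho> vanishes on the other three. That term is \<sigma> times 2 u, and the cube root of
  \<open>fefferman_M\<close> contributes a factor u as well, so u, the only trace of \<rho>,
  cancels. The exponent is 2 - 2/3 = 4/3, and the constant 2^(4/3) / 2 = 2^(1/3).\<close>

lemma fefferman_form_tangent:
  assumes \<rho>: "strongly_psc_defining_function \<rho> Z" and \<sigma>: "fefferman_form \<rho> Z \<sigma>"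
    and E: "extended_biholomorphism F W G V" and Z: "Z = F ` sphere 0 1" and p: "norm p = 1"
  defines "A \<equiv> frechet_derivative F (at p)"
  assumes tang: "frechet_derivative \<rho> (at (F p)) (A v1) = 0" "frechet_derivative \<rho> (at (F p)) (A v2) = 0" "frechet_derivative \<rho> (at (F p)) (A v3) = 0"
  shows "\<sigma> (F p) (A v1) (A v2) (A v3) = 2 powr (1/3) * cmod (cdet A) powr (4/3) * vol_form v1 v2 v3 p"
proof -
  note E' = extended_biholomorphismD[OF E]
  have d: "cmod (cdet A) > 0" and cl: "complex_linear A"
    using extended_biholomorphism_cdet[OF E] p by (auto simp: A_def)
  define u where "u = frechet_derivative \<rho> (at (F p)) (A p) / 2"
  have u: "u > 0" "fefferman_M \<rho> (F p) = u ^ 3 / (cmod (cdet A))\<^sup>2"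
    using boundary_levi_form[OF \<rho> E'(1,2,3) _ p] Z d by (auto simp: A_def u_def)
  have "wedge31 (\<sigma> (F p)) (frechet_derivative \<rho> (at (F p))) (A v1) (A v2) (A v3) (A p)
     = 2 powr (4/3) * fefferman_M \<rho> (F p) powr (1/3) * vol_form (A v1) (A v2) (A v3) (A p)"
    using \<sigma> Z p unfolding fefferman_form_def by auto
  hence "\<sigma> (F p) (A v1) (A v2) (A v3) * (2 * u)
     = 2 powr (4/3) * (u ^ 3 / (cmod (cdet A))\<^sup>2) powr (1/3) * ((cmod (cdet A))\<^sup>2 * vol_form v1 v2 v3 p)"
    unfolding wedge31_def tang u(2) vol_form_complex_linear[OF cl] by (simp add: u_def)
  also have "(u ^ 3 / (cmod (cdet A))\<^sup>2) powr (1/3) = u / cmod (cdet A) powr (2/3)"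
  proof -
    have "(u ^ 3) powr (1/3) = u" using u(1) by (simp add: powr_powr flip: powr_numeral)
    moreover have "((cmod (cdet A))\<^sup>2) powr (1/3) = cmod (cdet A) powr (2/3)" using d by (simp add: powr_powr flip: powr_numeral)
    ultimately show ?thesis using u(1) d by (simp add: powr_divide)
  qed
  also have "2 powr (4/3) = 2 * 2 powr (1/3 :: real)" using powr_add[of 2 1 "1/3 :: real"] by simp
  finally have "\<sigma> (F p) (A v1) (A v2) (A v3) * (2 * u)
     = (2 powr (1/3) * ((cmod (cdet A))\<^sup>2 / cmod (cdet A) powr (2/3)) * vol_form v1 v2 v3 p) * (2 * u)"
    by simp
  hence "\<sigma> (F p) (A v1) (A v2) (A v3) = 2 powr (1/3) * ((cmod (cdet A))\<^sup>2 / cmod (cdet A) powr (2/3)) * vol_form v1 v2 v3 p"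
    by (rule mult_right_cancel[THEN iffD1, rotated]) (use u(1) in simp)
  also have "(cmod (cdet A))\<^sup>2 / cmod (cdet A) powr (2/3) = cmod (cdet A) powr (4/3)"
    using d powr_diff[of "cmod (cdet A)" 2 "2/3"] by simp
  finally show ?thesis .
qed

text \<open>The chart is carried back to the unit sphere by G. As \<rho> vanishes along the chart,
  its partial derivatives are tangent vectors, and \<open>fefferman_form_tangent\<close> applies to
  their preimages.\<close>

lemma positive_chart_pullback:
  assumes \<rho>: "strongly_psc_defining_function \<rho> Z" and \<sigma>: "fefferman_form \<rho> Z \<sigma>"
    and E: "extended_biholomorphism F W G V" and Z: "Z = F ` sphere 0 1"
    and \<phi>: "smooth_on_open U \<phi>" "\<phi> ` U \<subseteq> Z" and t: "t \<in> U"
  defines "\<psi> \<equiv> \<lambda>t. G (\<phi> t)"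
  shows "norm (\<psi> t) = 1" "F (\<psi> t) = \<phi> t" "(\<psi> has_derivative frechet_derivative \<psi> (at t)) (at t)"
    "pullback3 \<sigma> \<phi> t = 2 powr (1/3) * cmod (cdet (frechet_derivative F (at (\<psi> t)))) powr (4/3) *
       vol_form (frechet_derivative \<psi> (at t) (axis 1 1)) (frechet_derivative \<psi> (at t) (axis 2 1)) (frechet_derivative \<psi> (at t) (axis 3 1)) (\<psi> t)"
proof -
  note E' = extended_biholomorphismD[OF E]
  have ZV: "Z \<subseteq> V" using E'(5) Z by auto
  have n: "norm (\<psi> s) = 1 \<and> F (\<psi> s) = \<phi> s" if "s \<in> U" for s
  proof -
    have "\<phi> s \<in> Z" using \<phi>(2) that by auto
    then obtain p where p: "norm p = 1" "\<phi> s = F p" using Z by auto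
    thus ?thesis using E'(6)[of p] by (simp add: \<psi>_def)
  qed
  show n1: "norm (\<psi> t) = 1" and n2: "F (\<psi> t) = \<phi> t" using n[OF t] by auto
  have sm: "smooth_on_open U \<psi>" unfolding \<psi>_def
    by (rule smooth_on_open_compose[OF \<phi>(1) E'(4)]) (use \<phi>(2) ZV in auto)
  note dpsi = smooth_on_openD(2)[OF sm t]
  show "(\<psi> has_derivative frechet_derivative \<psi> (at t)) (at t)" by (rule dpsi)
  have pW: "\<psi> t \<in> W" using E'(2) n1 by auto
  have "((\<lambda>s. F (\<psi> s)) has_derivative (\<lambda>h. frechet_derivative F (at (\<psi> t)) (frechet_derivative \<psi> (at t) h))) (at t)"
    by (rule has_derivative_compose[OF dpsi smooth_on_openD(2)[OF E'(1) pW]])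
  hence "(\<phi> has_derivative (\<lambda>h. frechet_derivative F (at (\<psi> t)) (frechet_derivative \<psi> (at t) h))) (at t)"
    by (rule has_derivative_transform_within_open[OF _ smooth_on_openD(1)[OF \<phi>(1)] t]) (use n in auto)
  hence D\<phi>: "frechet_derivative \<phi> (at t) = (\<lambda>h. frechet_derivative F (at (\<psi> t)) (frechet_derivative \<psi> (at t) h))"
    by (rule frechet_derivative_eqI)
  obtain N where N: "smooth_on_open N \<rho>" "Z = {q\<in>N. \<rho> q = 0}"
    using \<rho> unfolding strongly_psc_defining_function_def defining_function_def by blast
  have \<phi>Z: "\<phi> s \<in> Z" if "s \<in> U" for s using \<phi>(2) that by auto
  have qN: "\<phi> t \<in> N" using \<phi>Z[OF t] N by auto
  have tang: "frechet_derivative \<rho> (at (\<phi> t)) (frechet_derivative \<phi> (at t) h) = 0" for h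
  proof -
    have 1: "((\<lambda>s. \<rho> (\<phi> s)) has_derivative (\<lambda>h. frechet_derivative \<rho> (at (\<phi> t)) (frechet_derivative \<phi> (at t) h))) (at t)"
      by (rule has_derivative_compose[OF smooth_on_openD(2)[OF \<phi>(1) t] smooth_on_openD(2)[OF N(1) qN]])
    have "((\<lambda>s. \<rho> (\<phi> s)) has_derivative (\<lambda>h. 0)) (at t)"
    proof (rule has_derivative_transform_within_open[OF _ smooth_on_openD(1)[OF \<phi>(1)] t])
      fix s assume "s \<in> U"
      hence "\<phi> s \<in> Z" by (rule \<phi>Z)
      thus "0 = \<rho> (\<phi> s)" using N(2) by simp
    qed simp
    from has_derivative_unique[OF 1 this] show ?thesis by metis
  qed
  show "pullback3 \<sigma> \<phi> t = 2 powr (1/3) * cmod (cdet (frechet_derivative F (at (\<psi> t)))) powr (4/3) *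
       vol_form (frechet_derivative \<psi> (at t) (axis 1 1)) (frechet_derivative \<psi> (at t) (axis 2 1)) (frechet_derivative \<psi> (at t) (axis 3 1)) (\<psi> t)"
    using fefferman_form_tangent[OF \<rho> \<sigma> E Z n1, of "frechet_derivative \<psi> (at t) (axis 1 1)" "frechet_derivative \<psi> (at t) (axis 2 1)" "frechet_derivative \<psi> (at t) (axis 3 1)"]
      tang unfolding pullback3_def D\<phi> n2 by simp
qed


section \<open>The integral over the boundary as an integral over the ball\<close>

definition r4 :: "(real^3) \<times> real \<Rightarrow> real^4" where
  "r4 = (\<lambda>(t, r). vector [t $ 1, t $ 2, t $ 3, r])"

definition r3 :: "real^4 \<Rightarrow> real^3" where
  "r3 x = vector [x $ 1, x $ 2, x $ 3]"

lemma r4_nth [simp]: "r4 p $ 1 = fst p $ 1" "r4 p $ 2 = fst p $ 2" "r4 p $ 3 = fst p $ 3" "r4 p $ 4 = snd p"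
  by (cases p; simp add: r4_def)+

lemma r3_nth [simp]: "r3 x $ 1 = x $ 1" "r3 x $ 2 = x $ 2" "r3 x $ 3 = x $ 3"
  by (simp_all add: r3_def)

lemma r3_r4 [simp]: "r3 (r4 p) = fst p"
  by (simp add: vec_eq_iff forall_3)

lemma linear_r4: "linear r4"
  by (rule linearI) (auto simp: vec_eq_iff forall_4)

lemma bounded_linear_r3: "bounded_linear r3"
  unfolding linear_conv_bounded_linear[symmetric] by (rule linearI) (auto simp: vec_eq_iff forall_3)

lemma bij_r4: "bij_betw r4 Basis Basis"
proof (rule bij_betwI[where g = "\<lambda>x. (r3 x, x $ 4)"])
  show "r4 \<in> Basis \<rightarrow> Basis"
  proof (rule Pi_I)
    fix p :: "(real^3) \<times> real" assume "p \<in> Basis"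
    then consider i where "p = (axis i 1, 0)" | "p = (0, 1)"
      by (auto simp: Basis_prod_def Basis_vec_def)
    thus "r4 p \<in> Basis"
    proof cases
      case 1
      have "i = 1 \<or> i = 2 \<or> i = 3" by (rule exhaust_3)
      hence "r4 p = axis 1 1 \<or> r4 p = axis 2 1 \<or> r4 p = axis 3 1"
        unfolding 1 vec_eq_iff forall_4 by (auto simp: axis_def)
      thus ?thesis by auto
    next
      case 2
      hence "r4 p = axis 4 1" unfolding 2 vec_eq_iff forall_4 by (auto simp: axis_def)
      thus ?thesis by simp
    qed
  qed
  show "(\<lambda>x. (r3 x, x $ 4)) \<in> Basis \<rightarrow> Basis"
  proof (rule Pi_I)
    fix x :: "real^4" assume "x \<in> Basis"
    then obtain i where x: "x = axis i 1" by (auto simp: Basis_vec_def)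
    have "i = 1 \<or> i = 2 \<or> i = 3 \<or> i = 4" by (rule exhaust_4)
    hence "(r3 x, x $ 4) = (axis 1 1, 0) \<or> (r3 x, x $ 4) = (axis 2 1, 0) \<or> (r3 x, x $ 4) = (axis 3 1, 0) \<or> (r3 x, x $ 4) = (0, 1)"
      unfolding x prod_eq_iff vec_eq_iff forall_3 by (auto simp: axis_def)
    thus "(r3 x, x $ 4) \<in> Basis" by (auto simp: Basis_prod_def)
  qed
qed (auto simp: vec_eq_iff forall_4 forall_3)

lemma nn_integral_r4:
  assumes [measurable]: "f \<in> borel_measurable borel"
  shows "(\<integral>\<^sup>+x. f x \<partial>lborel) = (\<integral>\<^sup>+t. \<integral>\<^sup>+r. f (r4 (t, r)) \<partial>lborel \<partial>lborel)"
proof -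
  have [measurable]: "r4 \<in> borel \<rightarrow>\<^sub>M borel"
    using linear_r4 by (intro borel_measurable_continuous_onI linear_continuous_on) (simp add: linear_conv_bounded_linear[symmetric])
  have "(\<integral>\<^sup>+x. f x \<partial>lborel) = (\<integral>\<^sup>+p. f (r4 p) \<partial>lborel)"
    by (subst lborel_distr_basis_bij[OF linear_r4 bij_r4, symmetric], subst nn_integral_distr) simp_all
  also have "\<dots> = (\<integral>\<^sup>+p. f (r4 p) \<partial>(lborel \<Otimes>\<^sub>M lborel))" by (simp add: lborel_prod)
  finally show ?thesis by (subst lborel.nn_integral_fst) (simp_all add: lborel_prod)
qed

definition radial_cone :: "(real^3 \<Rightarrow> complex^2) \<Rightarrow> (real^3) set \<Rightarrow> (complex^2) set" where
  "radial_cone \<psi> A = {r *\<^sub>R \<psi> t | r t. 0 < r \<and> r < 1 \<and> t \<in> A}"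

text \<open>The map (t, r) -> r \<psi>(t) has determinant r^3 times the volume form of the three
  derivatives of \<psi> and \<psi> itself. As \<open>h\<close> is constant along radii, the integral
  in r is that of r^3 over (0,1), whence the factor 1/4.\<close>

lemma cone_change_of_variables:
  fixes \<psi> :: "real^3 \<Rightarrow> complex^2" and h :: "complex^2 \<Rightarrow> real"
  assumes A: "A \<in> sets borel"
    and \<psi>: "\<And>t. t \<in> A \<Longrightarrow> (\<psi> has_derivative \<psi>' t) (at t)" and inj: "inj_on \<psi> A" and n: "\<And>t. t \<in> A \<Longrightarrow> norm (\<psi> t) = 1"
    and h: "\<And>r t. 0 < r \<Longrightarrow> t \<in> A \<Longrightarrow> h (r *\<^sub>R \<psi> t) = h (\<psi> t)"
    and P: "\<And>t. t \<in> A \<Longrightarrow> P t = h (\<psi> t) * vol_form (\<psi>' t (axis 1 1)) (\<psi>' t (axis 2 1)) (\<psi>' t (axis 3 1)) (\<psi> t)"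
    and Ppos: "\<And>t. t \<in> A \<Longrightarrow> P t > 0" and hpos: "\<And>t. t \<in> A \<Longrightarrow> h (\<psi> t) > 0" and int: "set_integrable lborel A P"
  shows "h absolutely_integrable_on radial_cone \<psi> A" "integral (radial_cone \<psi> A) h = set_lebesgue_integral lborel A P / 4"
proof -
  define S where "S = {x. r3 x \<in> A \<and> 0 < x $ 4 \<and> x $ 4 < 1}"
  define K where "K x = x $ 4 *\<^sub>R \<psi> (r3 x)" for x
  define K' where "K' x y = y $ 4 *\<^sub>R \<psi> (r3 x) + x $ 4 *\<^sub>R \<psi>' (r3 x) (r3 y)" for x y
  have [measurable]: "r3 \<in> borel \<rightarrow>\<^sub>M borel"
    by (intro borel_measurable_continuous_onI linear_continuous_on bounded_linear_r3)
  have [measurable]: "(\<lambda>x::real^4. x $ 4) \<in> borel \<rightarrow>\<^sub>M borel"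
    by (intro borel_measurable_continuous_onI continuous_intros)
  note A[measurable]
  have Sb: "S \<in> sets borel" unfolding S_def by measurable
  hence S: "S \<in> sets lebesgue" by simp
  have K: "(K has_derivative K' x) (at x)" if "x \<in> S" for x
  proof -
    have r: "(r3 has_derivative r3) (at x)" by (rule bounded_linear_imp_has_derivative[OF bounded_linear_r3])
    have "((\<lambda>x. \<psi> (r3 x)) has_derivative (\<lambda>y. \<psi>' (r3 x) (r3 y))) (at x)"
      by (rule has_derivative_compose[OF r \<psi>]) (use that in \<open>simp add: S_def\<close>)
    moreover have "((\<lambda>x::real^4. x $ 4) has_derivative (\<lambda>y. y $ 4)) (at x)"
      by (intro bounded_linear_imp_has_derivative bounded_linear_vec_nth)
    ultimately have "((\<lambda>x. x $ 4 *\<^sub>R \<psi> (r3 x)) has_derivative (\<lambda>y. x $ 4 *\<^sub>R \<psi>' (r3 x) (r3 y) + y $ 4 *\<^sub>R \<psi> (r3 x))) (at x)"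
      by (intro has_derivative_scaleR)
    thus ?thesis unfolding K_def K'_def by (simp add: add.commute)
  qed
  define g where "g = real_coords \<circ> K"
  define g' where "g' x = real_coords \<circ> K' x" for x
  have g: "(g has_derivative g' x) (at x within S)" if "x \<in> S" for x
    unfolding g_def g'_def
    by (rule has_derivative_at_withinI, rule diff_chain_at[OF K[OF that]])
       (rule bounded_linear_imp_has_derivative[OF bounded_linear_real_coords(1)])
  have detg: "\<bar>det (matrix (g' x))\<bar> * h (of_real_coords (g x)) = (x $ 4) ^ 3 * P (r3 x)" if x: "x \<in> S" for x
  proof -
    define t where "t = r3 x"
    have t: "t \<in> A" and r: "x $ 4 > 0" using x by (auto simp: S_def t_def)
    have l: "linear (\<psi>' t)" using has_derivative_linear[OF \<psi>[OF t]] .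
    have K'ax: "K' x (axis 1 1) = x $ 4 *\<^sub>R \<psi>' t (axis 1 1)" "K' x (axis 2 1) = x $ 4 *\<^sub>R \<psi>' t (axis 2 1)"
      "K' x (axis 3 1) = x $ 4 *\<^sub>R \<psi>' t (axis 3 1)" "K' x (axis 4 1) = \<psi> t"
    proof -
      have "r3 (axis 1 1) = axis 1 1" "r3 (axis 2 1) = axis 2 1" "r3 (axis 3 1) = axis 3 1" "r3 (axis 4 1) = 0"
        by (simp_all add: vec_eq_iff forall_3 axis_def)
      thus "K' x (axis 1 1) = x $ 4 *\<^sub>R \<psi>' t (axis 1 1)" "K' x (axis 2 1) = x $ 4 *\<^sub>R \<psi>' t (axis 2 1)"
        "K' x (axis 3 1) = x $ 4 *\<^sub>R \<psi>' t (axis 3 1)" "K' x (axis 4 1) = \<psi> t"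
        using linear_0[OF l] by (simp_all add: K'_def t_def[symmetric] axis_def)
    qed
    have "transpose (matrix (g' x)) = vector [real_coords (K' x (axis 1 1)), real_coords (K' x (axis 2 1)), real_coords (K' x (axis 3 1)), real_coords (K' x (axis 4 1))]"
      unfolding vec_eq_iff forall_4 by (simp add: transpose_def matrix_def g'_def)
    hence "det (matrix (g' x)) = vol_form (K' x (axis 1 1)) (K' x (axis 2 1)) (K' x (axis 3 1)) (K' x (axis 4 1))"
      unfolding vol_form_def by (metis det_transpose)
    also have "\<dots> = (x $ 4) ^ 3 * vol_form (\<psi>' t (axis 1 1)) (\<psi>' t (axis 2 1)) (\<psi>' t (axis 3 1)) (\<psi> t)"
      unfolding K'ax vol_form_def det_4 by (simp add: power3_eq_cube algebra_simps)
    finally have d: "det (matrix (g' x)) = (x $ 4) ^ 3 * vol_form (\<psi>' t (axis 1 1)) (\<psi>' t (axis 2 1)) (\<psi>' t (axis 3 1)) (\<psi> t)" .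
    have "0 < h (\<psi> t) * vol_form (\<psi>' t (axis 1 1)) (\<psi>' t (axis 2 1)) (\<psi>' t (axis 3 1)) (\<psi> t)"
      using Ppos[OF t] P[OF t] by simp
    hence vp: "vol_form (\<psi>' t (axis 1 1)) (\<psi>' t (axis 2 1)) (\<psi>' t (axis 3 1)) (\<psi> t) > 0"
      using hpos[OF t] by (simp add: zero_less_mult_iff)
    have "h (of_real_coords (g x)) = h (\<psi> t)" using h[OF r t] by (simp add: g_def K_def t_def)
    thus ?thesis unfolding d using r vp P[OF t] by (simp add: abs_mult t_def)
  qed
  have injg: "inj_on g S"
  proof (rule inj_onI)
    fix x y assume xy: "x \<in> S" "y \<in> S" "g x = g y"
    hence "of_real_coords (g x) = of_real_coords (g y)" by simp
    hence K: "K x = K y" by (simp add: g_def)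
    have "norm (K x) = x $ 4" "norm (K y) = y $ 4" using xy n by (auto simp: K_def S_def)
    hence 4: "x $ 4 = y $ 4" using K by simp
    hence "\<psi> (r3 x) = \<psi> (r3 y)" using K xy by (simp add: K_def S_def)
    hence "r3 x = r3 y" using inj xy by (auto simp: inj_on_def S_def)
    thus "x = y" using 4 by (auto simp: vec_eq_iff forall_4 forall_3)
  qed
  have im: "g ` S = real_coords ` radial_cone \<psi> A"
  proof -
    have "K ` S = radial_cone \<psi> A"
    proof (intro equalityI subsetI)
      fix z assume "z \<in> radial_cone \<psi> A"
      then obtain r t where "0 < r" "r < 1" "t \<in> A" "z = r *\<^sub>R \<psi> t" by (auto simp: radial_cone_def)
      thus "z \<in> K ` S" by (intro image_eqI[of _ _ "r4 (t, r)"]) (auto simp: K_def S_def)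
    qed (auto simp: K_def S_def radial_cone_def)
    thus ?thesis unfolding g_def image_comp[symmetric] by simp
  qed
  have Pm[measurable]: "(\<lambda>t. indicator A t * P t) \<in> borel_measurable borel"
    using int by (auto simp: set_integrable_def dest: borel_measurable_integrable)
  define I where "I = set_lebesgue_integral lborel A P"
  have nnP: "(\<integral>\<^sup>+t. ennreal (indicator A t * P t) \<partial>lborel) = ennreal I"
    unfolding I_def set_lebesgue_integral_def real_scaleR_def
    by (rule nn_integral_eq_integral) (use int Ppos in \<open>auto simp: set_integrable_def indicator_def less_imp_le\<close>)
  have I0: "I \<ge> 0" unfolding I_def set_lebesgue_integral_def
    by (rule integral_nonneg_AE) (use Ppos in \<open>auto simp: indicator_def less_imp_le\<close>)
  define Q where "Q x = (x $ 4) ^ 3 * P (r3 x)" for x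
  have eqQ: "indicator S x * Q x = (indicator A (r3 x) * P (r3 x)) * (indicator {0<..<1} (x $ 4) * (x $ 4) ^ 3)" for x
    by (auto simp: Q_def S_def indicator_def)
  have Qm: "(\<lambda>x. indicator S x * Q x) \<in> borel_measurable borel"
    unfolding eqQ by (intro borel_measurable_times measurable_compose[OF _ Pm]) measurable
  have Q0: "0 \<le> indicator S x * Q x" for x
    using Ppos by (auto simp: Q_def S_def indicator_def less_imp_le)
  have "(\<integral>\<^sup>+x. ennreal (indicator S x * Q x) \<partial>lborel) = (\<integral>\<^sup>+t. \<integral>\<^sup>+r. ennreal (indicator A t * P t) * ennreal (indicator {0<..<1} r * r ^ 3) \<partial>lborel \<partial>lborel)"
    unfolding nn_integral_r4[OF measurable_compose[OF Qm measurable_ennreal]] unfolding eqQ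
    by (intro nn_integral_cong) (auto simp: indicator_def less_imp_le[OF Ppos] simp flip: ennreal_mult)
  also have "\<dots> = (\<integral>\<^sup>+t. ennreal (indicator A t * P t) * ennreal (1/4) \<partial>lborel)"
  proof (intro nn_integral_cong)
    fix t
    have "((\<lambda>r::real. r ^ 3) has_integral 1/4) {0<..<1}"
      using has_integral_beta_nat[of 3 0] by (simp add: has_integral_Icc_iff_Ioo mono_wt_def fact_numeral)
    hence "(\<integral>\<^sup>+r. ennreal (indicator {0<..<1} r * r ^ 3) \<partial>lborel) = ennreal (1/4)"
      by (intro nn_integral_has_integral_lebesgue) auto
    thus "(\<integral>\<^sup>+r. ennreal (indicator A t * P t) * ennreal (indicator {0<..<1} r * r ^ 3) \<partial>lborel) = ennreal (indicator A t * P t) * ennreal (1/4)"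
      by (subst nn_integral_cmult) auto
  qed
  also have "\<dots> = ennreal (I / 4)"
    using I0 by (subst nn_integral_multc) (auto simp: nnP simp flip: ennreal_mult)
  finally have "has_bochner_integral lborel (\<lambda>x. indicator S x * Q x) (I / 4)"
    by (intro has_bochner_integral_nn_integral) (use Qm Q0 I0 in auto)
  hence Qi: "integrable lebesgue (\<lambda>x. indicator S x * Q x)" "integral\<^sup>L lebesgue (\<lambda>x. indicator S x * Q x) = I / 4"
    using Qm by (auto simp: has_bochner_integral_iff integrable_completion integral_completion)
  hence ai: "Q absolutely_integrable_on S" by (simp add: set_integrable_def)
  have Qint: "integral S Q = I / 4"
    using set_lebesgue_integral_eq_integral(2)[OF ai] Qi(2) by (simp add: set_lebesgue_integral_def)
  have "(\<lambda>x. \<bar>det (matrix (g' x))\<bar> * h (of_real_coords (g x))) absolutely_integrable_on S"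
    using ai by (rule set_integrable_cong[THEN iffD1, rotated 3]) (auto simp: detg Q_def)
  moreover have "integral S (\<lambda>x. \<bar>det (matrix (g' x))\<bar> * h (of_real_coords (g x))) = I / 4"
    unfolding Qint[symmetric] by (rule integral_cong) (auto simp: detg Q_def)
  ultimately have "(\<lambda>y. h (of_real_coords y)) absolutely_integrable_on g ` S \<and> integral (g ` S) (\<lambda>y. h (of_real_coords y)) = I / 4"
    using real_change_of_variables_vec1[OF S g injg, of "\<lambda>y. h (of_real_coords y)" "I / 4"] by blast
  hence "h absolutely_integrable_on radial_cone \<psi> A \<and> integral (radial_cone \<psi> A) h = I / 4"
    unfolding im real_coords_change_of_variables_iff by simp
  thus "h absolutely_integrable_on radial_cone \<psi> A" "integral (radial_cone \<psi> A) h = set_lebesgue_integral lborel A P / 4"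
    by (auto simp: I_def)
qed

lemma jacobian_continuous:
  assumes "extended_biholomorphism F W G V"
  shows "continuous_on W (\<lambda>x. cdet (frechet_derivative F (at x)))"
  unfolding cdet_def
  by (intro continuous_intros smooth_on_openD(4)[OF smooth_on_openD(3)[OF extended_biholomorphismD(1)[OF assms]]])

text \<open>The density |g|^(4/3) of Fefferman's measure over the unit sphere, without the factor
  2^(1/3), extended constantly along radii. At the origin division by zero makes the argument 0, a
  single point.\<close>

definition radial_jacobian :: "(complex^2 \<Rightarrow> complex^2) \<Rightarrow> complex^2 \<Rightarrow> real" where
  "radial_jacobian F z = cmod (cdet (frechet_derivative F (at ((1 / norm z) *\<^sub>R z)))) powr (4/3)"

lemma radial_jacobian_integrable:
  assumes E: "extended_biholomorphism F W G V"
  shows "radial_jacobian F absolutely_integrable_on ball 0 1"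
proof -
  note E' = extended_biholomorphismD[OF E]
  define c where "c x = cmod (cdet (frechet_derivative F (at x))) powr (4/3)" for x
  have cc: "continuous_on (cball 0 1) c"
    unfolding c_def using extended_biholomorphism_cdet(2)[OF E] E'(2)
    by (intro continuous_on_powr continuous_on_norm continuous_on_const continuous_on_subset[OF jacobian_continuous[OF E]]) auto
  obtain M where M: "\<And>x. x \<in> cball 0 1 \<Longrightarrow> norm (c x) \<le> M"
    using compact_imp_bounded[OF compact_continuous_image[OF cc compact_cball]] unfolding bounded_iff by blast
  define u where "u z = (1 / norm z) *\<^sub>R z" for z :: "complex^2"
  have u: "u z \<in> cball 0 1" for z by (cases "z = 0") (auto simp: u_def)
  have [measurable]: "u \<in> borel_measurable borel" unfolding u_def by measurable
  have "(\<lambda>x. indicator (cball 0 1) x *\<^sub>R c x) \<in> borel_measurable borel"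
    by (rule borel_measurable_continuous_on_indicator[OF _ cc]) simp
  from measurable_compose[OF \<open>u \<in> borel_measurable borel\<close> this]
  have "(\<lambda>z. c (u z)) \<in> borel_measurable borel" using u by simp
  hence "(\<lambda>z. c (u z)) absolutely_integrable_on ball 0 1"
    by (rule absolutely_integrable_on_ball_bounded[where C = M]) (use M u in auto)
  thus ?thesis by (simp add: c_def u_def radial_jacobian_def[abs_def])
qed

text \<open>The cones over the pieces are disjoint and fill the ball without its centre, so the
  chart integrals add up to a multiple of one integral over the ball in which \<rho>, \<sigma> and
  the charts no longer occur. This is the uniqueness behind
  \<open>fefferman_measure\<close>.\<close>

lemma has_form_integral_value:
  assumes \<rho>: "strongly_psc_defining_function \<rho> Z" and \<sigma>: "fefferman_form \<rho> Z \<sigma>"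
    and E: "extended_biholomorphism F W G V" and Z: "Z = F ` sphere 0 1"
    and I: "has_form_integral \<sigma> Z I"
  shows "I = 4 * 2 powr (1/3) * integral (ball 0 1) (radial_jacobian F)"
proof -
  note E' = extended_biholomorphismD[OF E]
  obtain \<phi> U A where pc: "\<And>i::nat. positive_chart Z \<sigma> (U i) (\<phi> i)" and A: "\<And>i. A i \<in> sets borel" "\<And>i. A i \<subseteq> U i"
    and int: "\<And>i. set_integrable lborel (A i) (pullback3 \<sigma> (\<phi> i))"
    and disj: "disjoint_family (\<lambda>i. \<phi> i ` A i)" and un: "(\<Union>i. \<phi> i ` A i) = Z"
    and sums: "(\<lambda>i. set_lebesgue_integral lborel (A i) (pullback3 \<sigma> (\<phi> i))) sums I"
    using I unfolding has_form_integral_def by blast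
  define h where "h = radial_jacobian F"
  define k :: real where "k = 2 powr (1/3)"
  have k: "k > 0" by (simp add: k_def)
  define \<psi> where "\<psi> i t = G (\<phi> i t)" for i t
  define C where "C i = radial_cone (\<psi> i) (A i)" for i
  have sm: "smooth_on_open (U i) (\<phi> i)" "\<phi> i ` U i \<subseteq> Z" "inj_on (\<phi> i) (U i)" "\<And>t. t \<in> U i \<Longrightarrow> pullback3 \<sigma> (\<phi> i) t > 0" for i
    using pc[of i] by (auto simp: positive_chart_def)
  note pb = positive_chart_pullback[OF \<rho> \<sigma> E Z sm(1,2), folded \<psi>_def]
  have n: "norm (\<psi> i t) = 1" "F (\<psi> i t) = \<phi> i t" if "t \<in> A i" for i t
    using pb(1,2) A(2) that by blast+
  have h_sphere: "h x = cmod (cdet (frechet_derivative F (at x))) powr (4/3)" if "norm x = 1" for x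
    using that by (simp add: h_def radial_jacobian_def)
  have hpos: "h x > 0" if "norm x = 1" for x
    using extended_biholomorphism_cdet(2)[OF E, of x] that by (simp add: h_sphere)
  have cone: "h absolutely_integrable_on C i \<and> integral (C i) h = set_lebesgue_integral lborel (A i) (pullback3 \<sigma> (\<phi> i)) / (4 * k)" for i
  proof -
    define P where "P t = 1 / k * pullback3 \<sigma> (\<phi> i) t" for t
    have 1: "set_integrable lborel (A i) P" unfolding P_def using int by (intro set_integrable_mult_right)
    have AU: "t \<in> U i" if "t \<in> A i" for t using A(2) that by blast
    have f1: "(\<psi> i has_derivative frechet_derivative (\<psi> i) (at t)) (at t)" if "t \<in> A i" for t
      using pb(3)[OF AU[OF that]] by (simp add: \<psi>_def[abs_def])
    have f2: "inj_on (\<psi> i) (A i)"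
      using sm(3)[of i] n(2) AU by (metis inj_onD inj_onI)
    have f4: "h (r *\<^sub>R \<psi> i t) = h (\<psi> i t)" if "0 < r" "t \<in> A i" for r t
      using that by (simp add: h_def radial_jacobian_def)
    have f5: "P t = h (\<psi> i t) * vol_form (frechet_derivative (\<psi> i) (at t) (axis 1 1)) (frechet_derivative (\<psi> i) (at t) (axis 2 1)) (frechet_derivative (\<psi> i) (at t) (axis 3 1)) (\<psi> i t)"
      if "t \<in> A i" for t
      using pb(4)[OF AU[OF that]] k unfolding P_def h_sphere[OF n(1)[OF that]] k_def[symmetric] by (simp add: \<psi>_def[abs_def])
    have f6: "P t > 0" if "t \<in> A i" for t using sm(4)[OF AU[OF that]] k by (simp add: P_def)
    have f7: "h (\<psi> i t) > 0" if "t \<in> A i" for t by (rule hpos[OF n(1)[OF that]])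
    note cc = cone_change_of_variables[OF A(1) f1 f2 n(1) f4 f5 f6 f7 1]
    have "set_lebesgue_integral lborel (A i) P = set_lebesgue_integral lborel (A i) (pullback3 \<sigma> (\<phi> i)) / k"
      unfolding P_def by simp
    thus ?thesis using cc unfolding C_def by simp
  qed
  have zC: "z \<in> C i \<longleftrightarrow> z \<noteq> 0 \<and> norm z < 1 \<and> (1 / norm z) *\<^sub>R z \<in> \<psi> i ` A i" for z i
  proof
    assume "z \<in> C i"
    then obtain r t where r: "0 < r" "r < 1" "t \<in> A i" "z = r *\<^sub>R \<psi> i t" by (auto simp: C_def radial_cone_def)
    have nz: "norm z = r" using r n(1)[OF r(3)] by simp
    show "z \<noteq> 0 \<and> norm z < 1 \<and> (1 / norm z) *\<^sub>R z \<in> \<psi> i ` A i"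
      unfolding nz using r nz by (auto intro!: image_eqI[of _ _ t])
  next
    assume z: "z \<noteq> 0 \<and> norm z < 1 \<and> (1 / norm z) *\<^sub>R z \<in> \<psi> i ` A i"
    then obtain t where t: "t \<in> A i" "(1 / norm z) *\<^sub>R z = \<psi> i t" by auto
    have "z = norm z *\<^sub>R \<psi> i t" using z by (simp add: t(2)[symmetric])
    thus "z \<in> C i" using z t(1) unfolding C_def radial_cone_def by (auto intro!: exI[of _ "norm z"] exI[of _ t])
  qed
  have Cdisj: "C i \<inter> C j = {}" if "i \<noteq> j" for i j
  proof (rule ccontr)
    assume "C i \<inter> C j \<noteq> {}"
    then obtain z s t where "s \<in> A i" "t \<in> A j" "(1 / norm z) *\<^sub>R z = \<psi> i s" "(1 / norm z) *\<^sub>R z = \<psi> j t"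
      unfolding disjoint_iff zC by blast
    hence "\<phi> i s = \<phi> j t" using n(2) by metis
    moreover have "\<phi> i ` A i \<inter> \<phi> j ` A j = {}" using disj that by (auto simp: disjoint_family_on_def)
    ultimately show False using \<open>s \<in> A i\<close> \<open>t \<in> A j\<close> by blast
  qed
  have Cun: "(\<Union>i. C i) = ball 0 1 - {0}"
  proof (rule set_eqI)
    fix z :: "complex^2"
    have "\<exists>i. (1 / norm z) *\<^sub>R z \<in> \<psi> i ` A i" if "z \<noteq> 0"
    proof -
      have nu: "norm ((1 / norm z) *\<^sub>R z) = 1" using that by simp
      hence "F ((1 / norm z) *\<^sub>R z) \<in> Z" unfolding Z by (intro imageI) simp
      then obtain i t where t: "t \<in> A i" "F ((1 / norm z) *\<^sub>R z) = \<phi> i t" unfolding un[symmetric] by blast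
      have "\<psi> i t = (1 / norm z) *\<^sub>R z" unfolding \<psi>_def t(2)[symmetric] by (rule E'(6)) (use nu in simp)
      thus ?thesis using t(1) by (metis imageI)
    qed
    thus "z \<in> (\<Union>i. C i) \<longleftrightarrow> z \<in> ball 0 1 - {0}" by (auto simp: zC)
  qed
  \<comment> \<open>Measurability of a cone is read off from the integrable product of its indicator
    with h, which is positive there.\<close>
  have Cm: "C i \<in> sets lebesgue" for i
  proof -
    have "integrable lebesgue (\<lambda>z. indicator (C i) z *\<^sub>R h z)" using cone[of i] by (simp add: set_integrable_def)
    hence [measurable]: "(\<lambda>z. indicator (C i) z *\<^sub>R h z) \<in> borel_measurable lebesgue" by (rule borel_measurable_integrable)
    have "C i = {z \<in> space lebesgue. 0 < indicator (C i) z *\<^sub>R h z}"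
    proof (intro equalityI subsetI)
      fix z assume z: "z \<in> C i"
      hence nu: "norm ((1 / norm z) *\<^sub>R z) = 1" by (simp add: zC)
      have "h z = h ((1 / norm z) *\<^sub>R z)" using nu z by (simp add: h_def radial_jacobian_def zC)
      thus "z \<in> {z \<in> space lebesgue. 0 < indicator (C i) z *\<^sub>R h z}" using hpos[OF nu] z by simp
    next
      fix z assume "z \<in> {z \<in> space lebesgue. 0 < indicator (C i) z *\<^sub>R h z}"
      thus "z \<in> C i" by (cases "z \<in> C i") auto
    qed
    also have "\<dots> \<in> sets lebesgue" by measurable
    finally show ?thesis .
  qed
  have hb: "h absolutely_integrable_on ball 0 1" unfolding h_def by (rule radial_jacobian_integrable[OF E])
  have hu: "h absolutely_integrable_on (\<Union>i. C i)"
    by (rule set_integrable_subset[OF hb]) (use Cm in \<open>auto simp: Cun\<close>)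
  have "integral (ball 0 1) h = integral (ball 0 1 - {0}) h"
    by (rule integral_spike_set) (auto intro: negligible_subset[of "{0}"])
  also have "\<dots> = set_lebesgue_integral lebesgue (\<Union>i. C i) h"
    using set_lebesgue_integral_eq_integral(2)[OF hu] by (simp add: Cun)
  also have "\<dots> = (\<Sum>i. set_lebesgue_integral lebesgue (C i) h)"
    by (rule lebesgue_integral_countable_add[OF Cm Cdisj hu])
  also have "\<dots> = (\<Sum>i. set_lebesgue_integral lborel (A i) (pullback3 \<sigma> (\<phi> i)) / (4 * k))"
  proof (rule suminf_cong)
    fix i
    show "set_lebesgue_integral lebesgue (C i) h = set_lebesgue_integral lborel (A i) (pullback3 \<sigma> (\<phi> i)) / (4 * k)"
      using set_lebesgue_integral_eq_integral(2)[OF conjunct1[OF cone[of i]]] cone[of i] by simp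
  qed
  also have "\<dots> = I / (4 * k)"
    using sums_unique[OF sums_divide[OF sums]] by simp
  finally show ?thesis using k by (simp add: h_def k_def)
qed

section \<open>Existence of the Fefferman measure\<close>

lemma linear_expand_basis:
  fixes f :: "'a::euclidean_space \<Rightarrow> 'b::real_vector"
  assumes "linear f"
  shows "f v = (\<Sum>b\<in>Basis. (v \<bullet> b) *\<^sub>R f b)"
proof -
  interpret linear f by fact
  show ?thesis by (subst euclidean_representation[of v, symmetric]) (simp only: sum scale)
qed

text \<open>Continuity of the finitely many derivatives along basis vectors bounds the change of the
  whole derivative in operator norm, which is what the local injectivity theorem requires.\<close>

lemma has_derivative_locally_injective_C1:
  fixes G :: "'a::euclidean_space \<Rightarrow> 'a"
  assumes G: "smooth_on_open V G" and q: "q \<in> V" and inj: "linear B" "\<And>v. frechet_derivative G (at q) (B v) = v"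
  obtains r where "r > 0" "ball q r \<subseteq> V" "inj_on G (ball q r)"
proof -
  note d = smooth_on_openD(2)[OF G]
  note c = smooth_on_openD(4)[OF smooth_on_openD(3)[OF G]]
  have V: "open V" by (rule smooth_on_openD(1)[OF G])
  have lq: "linear (frechet_derivative G (at q))" by (rule has_derivative_linear[OF d[OF q]])
  have "B \<circ> frechet_derivative G (at q) = id"
    using linear_inverse_left[OF lq inj(1)] inj(2) by (auto simp: fun_eq_iff)
  moreover have "\<exists>\<delta>>0. \<forall>x. dist q x < \<delta> \<longrightarrow> onorm (\<lambda>v. frechet_derivative G (at x) v - frechet_derivative G (at q) v) < \<epsilon>" if "\<epsilon> > 0" for \<epsilon>
  proof -
    define g where "g x = (\<Sum>b\<in>Basis. norm (frechet_derivative G (at x) b - frechet_derivative G (at q) b))" for x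
    have "continuous_on V g" unfolding g_def by (intro continuous_intros c)
    hence "isCont g q" using V q by (simp add: continuous_on_eq_continuous_at)
    moreover have "g q = 0" by (simp add: g_def)
    ultimately have "(g \<longlongrightarrow> 0) (at q)" by (simp add: isCont_def)
    hence "eventually (\<lambda>x. g x < \<epsilon>) (at q)" using \<open>\<epsilon> > 0\<close> by (rule order_tendstoD)
    hence "eventually (\<lambda>x. g x < \<epsilon> \<and> x \<in> V) (at q)"
      using eventually_at_in_open'[OF V q] by (rule eventually_conj)
    then obtain \<delta> where \<delta>: "\<delta> > 0" "\<And>x. x \<noteq> q \<Longrightarrow> dist x q < \<delta> \<Longrightarrow> g x < \<epsilon> \<and> x \<in> V"
      by (auto simp: eventually_at)
    have "onorm (\<lambda>v. frechet_derivative G (at x) v - frechet_derivative G (at q) v) < \<epsilon>" if "dist q x < \<delta>" for x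
    proof -
      have gx: "g x < \<epsilon> \<and> x \<in> V" using \<delta>(2)[of x] that \<open>g q = 0\<close> \<open>\<epsilon> > 0\<close> q by (cases "x = q") (auto simp: dist_commute)
      let ?L = "\<lambda>v. frechet_derivative G (at x) v - frechet_derivative G (at q) v"
      have lL: "linear ?L" using gx by (intro linear_compose_sub lq has_derivative_linear[OF d]) auto
      have "norm (?L v) \<le> g x * norm v" for v
      proof -
        have "norm (?L v) \<le> (\<Sum>b\<in>Basis. norm ((v \<bullet> b) *\<^sub>R ?L b))"
          by (subst linear_expand_basis[OF lL, of v]) (rule norm_sum)
        also have "\<dots> \<le> (\<Sum>b\<in>Basis. norm v * norm (?L b))"
          by (intro sum_mono) (auto intro!: mult_right_mono Basis_le_norm)
        finally show ?thesis by (simp add: g_def sum_distrib_left mult.commute)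
      qed
      hence "onorm ?L \<le> g x" by (intro onorm_le) 
      thus ?thesis using gx by simp
    qed
    thus ?thesis using \<delta>(1) by blast
  qed
  ultimately show ?thesis
    using has_derivative_locally_injective[OF q V, of B "\<lambda>x. frechet_derivative G (at x)" G] d inj(1) that
    unfolding linear_conv_bounded_linear by blast
qed

lemma smooth_norm_defining: "smooth_on_open UNIV (\<lambda>y::'a::euclidean_space. y \<bullet> y - 1)"
proof -
  have "smooth_on_open UNIV (\<lambda>y::'a. y \<bullet> y + - 1)"
    by (intro smooth_on_open_add smooth_on_open_inner smooth_on_open_ident smooth_on_open_const open_UNIV)
  thus ?thesis by simp
qed

lemma norm_defining_derivatives:
  fixes y :: "'a::euclidean_space"
  shows "frechet_derivative (\<lambda>y. y \<bullet> y - 1) (at y) v = 2 * (y \<bullet> v)"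
    and "frechet_derivative (\<lambda>x. 2 * (x \<bullet> v)) (at y) w = 2 * (w \<bullet> v)"
proof -
  have "((\<lambda>y. y \<bullet> y - 1) has_derivative (\<lambda>v. 2 * (y \<bullet> v))) (at y)" for y :: 'a
    by (auto intro!: derivative_eq_intros simp: inner_commute)
  note 1 = frechet_derivative_eqI[OF this]
  show "frechet_derivative (\<lambda>y. y \<bullet> y - 1) (at y) v = 2 * (y \<bullet> v)" by (simp add: 1)
  have "((\<lambda>x. 2 * (x \<bullet> v)) has_derivative (\<lambda>w. 2 * (w \<bullet> v))) (at y)"
    by (auto intro!: derivative_eq_intros)
  thus "frechet_derivative (\<lambda>x. 2 * (x \<bullet> v)) (at y) w = 2 * (w \<bullet> v)"
    by (simp add: frechet_derivative_eqI)
qed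

text \<open>Beyond the image of the closed ball \<open>G\<close> is an arbitrary extension, so |G x|
  = 1 may hold off \<open>Z\<close>. Near a point q of Z, however, G is injective, and if |G x| = 1
  then F (G x) is also close to q and has the same image under G; hence x = F (G x) lies on
  Z.\<close>

lemma defining_neighbourhood:
  assumes E: "extended_biholomorphism F W G V" and Z: "Z = F ` sphere 0 1"
  obtains N where "open N" "N \<subseteq> V" "Z = {q\<in>N. norm (G q) = 1}"
proof -
  note E' = extended_biholomorphismD[OF E]
  have V: "open V" by (rule smooth_on_openD(1)[OF E'(4)])
  have Fc: "continuous_on (cball 0 1) F" by (rule continuous_on_subset[OF smooth_on_openD(4)[OF E'(1)] E'(2)])
  have "\<exists>X. open X \<and> q \<in> X \<and> X \<subseteq> V \<and> (\<forall>x\<in>X. norm (G x) = 1 \<longrightarrow> x \<in> Z)" if q: "q \<in> Z" for q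
  proof -
    obtain p where p: "norm p = 1" "q = F p" using q Z by auto
    have qV: "q \<in> V" using E'(5) p by auto
    have pc: "p \<in> cball 0 1" using p by simp
    have lin: "linear (frechet_derivative F (at p))"
      using has_derivative_linear[OF smooth_on_openD(2)[OF E'(1)]] E'(2) pc by blast
    obtain r where r: "r > 0" "ball q r \<subseteq> V" "inj_on G (ball q r)"
      using has_derivative_locally_injective_C1[OF E'(4) qV lin]
        extended_biholomorphism_inverse_derivative[OF E, of p] p by auto
    obtain \<delta> where \<delta>: "\<delta> > 0" "\<And>x. x \<in> cball 0 1 \<Longrightarrow> dist x p < \<delta> \<Longrightarrow> dist (F x) (F p) < r"
      using Fc pc r(1) unfolding continuous_on_iff by blast
    have Gq: "G q = p" using E'(6)[of p] p by simp
    define X where "X = ball q r \<inter> (V \<inter> G -` ball p \<delta>)"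
    have "open X" unfolding X_def
      by (intro open_Int open_ball continuous_open_preimage[OF smooth_on_openD(4)[OF E'(4)] V])
    moreover have "q \<in> X" using r \<delta> qV Gq by (auto simp: X_def)
    moreover have "x \<in> Z" if x: "x \<in> X" "norm (G x) = 1" for x
    proof -
      have gc: "G x \<in> cball 0 1" "dist (G x) p < \<delta>" using x by (auto simp: X_def dist_commute)
      have "F (G x) \<in> ball q r" using \<delta>(2)[OF gc] p(2) by (simp add: dist_commute)
      moreover have "G (F (G x)) = G x" using E'(6)[of "G x"] x by simp
      moreover have "x \<in> ball q r" using x by (simp add: X_def)
      ultimately have "x = F (G x)" using r(3) by (metis inj_onD)
      thus "x \<in> Z" unfolding Z using x(2) by (metis image_eqI mem_sphere_0)
    qed
    ultimately show ?thesis by (intro exI[of _ X]) (auto simp: X_def)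
  qed
  then obtain X where X: "\<And>q. q \<in> Z \<Longrightarrow> open (X q) \<and> q \<in> X q \<and> X q \<subseteq> V \<and> (\<forall>x\<in>X q. norm (G x) = 1 \<longrightarrow> x \<in> Z)"
    by metis
  show ?thesis
  proof (rule that[of "\<Union>q\<in>Z. X q"])
    show "open (\<Union>q\<in>Z. X q)" using X by blast
    show "(\<Union>q\<in>Z. X q) \<subseteq> V" using X by blast
    have "norm (G q) = 1" if "q \<in> Z" for q using that Z E'(6) by auto
    thus "Z = {q \<in> (\<Union>q\<in>Z. X q). norm (G q) = 1}" using X by blast
  qed
qed

text \<open>The function is |G|^2 - 1, the pullback of the standard one for the sphere. On Z the
  second derivatives of G cancel in the Levi form by
  \<open>holomorphic_boundary_derivatives\<close>, leaving |G' w|^2, which is positive for every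
  nonzero w.\<close>

lemma exists_strongly_psc_defining_function:
  assumes E: "extended_biholomorphism F W G V" and Z: "Z = F ` sphere 0 1"
  obtains \<rho> where "strongly_psc_defining_function \<rho> Z"
proof -
  note E' = extended_biholomorphismD[OF E]
  obtain N where N: "open N" "N \<subseteq> V" "Z = {q\<in>N. norm (G q) = 1}" by (rule defining_neighbourhood[OF E Z])
  define \<rho> where "\<rho> q = G q \<bullet> G q - 1" for q
  have GN: "smooth_on_open N G" by (rule smooth_on_open_subset[OF E'(4) N(1,2)])
  have sm: "smooth_on_open N \<rho>" unfolding \<rho>_def
    by (rule smooth_on_open_compose[OF GN smooth_norm_defining]) simp
  have Z\<rho>: "Z = {q\<in>N. \<rho> q = 0}"
  proof -
    have "\<rho> q = 0 \<longleftrightarrow> norm (G q) = 1" for q by (simp add: \<rho>_def norm_eq_1)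
    thus ?thesis using N(3) by simp
  qed
  have ZN: "q \<in> N" if "q \<in> Z" for q using that N(3) by auto
  note sc = second_derivative_compose[OF smooth_norm_defining GN _ UNIV_I, folded \<rho>_def, unfolded norm_defining_derivatives]
  have ex: "\<exists>p. norm p = 1 \<and> q = F p" if "q \<in> Z" for q using that Z by auto
  have inv: "frechet_derivative G (at (F p)) (frechet_derivative F (at p) v) = v" if "norm p = 1" for p v
    using extended_biholomorphism_inverse_derivative[OF E, of p] that by simp
  have "defining_function \<rho> Z"
    unfolding defining_function_def
  proof (intro exI[of _ N] conjI sm Z\<rho> ballI)
    fix q assume q: "q \<in> Z"
    then obtain p where p: "norm p = 1" "q = F p" using ex by blast
    have "frechet_derivative \<rho> (at q) (frechet_derivative F (at p) p) = 2"
      using sc(1)[OF ZN[OF q]] inv[OF p(1)] p E'(6)[of p] by (simp add: norm_eq_1)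
    thus "\<exists>v. frechet_derivative \<rho> (at q) v \<noteq> 0" by (metis zero_neq_numeral)
  qed
  moreover have "Re (levi_form \<rho> q w) > 0" if q: "q \<in> Z" and w: "w \<noteq> 0" for q w
  proof -
    obtain p where p: "norm p = 1" "q = F p" using ex q by blast
    have bV: "F ` ball 0 1 \<subseteq> V" using E'(5) by auto
    have qV: "q \<in> V" using ZN[OF q] N(2) by auto
    have qcl: "q \<in> closure (F ` ball 0 1)"
    proof -
      have "F ` closure (ball 0 1) \<subseteq> closure (F ` ball 0 1)"
        by (rule image_closure_subset[OF _ closed_closure closure_subset])
           (use continuous_on_subset[OF smooth_on_openD(4)[OF E'(1)] E'(2)] in simp)
      thus ?thesis using p by auto
    qed
    note hb = holomorphic_boundary_derivatives[OF E'(4) E'(7) bV E'(8) qV qcl]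
    define B where "B = frechet_derivative G (at q)"
    have cl: "B (\<i> *s w) = \<i> *s B w" using hb(1) by (simp add: complex_linear_def B_def)
    have hbw: "G q \<bullet> frechet_derivative (\<lambda>x. frechet_derivative G (at x) (\<i> *s w)) (at q) (\<i> *s w)
       = - (G q \<bullet> frechet_derivative (\<lambda>x. frechet_derivative G (at x) w) (at q) w)"
      by (simp only: hb(2)[of w] inner_minus_right)
    have "Re (levi_form \<rho> q w) = (2 * (B w \<bullet> B w) + 2 * ((\<i> *s B w) \<bullet> (\<i> *s B w))) / 4"
      unfolding Re_levi_form[OF sm ZN[OF q]] unfolding sc(2)[OF ZN[OF q]] unfolding B_def[symmetric] cl
      by (simp add: hbw norm_defining_derivatives(2))
    also have "(\<i> *s B w) \<bullet> (\<i> *s B w) = B w \<bullet> B w"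
      unfolding c2_inner by (simp add: algebra_simps)
    finally have "Re (levi_form \<rho> q w) = B w \<bullet> B w" by simp
    moreover have "B w \<noteq> 0"
    proof
      assume "B w = 0"
      have lF: "linear (frechet_derivative F (at p))" using extended_biholomorphism_cdet(1)[OF E, of p] p by (simp add: complex_linear_def)
      have lB: "linear B" using hb(1) by (simp add: complex_linear_def B_def)
      have "B \<circ> frechet_derivative F (at p) = id" using inv[OF p(1)] p(2) by (auto simp: B_def)
      hence "frechet_derivative F (at p) \<circ> B = id" using linear_inverse_left[OF lB lF] by simp
      hence "w = frechet_derivative F (at p) (B w)" by (metis comp_apply id_apply)
      thus False using \<open>B w = 0\<close> linear_0[OF lF] w by simp
    qed
    ultimately show ?thesis by simp
  qed
  ultimately have "strongly_psc_defining_function \<rho> Z" unfolding strongly_psc_defining_function_def by blast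
  thus ?thesis by (rule that)
qed


section \<open>The Fefferman form as a contraction of the volume form\<close>

lemma vol_form_expand:
  "vol_form v1 v2 v3 v4 = 
    (let a = real_coords v1; b = real_coords v2; c = real_coords v3; d = real_coords v4 in
    a$1 * (b$2 * (c$3 * d$4 - c$4 * d$3) - b$3 * (c$2 * d$4 - c$4 * d$2) + b$4 * (c$2 * d$3 - c$3 * d$2))
  - a$2 * (b$1 * (c$3 * d$4 - c$4 * d$3) - b$3 * (c$1 * d$4 - c$4 * d$1) + b$4 * (c$1 * d$3 - c$3 * d$1))
  + a$3 * (b$1 * (c$2 * d$4 - c$4 * d$2) - b$2 * (c$1 * d$4 - c$4 * d$1) + b$4 * (c$1 * d$2 - c$2 * d$1))
  - a$4 * (b$1 * (c$2 * d$3 - c$3 * d$2) - b$2 * (c$1 * d$3 - c$3 * d$1) + b$3 * (c$1 * d$2 - c$2 * d$1)))"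
  unfolding vol_form_def det_4 Let_def vector_4 ..

lemma vol_form_cramer_coordinate:
  "vol_form v1 v2 v3 u * real_coords v4 $ i - vol_form v1 v2 v4 u * real_coords v3 $ i
     + vol_form v1 v3 v4 u * real_coords v2 $ i - vol_form v2 v3 v4 u * real_coords v1 $ i = vol_form v1 v2 v3 v4 * real_coords u $ i"
proof -
  have "i = 1 \<or> i = 2 \<or> i = 3 \<or> i = 4" by (rule exhaust_4)
  thus ?thesis unfolding vol_form_expand Let_def by (elim disjE; hypsubst) (simp only: algebra_simps)+
qed

text \<open>Cramer's linear relation among the five vectors v1, v2, v3, v4, u of a four-dimensional
  space, with \<open>a\<close> applied to it.\<close>

lemma vol_form_cramer:
  fixes a :: "complex^2 \<Rightarrow> real"
  assumes "linear a"
  shows "vol_form v1 v2 v3 u * a v4 - vol_form v1 v2 v4 u * a v3 + vol_form v1 v3 v4 u * a v2 - vol_form v2 v3 v4 u * a v1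
    = vol_form v1 v2 v3 v4 * a u"
proof -
  define b where "b i = a (of_real_coords (axis i 1))" for i
  have a: "a v = (\<Sum>i\<in>UNIV. real_coords v $ i * b i)" for v
  proof -
    have "a v = (a \<circ> of_real_coords) (\<Sum>i\<in>UNIV. real_coords v $ i *\<^sub>R axis i 1)"
    proof -
      have "(\<Sum>i\<in>UNIV. real_coords v $ i *\<^sub>R axis i 1) = real_coords v"
        by (simp add: vec_eq_iff forall_4 sum_4 axis_def)
      thus ?thesis by simp
    qed
    also have "\<dots> = (\<Sum>i\<in>UNIV. real_coords v $ i *\<^sub>R (a \<circ> of_real_coords) (axis i 1))"
    proof -
      interpret linear "a \<circ> of_real_coords" by (rule linear_compose[OF linear_of_real_coords assms])
      show ?thesis by (simp only: sum scale)
    qed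
    finally show ?thesis by (simp add: b_def)
  qed
  have "vol_form v1 v2 v3 u * a v4 - vol_form v1 v2 v4 u * a v3 + vol_form v1 v3 v4 u * a v2 - vol_form v2 v3 v4 u * a v1
    = (\<Sum>i\<in>UNIV. (vol_form v1 v2 v3 u * real_coords v4 $ i - vol_form v1 v2 v4 u * real_coords v3 $ i
     + vol_form v1 v3 v4 u * real_coords v2 $ i - vol_form v2 v3 v4 u * real_coords v1 $ i) * b i)"
    unfolding a by (simp add: sum_distrib_left sum_subtractf sum.distrib algebra_simps)
  also have "\<dots> = vol_form v1 v2 v3 v4 * a u"
    unfolding vol_form_cramer_coordinate a by (simp add: sum_distrib_left mult.assoc)
  finally show ?thesis .
qed

lemma alternating3_vol_form: "alternating3 (\<lambda>v1 v2 v3. c * vol_form v1 v2 v3 u)"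
  unfolding alternating3_def
proof (intro conjI allI)
  fix v w
  have c: "linear (\<lambda>x. c * f x)" if "linear f" for f :: "complex^2 \<Rightarrow> real"
    by (rule linearI) (simp_all add: linear_add[OF that] linear_scale[OF that] algebra_simps)
  show "linear (\<lambda>x. c * vol_form x v w u)" "linear (\<lambda>x. c * vol_form v x w u)" "linear (\<lambda>x. c * vol_form v w x u)"
    by (rule c, rule linearI; simp add: vol_form_expand Let_def algebra_simps)+
  show "c * vol_form v v w u = 0" "c * vol_form v w v u = 0" "c * vol_form w v v u = 0"
    unfolding vol_form_expand Let_def by (simp_all add: algebra_simps)
qed

text \<open>The volume form is contracted with a vector \<nu> transverse to Z. By
  \<open>vol_form_cramer\<close> the wedge of the result with d\<rho> is d\<rho>(\<nu>) times the
  volume form, so \<open>c\<close> is the required factor divided by d\<rho>(\<nu>). The choice is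
  pointwise, like the forms themselves.\<close>

lemma exists_fefferman_form:
  assumes "strongly_psc_defining_function \<rho> Z"
  obtains \<sigma> where "fefferman_form \<rho> Z \<sigma>"
proof -
  obtain N where N: "smooth_on_open N \<rho>" "Z = {q\<in>N. \<rho> q = 0}" and nz: "\<And>q. q \<in> Z \<Longrightarrow> \<exists>v. frechet_derivative \<rho> (at q) v \<noteq> 0"
    using assms unfolding strongly_psc_defining_function_def defining_function_def by blast
  obtain \<nu> where \<nu>: "\<And>q. q \<in> Z \<Longrightarrow> frechet_derivative \<rho> (at q) (\<nu> q) \<noteq> 0" using nz by metis
  define c where "c q = 2 powr (4/3) * fefferman_M \<rho> q powr (1/3) / frechet_derivative \<rho> (at q) (\<nu> q)" for q
  define \<sigma> where "\<sigma> q v1 v2 v3 = c q * vol_form v1 v2 v3 (\<nu> q)" for q v1 v2 v3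
  have "fefferman_form \<rho> Z \<sigma>" unfolding fefferman_form_def
  proof (intro ballI conjI allI)
    fix q assume q: "q \<in> Z"
    have "\<sigma> q = (\<lambda>v1 v2 v3. c q * vol_form v1 v2 v3 (\<nu> q))" by (intro ext) (simp add: \<sigma>_def)
    thus "alternating3 (\<sigma> q)" by (simp add: alternating3_vol_form)
    fix v1 v2 v3 v4
    have "q \<in> N" using q N by auto
    hence lin: "linear (frechet_derivative \<rho> (at q))" using has_derivative_linear[OF smooth_on_openD(2)[OF N(1)]] by blast
    have "wedge31 (\<sigma> q) (frechet_derivative \<rho> (at q)) v1 v2 v3 v4
      = c q * (vol_form v1 v2 v3 (\<nu> q) * frechet_derivative \<rho> (at q) v4 - vol_form v1 v2 v4 (\<nu> q) * frechet_derivative \<rho> (at q) v3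
       + vol_form v1 v3 v4 (\<nu> q) * frechet_derivative \<rho> (at q) v2 - vol_form v2 v3 v4 (\<nu> q) * frechet_derivative \<rho> (at q) v1)"
      unfolding wedge31_def \<sigma>_def by (simp only: algebra_simps)
    also have "\<dots> = 2 powr (4/3) * fefferman_M \<rho> q powr (1/3) * vol_form v1 v2 v3 v4"
      unfolding vol_form_cramer[OF lin] using \<nu>[OF q] by (simp add: c_def)
    finally show "wedge31 (\<sigma> q) (frechet_derivative \<rho> (at q)) v1 v2 v3 v4 = 2 powr (4/3) * fefferman_M \<rho> q powr (1/3) * vol_form v1 v2 v3 v4" .
  qed
  thus ?thesis by (rule that)
qed

text \<open>Stereographic charts of the unit sphere, centred at \<open>(0, \<epsilon>\<i>)\<close> for \<open>\<epsilon> = \<plusminus>1\<close>. The sign in the first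
  coordinate makes both of them positively oriented.\<close>

definition stereo_numerator :: "real \<Rightarrow> real^3 \<Rightarrow> complex^2" where
  "stereo_numerator \<epsilon> t = vector [Complex (2 * \<epsilon> * t $ 1) (2 * t $ 2), Complex (2 * t $ 3) 0] + (1 - t \<bullet> t) *\<^sub>R axis 2 (of_real \<epsilon> * \<i>)"

definition stereo :: "real \<Rightarrow> real^3 \<Rightarrow> complex^2" where
  "stereo \<epsilon> t = inverse (1 + t \<bullet> t) *\<^sub>R stereo_numerator \<epsilon> t"

lemma real3_inner: "t \<bullet> s = t $ 1 * s $ 1 + t $ 2 * s $ 2 + t $ 3 * s $ 3" for t s :: "real^3"
  by (simp add: inner_vec_def sum_3)

lemma stereo_coords:
  "real_coords (stereo \<epsilon> t) $ 1 = 2 * \<epsilon> * t $ 1 / (1 + t \<bullet> t)" "real_coords (stereo \<epsilon> t) $ 2 = 2 * t $ 2 / (1 + t \<bullet> t)"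
  "real_coords (stereo \<epsilon> t) $ 3 = 2 * t $ 3 / (1 + t \<bullet> t)" "real_coords (stereo \<epsilon> t) $ 4 = \<epsilon> * (1 - t \<bullet> t) / (1 + t \<bullet> t)"
  by (simp_all add: stereo_def stereo_numerator_def axis_def divide_inverse)

lemma stereo_denominator: "1 + t \<bullet> t > 0" for t :: "'a::real_inner"
  by (simp add: add_pos_nonneg)

lemma norm_real_coords: "(norm z)\<^sup>2 = (real_coords z $ 1)\<^sup>2 + (real_coords z $ 2)\<^sup>2 + (real_coords z $ 3)\<^sup>2 + (real_coords z $ 4)\<^sup>2"
  by (simp add: c2_norm cmod_power2)

lemma norm_stereo:
  assumes "\<bar>\<epsilon>\<bar> = 1"
  shows "norm (stereo \<epsilon> t) = 1"
proof (rule norm_eq_1I)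
  have e: "\<epsilon>\<^sup>2 = 1" using assms by (metis power2_abs one_power2)
  define s where "s = t \<bullet> t"
  have s0: "1 + s \<noteq> 0" using stereo_denominator[of t] by (simp add: s_def)
  have s: "s = (t $ 1)\<^sup>2 + (t $ 2)\<^sup>2 + (t $ 3)\<^sup>2" by (simp add: s_def real3_inner power2_eq_square)
  have "(norm (stereo \<epsilon> t))\<^sup>2 = (4 * ((t $ 1)\<^sup>2 + (t $ 2)\<^sup>2 + (t $ 3)\<^sup>2) + (1 - s)\<^sup>2) / (1 + s)\<^sup>2"
    unfolding norm_real_coords stereo_coords s_def[symmetric] by (simp add: power_divide power_mult_distrib e add_divide_distrib)
  also have "4 * ((t $ 1)\<^sup>2 + (t $ 2)\<^sup>2 + (t $ 3)\<^sup>2) + (1 - s)\<^sup>2 = (1 + s)\<^sup>2"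
    unfolding s[symmetric] by (simp add: power2_eq_square algebra_simps)
  finally show "(norm (stereo \<epsilon> t))\<^sup>2 = 1" using s0 by simp
qed

lemma stereo_last: "1 + \<epsilon> * real_coords (stereo \<epsilon> t) $ 4 = 2 / (1 + t \<bullet> t)" if "\<bar>\<epsilon>\<bar> = 1"
proof -
  have e: "\<epsilon> * \<epsilon> = 1" using that by (metis abs_mult_self_eq mult_1)
  have "1 + \<epsilon> * real_coords (stereo \<epsilon> t) $ 4 = 1 + (\<epsilon> * \<epsilon>) * (1 - t \<bullet> t) / (1 + t \<bullet> t)" unfolding stereo_coords by simp
  thus ?thesis unfolding e using stereo_denominator[of t] by (simp add: field_simps)
qed

lemma inj_stereo:
  assumes e: "\<bar>\<epsilon>\<bar> = 1"
  shows "inj (stereo \<epsilon>)"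
proof (rule injI)
  fix s t assume st: "stereo \<epsilon> s = stereo \<epsilon> t"
  have "2 / (1 + s \<bullet> s) = 2 / (1 + t \<bullet> t)" using stereo_last[OF e, of s] stereo_last[OF e, of t] st by simp
  hence d: "1 + s \<bullet> s = 1 + t \<bullet> t" by simp
  have "\<epsilon> \<noteq> 0" using e by auto
  have "real_coords (stereo \<epsilon> s) $ i = real_coords (stereo \<epsilon> t) $ i" for i using st by simp
  from this[of 1] this[of 2] this[of 3] show "s = t"
    unfolding stereo_coords d using stereo_denominator[of t] \<open>\<epsilon> \<noteq> 0\<close> by (auto simp: vec_eq_iff forall_3)
qed

lemma smooth_stereo: "smooth_on_open UNIV (stereo \<epsilon>)"
proof -
  have L: "bounded_linear (\<lambda>t::real^3. vector [Complex (2 * \<epsilon> * t $ 1) (2 * t $ 2), Complex (2 * t $ 3) 0] :: complex^2)"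
    unfolding linear_conv_bounded_linear[symmetric]
    by (rule linearI) (auto simp: c2_eq_iff complex_eq_iff algebra_simps)
  have ii: "smooth_on_open UNIV (\<lambda>t::real^3. t \<bullet> t)"
    by (intro smooth_on_open_inner smooth_on_open_ident open_UNIV)
  have "smooth_on_open UNIV (\<lambda>t::real^3. 1 + - 1 * (t \<bullet> t))"
    using smooth_on_open_linear[OF bounded_linear_mult_right ii, of "- 1"]
    by (intro smooth_on_open_add smooth_on_open_const open_UNIV)
  hence "smooth_on_open UNIV (\<lambda>t. stereo_numerator \<epsilon> t)" unfolding stereo_numerator_def
    by (intro smooth_on_open_add smooth_on_open_scaleR smooth_on_open_const open_UNIV smooth_on_open_linear[OF L smooth_on_open_ident[OF open_UNIV]]) simp
  moreover have "smooth_on_open UNIV (\<lambda>t::real^3. inverse (1 + t \<bullet> t))"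
    by (intro smooth_on_open_inverse smooth_on_open_add smooth_on_open_const open_UNIV ii) (use stereo_denominator in \<open>metis less_irrefl\<close>)
  ultimately show ?thesis unfolding stereo_def[abs_def] by (intro smooth_on_open_scaleR)
qed

text \<open>Multiples of the last vector do not affect a determinant. This removes the derivative of
  the scalar factor in \<open>stereo\<close>, which contributes only multiples of the position
  vector.\<close>

lemma vol_form_add_last:
  "vol_form (x + m *\<^sub>R u) y z u = vol_form x y z u" "vol_form x (y + m *\<^sub>R u) z u = vol_form x y z u"
  "vol_form x y (z + m *\<^sub>R u) u = vol_form x y z u"
  unfolding vol_form_expand Let_def by (simp_all add: algebra_simps)

lemma vol_form_scale_last: "vol_form x y z (k *\<^sub>R u) = k * vol_form x y z u"
  unfolding vol_form_expand Let_def by (simp add: algebra_simps)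

lemma vol_form_scale: "vol_form (k *\<^sub>R x) (k *\<^sub>R y) (k *\<^sub>R z) u = k ^ 3 * vol_form x y z u"
  unfolding vol_form_expand Let_def by (simp add: algebra_simps power3_eq_cube)

text \<open>The value is the cube of the conformal factor 2 / (1 + |t|^2). The sign \<epsilon>
  enters twice, through the first coordinate and through the axis, so both charts give a positive
  value.\<close>

lemma vol_form_stereo:
  assumes e: "\<bar>\<epsilon>\<bar> = 1"
  shows "vol_form (frechet_derivative (stereo \<epsilon>) (at t) (axis 1 1)) (frechet_derivative (stereo \<epsilon>) (at t) (axis 2 1))
     (frechet_derivative (stereo \<epsilon>) (at t) (axis 3 1)) (stereo \<epsilon> t) = 8 / (1 + t \<bullet> t) ^ 3"
proof -
  have ee: "\<epsilon> * \<epsilon> = 1" using e by (metis abs_mult_self_eq mult_1)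
  define k where "k = inverse (1 + t \<bullet> t)"
  define Lt where "Lt h = (vector [Complex (2 * \<epsilon> * h $ 1) (2 * h $ 2), Complex (2 * h $ 3) 0] :: complex^2)" for h :: "real^3"
  define c where "c = (axis 2 (of_real \<epsilon> * \<i>) :: complex^2)"
  have L: "bounded_linear Lt" unfolding Lt_def linear_conv_bounded_linear[symmetric]
    by (rule linearI) (auto simp: c2_eq_iff complex_eq_iff algebra_simps)
  have dN: "(stereo_numerator \<epsilon> has_derivative (\<lambda>h. Lt h - (2 * (t \<bullet> h)) *\<^sub>R c)) (at t)"
    unfolding stereo_numerator_def[abs_def] Lt_def[symmetric] c_def[symmetric]
    by (auto intro!: derivative_eq_intros bounded_linear_imp_has_derivative[OF L] simp: inner_commute)
  have dk: "((\<lambda>t. inverse (1 + t \<bullet> t)) has_derivative (\<lambda>h. - (k * (2 * (t \<bullet> h)) * k))) (at t)"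
    unfolding k_def using stereo_denominator[of t]
    by (auto intro!: derivative_eq_intros simp: inner_commute)
  have "(stereo \<epsilon> has_derivative (\<lambda>h. k *\<^sub>R (Lt h - (2 * (t \<bullet> h)) *\<^sub>R c) + (- (k * (2 * (t \<bullet> h)) * k)) *\<^sub>R stereo_numerator \<epsilon> t)) (at t)"
    unfolding stereo_def[abs_def] using has_derivative_scaleR[OF dk dN] by (simp add: k_def)
  note D = frechet_derivative_eqI[OF this]
  define x y z where "x = t $ 1" and "y = t $ 2" and "z = t $ 3"
  define s where "s = x * x + y * y + z * z"
  have ts: "t \<bullet> t = s" by (simp add: s_def x_def y_def z_def real3_inner)
  have "vol_form (frechet_derivative (stereo \<epsilon>) (at t) (axis 1 1)) (frechet_derivative (stereo \<epsilon>) (at t) (axis 2 1))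
     (frechet_derivative (stereo \<epsilon>) (at t) (axis 3 1)) (stereo \<epsilon> t) = (\<epsilon> * \<epsilon>) * (8 * k ^ 4 * (1 - s + 2 * (x * x + y * y + z * z)))"
  proof -
    have tj: "t \<bullet> axis 1 1 = x" "t \<bullet> axis 2 1 = y" "t \<bullet> axis 3 1 = z"
      by (simp_all add: x_def y_def z_def inner_axis)
    have "vol_form (Lt (axis 1 1) - (2 * x) *\<^sub>R c) (Lt (axis 2 1) - (2 * y) *\<^sub>R c) (Lt (axis 3 1) - (2 * z) *\<^sub>R c) (stereo_numerator \<epsilon> t)
      = (\<epsilon> * \<epsilon>) * (8 * (1 - s + 2 * (x * x + y * y + z * z)))"
      unfolding vol_form_expand Let_def stereo_numerator_def Lt_def c_def ts x_def[symmetric] y_def[symmetric] z_def[symmetric]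
      by (simp add: axis_def x_def[symmetric] y_def[symmetric] z_def[symmetric]) (simp add: algebra_simps)
    thus ?thesis
      unfolding D tj stereo_def k_def[symmetric] vol_form_scale_last vol_form_add_last vol_form_scale
      by (simp add: eval_nat_numeral)
  qed
  also have "\<dots> = 8 * k ^ 4 * (1 + s)" unfolding ee by (simp add: s_def)
  also have "\<dots> = 8 / (1 + t \<bullet> t) ^ 3" using stereo_denominator[of t] by (simp add: k_def ts divide_inverse power_inverse eval_nat_numeral)
  finally show ?thesis .
qed


text \<open>Inverse stereographic projection from the pole opposite to the centre of the chart. The
  second equation identifies |t| <= 1 with the hemisphere on which \<epsilon> times the fourth
  coordinate is nonnegative.\<close>

lemma stereo_covers:
  assumes x: "norm x = 1" and e: "\<bar>\<epsilon>\<bar> = 1" and pos: "\<epsilon> * real_coords x $ 4 \<ge> 0"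
  obtains t where "stereo \<epsilon> t = x" "1 - t \<bullet> t = (1 + t \<bullet> t) * (\<epsilon> * real_coords x $ 4)"
proof -
  have ee: "\<epsilon> * \<epsilon> = 1" using e by (metis abs_mult_self_eq mult_1)
  define y where "y = real_coords x"
  define w where "w = \<epsilon> * y $ 4"
  have w0: "1 + w > 0" using pos by (simp add: w_def y_def)
  define t :: "real^3" where "t = vector [\<epsilon> * y $ 1 / (1 + w), y $ 2 / (1 + w), y $ 3 / (1 + w)]"
  have n: "(y $ 1)\<^sup>2 + (y $ 2)\<^sup>2 + (y $ 3)\<^sup>2 = 1 - w\<^sup>2"
  proof -
    have "w\<^sup>2 = (y $ 4)\<^sup>2" using ee by (simp add: w_def power_mult_distrib power2_eq_square[of \<epsilon>])
    thus ?thesis using norm_real_coords[of x] x by (simp add: y_def)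
  qed
  have "t \<bullet> t = ((\<epsilon> * \<epsilon>) * (y $ 1)\<^sup>2 + (y $ 2)\<^sup>2 + (y $ 3)\<^sup>2) / (1 + w)\<^sup>2"
    by (simp add: real3_inner t_def power2_eq_square add_divide_distrib)
  also have "\<dots> = (1 - w\<^sup>2) / (1 + w)\<^sup>2" unfolding ee by (simp add: n)
  also have "\<dots> = (1 - w) / (1 + w)"
  proof -
    have "1 - w\<^sup>2 = (1 - w) * (1 + w)" by (simp add: power2_eq_square algebra_simps)
    thus ?thesis using w0 by (simp add: power2_eq_square)
  qed
  finally have tt: "t \<bullet> t = (1 - w) / (1 + w)" .
  have d: "1 + t \<bullet> t = 2 / (1 + w)" and d': "1 - t \<bullet> t = 2 * w / (1 + w)"
    unfolding tt using w0 by (simp_all add: field_simps)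
  have "real_coords (stereo \<epsilon> t) = y"
    unfolding vec_eq_iff forall_4 stereo_coords d d' using w0 ee
    by (auto simp: t_def w_def field_simps) (simp_all flip: mult.assoc)
  hence "stereo \<epsilon> t = x" unfolding y_def by (metis real_coords_inverse(2))
  moreover have "1 - t \<bullet> t = (1 + t \<bullet> t) * (\<epsilon> * real_coords x $ 4)"
    unfolding d d' using w_def y_def by simp
  ultimately show ?thesis by (rule that)
qed

lemma exists_form_integral:
  assumes \<rho>: "strongly_psc_defining_function \<rho> Z" and \<sigma>: "fefferman_form \<rho> Z \<sigma>"
    and E: "extended_biholomorphism F W G V" and Z: "Z = F ` sphere 0 1"
  obtains I where "has_form_integral \<sigma> Z I"
proof -
  note E' = extended_biholomorphismD[OF E]
  define \<phi> where "\<phi> i = (\<lambda>t. F (stereo (if i = (1::nat) then -1 else 1) t))" for i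
  \<comment> \<open>One chart takes the closed unit ball and the other the open one, so the equator
    is covered once; the other members of the countable family are empty.\<close>
  define A where "A i = (if i = 0 then cball 0 1 else if i = (1::nat) then ball 0 1 else ({} :: (real^3) set))" for i
  define \<epsilon> where "\<epsilon> i = (if i = (1::nat) then -1 else 1 :: real)" for i
  have e: "\<bar>\<epsilon> i\<bar> = 1" for i by (simp add: \<epsilon>_def)
  have \<phi>: "\<phi> i = (\<lambda>t. F (stereo (\<epsilon> i) t))" for i by (simp add: \<phi>_def \<epsilon>_def)
  have n: "norm (stereo (\<epsilon> i) t) = 1" for i t by (rule norm_stereo[OF e])
  have sW: "stereo (\<epsilon> i) t \<in> W" for i t using E'(2) n[of i t] by auto
  have G\<phi>: "G (\<phi> i t) = stereo (\<epsilon> i) t" for i t unfolding \<phi> by (rule E'(6)) (simp add: n)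
  have sm: "smooth_on_open UNIV (\<phi> i)" for i unfolding \<phi>
    by (rule smooth_on_open_compose[OF smooth_stereo E'(1)]) (use sW in auto)
  have \<phi>Z: "\<phi> i ` UNIV \<subseteq> Z" for i unfolding \<phi> Z by (auto simp: n)
  have inj: "inj (\<phi> i)" for i
    using inj_stereo[OF e[of i]] G\<phi>[of i] by (metis injD injI)
  have pb: "pullback3 \<sigma> (\<phi> i) t = 2 powr (1/3) * cmod (cdet (frechet_derivative F (at (stereo (\<epsilon> i) t)))) powr (4/3) * (8 / (1 + t \<bullet> t) ^ 3)" for i t
    using positive_chart_pullback(4)[OF \<rho> \<sigma> E Z sm[of i] \<phi>Z[of i] UNIV_I, of t]
    unfolding G\<phi> vol_form_stereo[OF e] .
  have cd: "cdet (frechet_derivative F (at (stereo (\<epsilon> i) t))) \<noteq> 0" for i t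
    by (rule extended_biholomorphism_cdet(2)[OF E]) (simp add: n)
  have pos: "pullback3 \<sigma> (\<phi> i) t > 0" for i t
    unfolding pb using stereo_denominator[of t] cd by simp
  have nz: "1 + t \<bullet> t \<noteq> 0" for t :: "real^3" using stereo_denominator[of t] by simp
  have cont: "continuous_on UNIV (pullback3 \<sigma> (\<phi> i))" for i
    unfolding pb[abs_def]
    by (intro continuous_intros continuous_on_compose2[OF jacobian_continuous[OF E] smooth_on_openD(4)[OF smooth_stereo]])
       (use sW cd nz in auto)
  have int: "set_integrable lborel (A i) (pullback3 \<sigma> (\<phi> i))" for i
  proof (rule set_integrable_subset)
    show "set_integrable lborel (cball 0 1) (pullback3 \<sigma> (\<phi> i))"
      unfolding set_integrable_def by (rule borel_integrable_compact[OF compact_cball continuous_on_subset[OF cont]]) simp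
  qed (auto simp: A_def)
  have Im: "z \<in> \<phi> 0 ` A 0 \<longleftrightarrow> z \<in> Z \<and> real_coords (G z) $ 4 \<ge> 0" "z \<in> \<phi> 1 ` A 1 \<longleftrightarrow> z \<in> Z \<and> real_coords (G z) $ 4 < 0" for z
  proof -
    have tt: "norm t \<le> 1 \<longleftrightarrow> t \<bullet> t \<le> 1" "norm t < 1 \<longleftrightarrow> t \<bullet> t < 1" for t :: "real^3"
      by (simp_all add: norm_le_square norm_lt_square)
    show "z \<in> \<phi> 0 ` A 0 \<longleftrightarrow> z \<in> Z \<and> real_coords (G z) $ 4 \<ge> 0"
    proof
      assume "z \<in> \<phi> 0 ` A 0"
      then obtain t where t: "t \<bullet> t \<le> 1" "z = \<phi> 0 t" by (auto simp: A_def tt)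
      have "real_coords (G z) $ 4 \<ge> 0" unfolding t(2) G\<phi> stereo_coords using t(1) by (simp add: \<epsilon>_def)
      thus "z \<in> Z \<and> real_coords (G z) $ 4 \<ge> 0" using \<phi>Z t(2) by auto
    next
      assume z: "z \<in> Z \<and> real_coords (G z) $ 4 \<ge> 0"
      then obtain x where x: "norm x = 1" "z = F x" using Z by auto
      have Gz: "G z = x" using E'(6)[of x] x by simp
      obtain t where t: "stereo (\<epsilon> 0) t = x" "1 - t \<bullet> t = (1 + t \<bullet> t) * (\<epsilon> 0 * real_coords x $ 4)"
        by (rule stereo_covers[OF x(1) e[of 0]]) (use z Gz in \<open>simp add: \<epsilon>_def\<close>)
      have "1 - t \<bullet> t \<ge> 0" unfolding t(2) using z Gz stereo_denominator[of t] by (simp add: \<epsilon>_def)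
      thus "z \<in> \<phi> 0 ` A 0" using t(1) x(2) by (auto simp: A_def tt \<phi> intro!: image_eqI[of _ _ t])
    qed
    show "z \<in> \<phi> 1 ` A 1 \<longleftrightarrow> z \<in> Z \<and> real_coords (G z) $ 4 < 0"
    proof
      assume "z \<in> \<phi> 1 ` A 1"
      then obtain t where t: "t \<bullet> t < 1" "z = \<phi> 1 t" by (auto simp: A_def tt)
      have "real_coords (G z) $ 4 < 0" unfolding t(2) G\<phi> stereo_coords using t(1) stereo_denominator[of t] by (simp add: \<epsilon>_def divide_less_0_iff)
      thus "z \<in> Z \<and> real_coords (G z) $ 4 < 0" using \<phi>Z t(2) by auto
    next
      assume z: "z \<in> Z \<and> real_coords (G z) $ 4 < 0"
      then obtain x where x: "norm x = 1" "z = F x" using Z by auto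
      have Gz: "G z = x" using E'(6)[of x] x by simp
      obtain t where t: "stereo (\<epsilon> 1) t = x" "1 - t \<bullet> t = (1 + t \<bullet> t) * (\<epsilon> 1 * real_coords x $ 4)"
        by (rule stereo_covers[OF x(1) e[of 1]]) (use z Gz in \<open>simp add: \<epsilon>_def\<close>)
      have "1 - t \<bullet> t > 0" unfolding t(2) using z Gz stereo_denominator[of t] by (simp add: \<epsilon>_def mult_pos_neg)
      thus "z \<in> \<phi> 1 ` A 1" using t(1) x(2) by (auto simp: A_def tt \<phi> intro!: image_eqI[of _ _ t])
    qed
  qed
  have A2: "A i = {}" if "i \<noteq> 0" "i \<noteq> 1" for i using that by (simp add: A_def)
  have d01: "\<phi> 0 ` A 0 \<inter> \<phi> 1 ` A 1 = {}"
  proof (rule equals0I)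
    fix z assume "z \<in> \<phi> 0 ` A 0 \<inter> \<phi> 1 ` A 1"
    hence "real_coords (G z) $ 4 \<ge> 0" "real_coords (G z) $ 4 < 0" using Im[of z] by blast+
    thus False by linarith
  qed
  have disj: "disjoint_family (\<lambda>i. \<phi> i ` A i)"
  proof (unfold disjoint_family_on_def, intro ballI impI)
    fix i j :: nat assume "i \<noteq> j"
    then consider "i = 0" "j = 1" | "i = 1" "j = 0" | "A i = {}" | "A j = {}" using A2 by metis
    thus "\<phi> i ` A i \<inter> \<phi> j ` A j = {}" using d01 by cases (simp_all only: Int_commute image_empty Int_empty_left Int_empty_right)
  qed
  have un: "(\<Union>i. \<phi> i ` A i) = Z"
  proof (intro equalityI subsetI)
    fix z assume "z \<in> Z"
    hence "z \<in> \<phi> 0 ` A 0 \<or> z \<in> \<phi> 1 ` A 1" unfolding Im by auto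
    thus "z \<in> (\<Union>i. \<phi> i ` A i)" by blast
  qed (use \<phi>Z in blast)
  have "(\<lambda>i. set_lebesgue_integral lborel (A i) (pullback3 \<sigma> (\<phi> i))) sums
     (\<Sum>i\<in>{0,1}. set_lebesgue_integral lborel (A i) (pullback3 \<sigma> (\<phi> i)))"
    by (rule sums_finite) (use A2 in \<open>auto simp: set_lebesgue_integral_def\<close>)
  moreover have "positive_chart Z \<sigma> UNIV (\<phi> i)" "A i \<in> sets borel" for i
    using sm \<phi>Z inj pos by (auto simp: positive_chart_def A_def)
  ultimately have "has_form_integral \<sigma> Z (\<Sum>i\<in>{0,1}. set_lebesgue_integral lborel (A i) (pullback3 \<sigma> (\<phi> i)))"
    unfolding has_form_integral_def using int disj un
    by (intro exI[of _ \<phi>] exI[of _ "\<lambda>_. UNIV"] exI[of _ A]) auto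
  thus ?thesis by (rule that)
qed

lemma fefferman_measure_eq:
  assumes E: "extended_biholomorphism F W G V" and Z: "Z = F ` sphere 0 1"
  shows "fefferman_measure Z = 4 * 2 powr (1/3) * integral (ball 0 1) (radial_jacobian F)"
proof -
  obtain \<rho> where \<rho>: "strongly_psc_defining_function \<rho> Z" by (rule exists_strongly_psc_defining_function[OF E Z])
  obtain \<sigma> where \<sigma>: "fefferman_form \<rho> Z \<sigma>" by (rule exists_fefferman_form[OF \<rho>])
  obtain I where I: "has_form_integral \<sigma> Z I" by (rule exists_form_integral[OF \<rho> \<sigma> E Z])
  show ?thesis unfolding fefferman_measure_def
    by (rule the_equality) (use \<rho> \<sigma> I has_form_integral_value[OF _ _ E Z] in blast)+
qed

section \<open>The enclosed volume\<close>

lemma extended_biholomorphism_inj: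
  assumes "extended_biholomorphism F W G V"
  shows "inj_on F (cball 0 1)"
  by (rule inj_on_inverseI[where g = G]) (use extended_biholomorphismD(6)[OF assms] in simp)

text \<open>The image of the closed ball is homeomorphic to a compact convex set, so its complement
  is connected, and it is unbounded. As the image of the open ball is open, no connected set
  avoiding the image of the sphere meets both; the bounded components therefore lie in the image of
  the open ball.\<close>

lemma inside_image_sphere:
  assumes E: "extended_biholomorphism F W G V"
  shows "inside (F ` sphere 0 1) = F ` ball 0 1"
proof -
  note E' = extended_biholomorphismD[OF E]
  let ?Z = "F ` sphere 0 1" and ?U = "F ` ball 0 1" and ?K = "F ` cball 0 1"
  have cF: "continuous_on (cball 0 1) F" by (rule continuous_on_subset[OF smooth_on_openD(4)[OF E'(1)] E'(2)])
  have K: "compact ?K" by (rule compact_continuous_image[OF cF compact_cball])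
  have "cball (0::complex^2) 1 = sphere 0 1 \<union> ball 0 1" by auto
  hence ZU: "?K = ?Z \<union> ?U" by (simp only: image_Un)
  have disj: "?Z \<inter> ?U = {}"
  proof -
    have "?Z \<inter> ?U = F ` (sphere 0 1 \<inter> ball 0 1)"
      by (rule inj_on_image_Int[OF extended_biholomorphism_inj[OF E] sphere_cball ball_subset_cball, symmetric])
    moreover have "sphere 0 1 \<inter> ball 0 1 = ({} :: (complex^2) set)" by auto
    ultimately show ?thesis by (simp only: image_empty)
  qed
  have "homeomorphism (cball 0 1) ?K F G"
  proof (rule homeomorphismI[OF cF continuous_on_subset[OF smooth_on_openD(4)[OF E'(4)] E'(5)]])
    have inv: "G (F x) = x" if "x \<in> cball 0 1" for x using E'(6) that by simp
    show "G ` ?K \<subseteq> cball 0 1"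
    proof (rule image_subsetI)
      fix y assume "y \<in> ?K"
      then obtain x where x: "y = F x" "x \<in> cball 0 1" by (rule imageE)
      show "G y \<in> cball 0 1" unfolding x(1) inv[OF x(2)] by (rule x(2))
    qed
    show "G (F x) = x" if "x \<in> cball 0 1" for x by (rule inv[OF that])
    show "F (G y) = y" if y: "y \<in> ?K" for y
    proof -
      obtain x where x: "y = F x" "x \<in> cball 0 1" using y by (rule imageE)
      show ?thesis unfolding x(1) inv[OF x(2)] ..
    qed
  qed (rule subset_refl)
  hence "cball (0::complex^2) 1 homeomorphic ?K"
    unfolding homeomorphic_def by (intro exI)
  hence hom: "?K homeomorphic cball (0::complex^2) 1"
    by (rule homeomorphic_sym[THEN iffD1])
  have connK: "connected (- ?K)"
    by (rule connected_complement_homeomorphic_convex_compact[OF hom convex_cball compact_cball]) simp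
  have bU: "bounded ?U" using compact_imp_bounded[OF K] by (rule bounded_subset) auto
  show ?thesis
  proof (intro equalityI subsetI)
    fix x assume x: "x \<in> ?U"
    hence xZ: "x \<in> - ?Z" using disj by auto
    have "connected_component_set (- ?Z) x \<subseteq> ?U"
    proof (rule ccontr)
      let ?C = "connected_component_set (- ?Z) x"
      assume "\<not> ?C \<subseteq> ?U"
      moreover have sub: "?C \<subseteq> - ?Z" by (rule connected_component_subset)
      ultimately have "- ?K \<inter> ?C \<noteq> {}" using ZU by blast
      moreover have "?U \<inter> ?C \<noteq> {}" using x xZ using connected_component_refl[of x "- ?Z"] by blast
      moreover have "?C \<subseteq> ?U \<union> - ?K" using sub ZU by blast
      moreover have "?U \<inter> - ?K \<inter> ?C = {}" using ZU by blast
      moreover have "open (- ?K)" by (rule open_Compl[OF compact_imp_closed[OF K]])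
      ultimately show False
        using connectedD[OF connected_connected_component[of "- ?Z" x] E'(7), of "- ?K"] by blast
    qed
    thus "x \<in> inside ?Z" unfolding inside_def using xZ bU bounded_subset by auto
  next
    fix x assume "x \<in> inside ?Z"
    hence xZ: "x \<notin> ?Z" and b: "bounded (connected_component_set (- ?Z) x)" by (auto simp: inside_def)
    show "x \<in> ?U"
    proof (rule ccontr)
      assume "x \<notin> ?U"
      hence "x \<in> - ?K" using xZ ZU by auto
      moreover have "- ?K \<subseteq> - ?Z" by auto
      ultimately have "- ?K \<subseteq> connected_component_set (- ?Z) x"
        using connK by (intro connected_component_maximal) auto
      hence "bounded (- ?K)" using b bounded_subset by blast
      thus False using cobounded_imp_unbounded[of "?K"] compact_imp_bounded[OF K] by simp
    qed
  qed
qed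

lemma enclosed_volume_eq:
  assumes E: "extended_biholomorphism F W G V"
  shows "enclosed_volume (F ` sphere 0 1) = integral (ball 0 1) (\<lambda>x. (cmod (cdet (frechet_derivative F (at x))))\<^sup>2)"
    and "enclosed_volume (F ` sphere 0 1) > 0"
proof -
  note E' = extended_biholomorphismD[OF E]
  let ?J = "\<lambda>x. (cmod (cdet (frechet_derivative F (at x))))\<^sup>2"
  have "continuous_on (cball 0 1) ?J"
    by (intro continuous_intros continuous_on_subset[OF jacobian_continuous[OF E] E'(2)])
  hence "set_integrable lborel (cball 0 1) ?J"
    unfolding set_integrable_def by (intro borel_integrable_compact compact_cball)
  hence "set_integrable lborel (ball 0 1) ?J" by (rule set_integrable_subset) auto
  hence Jint: "?J absolutely_integrable_on ball 0 1"
    unfolding set_integrable_def using integrable_completion[of "\<lambda>x. indicator (ball 0 1) x *\<^sub>R ?J x" lborel]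
    by (auto dest: borel_measurable_integrable)
  have "(\<lambda>x. 1::real) absolutely_integrable_on (F ` ball 0 1) \<and> integral (F ` ball 0 1) (\<lambda>x. 1::real) = integral (ball 0 1) ?J"
  proof (subst c2_change_of_variables[where g' = "\<lambda>x. frechet_derivative F (at x)" and S = "ball 0 1", symmetric])
    show "ball (0::complex^2) 1 \<in> sets lebesgue" by simp
    show "(F has_derivative frechet_derivative F (at x)) (at x within ball 0 1)" if "x \<in> ball 0 1" for x
      by (rule has_derivative_at_withinI[OF smooth_on_openD(2)[OF E'(1)]]) (use E'(2) that in auto)
    show "inj_on F (ball 0 1)" by (rule inj_on_subset[OF extended_biholomorphism_inj[OF E]]) auto
  qed (use E'(3) Jint in auto)
  hence lm: "F ` ball 0 1 \<in> lmeasurable" and i: "integral (F ` ball 0 1) (\<lambda>x. 1::real) = integral (ball 0 1) ?J"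
    by (auto simp: lmeasurable_iff_integrable_on dest: set_lebesgue_integral_eq_integral(1))
  show "enclosed_volume (F ` sphere 0 1) = integral (ball 0 1) ?J"
    unfolding enclosed_volume_def inside_image_sphere[OF E] lmeasure_integral[OF lm] i ..
  have "F 0 \<in> F ` ball 0 1" by simp
  then obtain r where r: "r > 0" "ball (F 0) r \<subseteq> F ` ball 0 1" using E'(7) open_contains_ball by metis
  have "0 < measure lebesgue (ball (F 0) r)" using content_ball_pos[OF r(1), of "F 0"] by simp
  also have "\<dots> \<le> measure lebesgue (F ` ball 0 1)"
    by (rule measure_mono_fmeasurable[OF r(2) _ lm]) simp
  finally show "enclosed_volume (F ` sphere 0 1) > 0"
    unfolding enclosed_volume_def inside_image_sphere[OF E] .
qed

section \<open>The holomorphic cube root of the Jacobian\<close>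

text \<open>Polarisation of \<open>second_derivative_complex_line\<close> controls only the sum Q v
  (\<i> w) + Q w (\<i> v). Replacing v by \<i> v, with linearity in the first slot clear from that
  of F', gives a second relation, and the two together determine Q v (\<i> w).\<close>

lemma second_derivative_complex_linear:
  fixes F :: "complex^2 \<Rightarrow> complex^2"
  assumes F: "smooth_on_open W F" and O: "open O'" "O' \<subseteq> W"
    and cl: "\<And>x. x \<in> O' \<Longrightarrow> complex_linear (frechet_derivative F (at x))" and x: "x \<in> O'"
  shows "frechet_derivative (\<lambda>x. frechet_derivative F (at x) v) (at x) (c *s w)
     = c *s frechet_derivative (\<lambda>x. frechet_derivative F (at x) v) (at x) w"
proof -
  define Q where "Q v w = frechet_derivative (\<lambda>x. frechet_derivative F (at x) v) (at x) w" for v w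
  have xW: "x \<in> W" using x O by auto
  note F2 = smooth_on_openD(2)[OF smooth_on_openD(3)[OF F] xW]
  have lin: "linear (Q v)" for v unfolding Q_def[abs_def] using has_derivative_linear[OF F2] by simp
  have lin': "linear (\<lambda>v. Q v w)" for w unfolding Q_def by (rule second_derivative_linear_left[OF F xW])
  note add = linear_add[OF lin] linear_add[OF lin']
  have i1: "Q (\<i> *s v) w = \<i> *s Q v w" for v w
  proof -
    have "((\<lambda>x. \<i> *s frechet_derivative F (at x) v) has_derivative (\<lambda>h. \<i> *s Q v h)) (at x)"
      unfolding Q_def by (rule bounded_linear.has_derivative[OF bounded_linear_cscale F2])
    hence "((\<lambda>x. frechet_derivative F (at x) (\<i> *s v)) has_derivative (\<lambda>h. \<i> *s Q v h)) (at x)"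
      by (rule has_derivative_transform_within_open[OF _ O(1) x]) (use cl in \<open>auto simp: complex_linear_def\<close>)
    from frechet_derivative_eqI[OF this] show ?thesis by (simp add: Q_def)
  qed
  have i0: "Q w (\<i> *s w) = \<i> *s Q w w" for w
    unfolding Q_def by (rule second_derivative_complex_line[OF F O cl x])
  have neg: "Q w (- v) = - Q w v" for v w by (rule linear_neg[OF lin])
  have i2: "Q v (\<i> *s w) = \<i> *s Q v w" for v w
  proof -
    have ia: "\<i> *s (v + w) = \<i> *s v + \<i> *s w" for v w :: "complex^2" by (simp add: vec_eq_iff algebra_simps)
    have e: "Q v (\<i> *s w) + Q w (\<i> *s v) = \<i> *s Q v w + \<i> *s Q w v" for v w
      using i0[of "v + w"] unfolding ia add i0 by (simp add: add_ac)
    show ?thesis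
    proof (subst vec_eq_iff, intro allI)
      fix j
      from e[of "\<i> *s v" w] have e': "\<i> *s Q v (\<i> *s w) - Q w v = - Q v w + \<i> *s Q w (\<i> *s v)"
        unfolding i1 cscale_simps neg by simp
      from arg_cong[OF e[of v w], of "\<lambda>u. u $ j"] arg_cong[OF e', of "\<lambda>u. u $ j"]
      show "Q v (\<i> *s w) $ j = (\<i> *s Q v w) $ j"
        by (simp add: complex_eq_iff)
    qed
  qed
  have "c *s w = Re c *\<^sub>R w + Im c *\<^sub>R (\<i> *s w)" for w :: "complex^2"
    by (simp add: vec_eq_iff complex_eq_iff)
  hence "Q v (c *s w) = c *s Q v w" unfolding \<open>\<And>w. c *s w = Re c *\<^sub>R w + Im c *\<^sub>R (\<i> *s w)\<close>
    by (simp only: linear_add[OF lin] linear_scale[OF lin] i2)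
  thus ?thesis unfolding Q_def .
qed

text \<open>\<open>L\<close> is only a continuous logarithm. Near p it differs from L p by less than
  pi, so L x - L p is the principal logarithm of g x / g p, and exp (L x / 3) becomes a holomorphic
  function of g x.\<close>

lemma has_derivative_exp_third_log:
  fixes g L :: "'a::real_normed_vector \<Rightarrow> complex"
  assumes L: "continuous_on S L" "open S" "p \<in> S" and g: "\<And>x. x \<in> S \<Longrightarrow> g x = exp (L x)"
    and g': "(g has_derivative g') (at p)"
  shows "((\<lambda>x. exp (L x / 3)) has_derivative (\<lambda>v. exp (L p / 3) * (g' v / (3 * g p)))) (at p)"
proof -
  have gp: "g p \<noteq> 0" using g[OF L(3)] by simp
  have "((\<lambda>x. exp (L p / 3) * exp (Ln (g x / g p) / 3)) has_derivative (\<lambda>v. exp (L p / 3) * (g' v / (3 * g p)))) (at p)"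
  proof -
    have "((\<lambda>w. exp (L p / 3) * exp (Ln (w / g p) / 3)) has_field_derivative exp (L p / 3) * (1 / (3 * g p))) (at (g p))"
      using gp by (auto intro!: derivative_eq_intros)
    hence "((\<lambda>w. exp (L p / 3) * exp (Ln (w / g p) / 3)) has_derivative (\<lambda>h. exp (L p / 3) * (1 / (3 * g p)) * h)) (at (g p))"
      unfolding has_field_derivative_def .
    from has_derivative_compose[OF g' this] show ?thesis by simp
  qed
  moreover obtain X where X: "open X" "p \<in> X" "X \<subseteq> S" "\<And>x. x \<in> X \<Longrightarrow> dist (L x) (L p) < pi"
  proof -
    have "open (S \<inter> L -` ball (L p) pi)" by (rule continuous_open_preimage[OF L(1,2) open_ball])
    thus ?thesis by (rule that) (use L(3) in \<open>auto simp: dist_commute\<close>)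
  qed
  ultimately show ?thesis
  proof (rule_tac has_derivative_transform_within_open[OF _ X(1,2)])
    fix x assume x: "x \<in> X"
    hence "cmod (L x - L p) < pi" using X(4) by (simp add: dist_norm)
    hence "\<bar>Im (L x - L p)\<bar> < pi" using abs_Im_le_cmod[of "L x - L p"] by linarith
    hence "Ln (exp (L x - L p)) = L x - L p" by (intro Ln_exp) auto
    moreover have "g x / g p = exp (L x - L p)" using g x X(3) L(3) by (auto simp: exp_diff)
    ultimately show "exp (L p / 3) * exp (Ln (g x / g p) / 3) = exp (L x / 3)"
      by (simp add: exp_add[symmetric] diff_divide_distrib)
  qed
qed

text \<open>The closed ball is contractible, so the nonvanishing Jacobian g has a logarithm that is
  continuous up to the sphere, and so is the cube root \<open>e\<close>. The two densities are |g|^2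
  = |e|^6 and |g|^(4/3) = |e|^4.\<close>

lemma volume_le_fefferman:
  assumes E: "extended_biholomorphism F W G V"
  shows "2 / pi\<^sup>2 * integral (ball 0 1) (\<lambda>x. (cmod (cdet (frechet_derivative F (at x))))\<^sup>2)
    \<le> 2 * sqrt (2 / pi\<^sup>2 * integral (ball 0 1) (radial_jacobian F)) ^ 3"
proof -
  note E' = extended_biholomorphismD[OF E]
  define g where "g x = cdet (frechet_derivative F (at x))" for x
  have bW: "ball 0 1 \<subseteq> W" using E'(2) by auto
  have gc: "continuous_on (cball 0 1) g" unfolding g_def by (rule continuous_on_subset[OF jacobian_continuous[OF E] E'(2)])
  have g0: "g x \<noteq> 0" if "x \<in> cball 0 1" for x unfolding g_def by (rule extended_biholomorphism_cdet(2)[OF E]) (use that in simp)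
  obtain L where L: "continuous_on (cball 0 1) L" "\<And>x. x \<in> cball 0 1 \<Longrightarrow> g x = exp (L x)"
    using continuous_logarithm_on_contractible[OF gc convex_imp_contractible[OF convex_cball] g0] by metis
  define e where "e x = exp (L x / 3)" for x
  have ec: "continuous_on (cball 0 1) e" unfolding e_def by (intro continuous_intros L) simp
  have e3: "e x ^ 3 = g x" if "x \<in> cball 0 1" for x
    using L(2)[OF that] by (simp add: e_def exp_of_nat_mult[symmetric])
  define D2 where "D2 v x w = frechet_derivative (\<lambda>x. frechet_derivative F (at x) v) (at x) w" for v x w
  define D1 where "D1 v x = frechet_derivative F (at x) v" for v x
  define g' where "g' x v = D1 (axis 1 1) x $ 1 * D2 (axis 2 1) x v $ 2 + D2 (axis 1 1) x v $ 1 * D1 (axis 2 1) x $ 2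
      - (D1 (axis 2 1) x $ 1 * D2 (axis 1 1) x v $ 2 + D2 (axis 2 1) x v $ 1 * D1 (axis 1 1) x $ 2)" for x v
  have dg: "(g has_derivative g' x) (at x)" if "x \<in> W" for x
    unfolding g_def cdet_def g'_def D1_def D2_def
    by (intro has_derivative_diff has_derivative_mult bounded_linear.has_derivative[OF bounded_linear_vec_nth]
         smooth_on_openD(2)[OF smooth_on_openD(3)[OF E'(1)] that])
  define D where "D x v = e x * (g' x v / (3 * g x))" for x v
  have dE: "(e has_derivative D x) (at x)" if x: "x \<in> ball 0 1" for x
    unfolding e_def D_def
    by (rule has_derivative_exp_third_log[OF continuous_on_subset[OF L(1)] open_ball x]) (use L(2) dg x bW in auto)
  have D2c: "D2 v x (c *s w) = c *s D2 v x w" if "x \<in> ball 0 1" for v x c w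
    unfolding D2_def by (rule second_derivative_complex_linear[OF E'(1) open_ball bW E'(3) that])
  have "D x (c *s v) = c * D x v" if "x \<in> ball 0 1" for x c v
    unfolding D_def g'_def D2c[OF that] by (simp add: algebra_simps add_divide_distrib diff_divide_distrib)
  moreover have "continuous_on (ball 0 1) (\<lambda>x. D x v)" for v
    unfolding D_def g'_def D1_def D2_def
    by (intro continuous_intros continuous_on_subset[OF ec] continuous_on_subset[OF gc]
        continuous_on_subset[OF smooth_on_openD(4)[OF smooth_on_openD(3)[OF E'(1)]] bW]
        continuous_on_subset[OF smooth_on_openD(4)[OF smooth_on_openD(3)[OF smooth_on_openD(3)[OF E'(1)]]] bW])
       (use g0 in auto)
  ultimately have "2 / pi\<^sup>2 * integral (ball 0 1) (\<lambda>z. cmod (e z) ^ 6)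
     \<le> 2 * sqrt (2 / pi\<^sup>2 * integral (ball 0 1) (\<lambda>z. cmod (e ((1 / norm z) *\<^sub>R z)) ^ 4)) ^ 3"
    using bergman_hardy_ball[OF dE _ _ ec] by blast
  also have "integral (ball 0 1) (\<lambda>z. cmod (e z) ^ 6) = integral (ball 0 1) (\<lambda>x. (cmod (cdet (frechet_derivative F (at x))))\<^sup>2)"
  proof (rule integral_cong)
    fix z :: "complex^2" assume "z \<in> ball 0 1"
    hence "g z = e z ^ 3" using e3[of z] by simp
    thus "cmod (e z) ^ 6 = (cmod (cdet (frechet_derivative F (at z))))\<^sup>2"
      unfolding g_def[symmetric] by (simp add: norm_power flip: power_mult)
  qed
  also have "(\<lambda>z. cmod (e ((1 / norm z) *\<^sub>R z)) ^ 4) = radial_jacobian F"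
  proof
    fix z :: "complex^2"
    define x where "x = (1 / norm z) *\<^sub>R z"
    have "x \<in> cball 0 1" by (cases "z = 0") (auto simp: x_def)
    hence ge: "g x = e x ^ 3" using e3[of x] by simp
    have epos: "cmod (e x) > 0" by (simp add: e_def)
    have "cmod (g x) powr (4/3) = (cmod (e x) powr real 3) powr (4/3)"
      by (simp only: ge norm_power powr_realpow[OF epos])
    also have "\<dots> = cmod (e x) powr real 4" by (simp only: powr_powr) simp
    also have "\<dots> = cmod (e x) ^ 4" by (rule powr_realpow[OF epos])
    finally show "cmod (e ((1 / norm z) *\<^sub>R z)) ^ 4 = radial_jacobian F z"
      by (simp add: radial_jacobian_def g_def x_def)
  qed
  finally show ?thesis .
qed

section \<open>Assembly of the isoperimetric inequality\<close>

lemma extension_of_biholomorphism: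
  assumes H: "diffeomorphism_onto_image (cball 0 1) H" "biholomorphic_on (ball 0 1) H"
  obtains F W G V where "extended_biholomorphism F W G V" "\<And>x. x \<in> cball 0 1 \<Longrightarrow> F x = H x"
proof -
  have injH: "inj_on H (cball 0 1)" using H(1) by (simp add: diffeomorphism_onto_image_def)
  have sH: "smooth_map_on (cball 0 1) H" "smooth_map_on (H ` cball 0 1) (inv_into (cball 0 1) H)"
    using H(1) by (simp_all add: diffeomorphism_onto_image_def)
  from sH(1) obtain W F where F: "cball 0 1 \<subseteq> W" "smooth_on_open W F" and "\<forall>x\<in>cball 0 1. F x = H x"
    unfolding smooth_map_on_def by (elim exE conjE)
  hence F3: "F x = H x" if "x \<in> cball 0 1" for x using that by blast
  from sH(2) obtain V G where G: "H ` cball 0 1 \<subseteq> V" "smooth_on_open V G" and "\<forall>y\<in>H ` cball 0 1. G y = inv_into (cball 0 1) H y"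
    unfolding smooth_map_on_def by (elim exE conjE)
  hence G3: "G y = inv_into (cball 0 1) H y" if "y \<in> H ` cball 0 1" for y using that by blast
  have FH: "F ` cball 0 1 = H ` cball 0 1" "F ` ball 0 1 = H ` ball 0 1"
    by (rule image_cong[OF refl F3], simp)+
  have bh: "inj_on H (ball 0 1)" "holomorphic_map_on (ball 0 1) H" "holomorphic_map_on (H ` ball 0 1) (inv_into (ball 0 1) H)"
    using H(2) by (auto simp: biholomorphic_on_def)
  have tr: "complex_linear (frechet_derivative f (at p))"
    if h: "holomorphic_map_on S h" "p \<in> S" "\<And>x. x \<in> S \<Longrightarrow> f x = h x" for S and f h :: "complex^2 \<Rightarrow> complex^2" and p
  proof -
    obtain L where L: "(h has_derivative L) (at p)" "\<And>c v. L (c *s v) = c *s L v"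
      using h unfolding holomorphic_map_on_def by blast
    have "(f has_derivative L) (at p)"
      by (rule has_derivative_transform_within_open[OF L(1)]) (use h in \<open>auto simp: holomorphic_map_on_def\<close>)
    from frechet_derivative_eqI[OF this] has_derivative_linear[OF this] show ?thesis by (simp add: complex_linear_def L(2))
  qed
  have "extended_biholomorphism F W G V"
    unfolding extended_biholomorphism_def FH
  proof (intro conjI ballI F(1,2) G(1,2))
    fix x :: "complex^2" assume "x \<in> ball 0 1"
    thus "complex_linear (frechet_derivative F (at x))" by (intro tr[OF bh(2)] F3) auto
  next
    fix x :: "complex^2" assume x: "x \<in> cball 0 1"
    thus "G (F x) = x" using F3[OF x] G3[of "H x"] inv_into_f_f[OF injH x] by auto
  next
    show "open (H ` ball 0 1)" using bh(3) by (simp add: holomorphic_map_on_def)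
  next
    fix y assume y: "y \<in> H ` ball 0 1"
    show "complex_linear (frechet_derivative G (at y))"
    proof (rule tr[OF bh(3) y])
      \<comment> \<open>The inverses of H over the open and over the closed ball agree by
        injectivity.\<close>
      fix z assume "z \<in> H ` ball 0 1"
      then obtain x where x: "x \<in> ball 0 1" "z = H x" by auto
      have xc: "x \<in> cball 0 1" using x by auto
      have "G z = x" using G3[of z] inv_into_f_f[OF injH xc] x(2) xc by auto
      thus "G z = inv_into (ball 0 1) H z" using inv_into_f_f[OF bh(1) x(1)] x(2) by simp
    qed
  qed
  thus ?thesis by (rule that[OF _ F3])
qed

theorem theorem22:
  fixes H :: "complex^2 \<Rightarrow> complex^2" and Z :: "(complex^2) set"
  assumes "diffeomorphism_onto_image (cball 0 1) H"
    and "biholomorphic_on (ball 0 1) H"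
    and "Z = H ` sphere 0 1"
  shows "isoperimetric_quotient Z \<ge> 4 * pi"
proof -
  obtain F W G V where E: "extended_biholomorphism F W G V" and F: "\<And>x. x \<in> cball 0 1 \<Longrightarrow> F x = H x"
    using extension_of_biholomorphism[OF assms(1,2)] by blast
  have Z: "Z = F ` sphere 0 1" unfolding assms(3) using F by (intro image_cong) auto
  define X where "X = integral (ball 0 1) (radial_jacobian F)"
  define v where "v = enclosed_volume Z"
  have X0: "X \<ge> 0" unfolding X_def
    by (intro integral_nonneg set_lebesgue_integral_eq_integral(1)[OF radial_jacobian_integrable[OF E]]) (simp add: radial_jacobian_def)
  have v: "v > 0" "2 / pi\<^sup>2 * v \<le> 2 * sqrt (2 / pi\<^sup>2 * X) ^ 3"
    using enclosed_volume_eq[OF E] volume_le_fefferman[OF E] by (simp_all add: v_def Z X_def)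
  have "sqrt (2 / pi\<^sup>2 * X) = sqrt 2 * sqrt X / pi"
    by (simp add: real_sqrt_mult real_sqrt_divide)
  hence "2 / pi\<^sup>2 * v \<le> 2 * (sqrt 2 * sqrt X / pi) ^ 3" using v(2) by simp
  also have "(sqrt 2 * sqrt X / pi) ^ 3 = 2 * sqrt 2 * (sqrt X) ^ 3 / pi ^ 3"
  proof -
    have "sqrt 2 ^ 3 = 2 * sqrt (2::real)" by (simp add: power3_eq_cube)
    thus ?thesis by (simp only: power_divide power_mult_distrib)
  qed
  finally have "v * pi \<le> 2 * sqrt 2 * (sqrt X) ^ 3"
    by (simp add: field_simps power2_eq_square power3_eq_cube)
  hence "4 * pi * v \<le> 8 * sqrt 2 * (sqrt X) ^ 3" by (simp add: mult_ac)
  \<comment> \<open>Here 4^(3/2) = 8 and (2^(1/3))^(3/2) = sqrt 2: the 4 comes from the cones over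
    the sphere, the root of 2 from Fefferman's normalisation.\<close>
  also have "8 * sqrt 2 * (sqrt X) ^ 3 = (4 * 2 powr (1/3) * X) powr (3/2)"
  proof -
    have "(4::real) powr (3/2) = (2 powr 2) powr (3/2)" by simp
    also have "\<dots> = 2 powr 3" by (simp only: powr_powr) simp
    finally have "(4::real) powr (3/2) = 8" by simp
    moreover have "(2 powr (1/3)) powr (3/2) = sqrt (2::real)" by (simp add: powr_powr powr_half_sqrt)
    moreover have "X powr (3/2) = (sqrt X) ^ 3"
    proof (cases "X = 0")
      case False
      hence "X > 0" using X0 by simp
      hence "(sqrt X) ^ 3 = (X powr (1/2)) powr real 3"
        by (simp only: powr_half_sqrt powr_realpow real_sqrt_gt_zero less_imp_le)
      thus ?thesis by (simp only: powr_powr) simp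
    qed simp
    ultimately show ?thesis using X0 by (simp add: powr_mult)
  qed
  finally have "4 * pi * v \<le> fefferman_measure Z powr (3/2)"
    unfolding fefferman_measure_eq[OF E Z] X_def .
  thus ?thesis unfolding isoperimetric_quotient_def v_def[symmetric] using v(1) by (simp add: field_simps)
qed

end
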